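(* Let $n\ge1$, $\nu:=q-q^{-1}$, let $\Delta^+=\{\alpha_{ij}=\varepsilon_i-\varepsilon_j\mid 1\le i<j\le n+1\}$, and let $\Lambda^{(0,\bullet)}_q$ be the quantum exterior algebra associated to the tangent space $T^{(0,1)}$ of $\mathcal O_q(\mathrm{SU}_{n+1})$, with degree one basis $e_{\alpha_{ij}}=e_{ji}$. Let $\leq$ be the total order on $\Delta^+$ for which $\alpha_{ij}<\alpha_{kl}$ if and only if $j<l$, or $j=l$ and $i<k$; and let $\prec$ be the partial order with $\beta\prec\gamma$ iff $\gamma-\beta$ is a $\mathbb Z_{\ge0}$-combination of positive roots. For $\beta=\alpha_{ab}$, $\gamma=\alpha_{cd}$ orthogonal put $\beta':=\alpha_{ad}$, $\gamma':=\alpha_{cb}$. Then the relations, for all $\beta\leq\gamma$ in $\Delta^+$, $$e_\beta\wedge e_\gamma=-e_\gamma\wedge e_\beta-\nu\,e_{\beta'}\wedge e_{\gamma'}\quad\text{if }(\beta,\gamma)=0\text{ and }\beta\prec\gamma,$$ $$e_\beta\wedge e_\gamma=-q^{(\beta,\gamma)}e_\gamma\wedge e_\beta\quad\text{otherwise},$$ form a full set of relations for the algebra $\Lambda^{(0,\bullet)}_q$; that is, $\Lambda^{(0,\bullet)}_q$ is the quotient of the tensor algebra of $\Lambda^{(0,1)}_q=\mathrm{span}_{\mathbb C}\{e_\beta\mid \beta\in\Delta^+\}$ by the two-sided ideal generated by these relations.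
   Context: All algebras are over $\mathbb C$. Fix $q\in\mathbb R$, $q\ne-1,0,1$. $(-,-)$ is the standard inner product on $\mathbb R^{n+1}$ with standard basis $\varepsilon_1,\dots,\varepsilon_{n+1}$; $[a,b]_c:=ab-c\,ba$. $U_q(\mathfrak{sl}_{n+1})$ is the standard Drinfeld--Jimbo algebra with generators $E_i,F_i,K_i^{\pm1}$, $i=1,\dots,n$ ($K_iE_j=q^{a_{ij}}E_jK_i$, $K_iF_j=q^{-a_{ij}}F_jK_i$, $E_iF_j-F_jE_i=\delta_{ij}\frac{K_i-K_i^{-1}}{q-q^{-1}}$, $K_i$'s commuting and invertible, quantum Serre relations; $(a_{ij})$ the type $A_n$ Cartan matrix), and coproduct $\Delta(K_i)=K_i\otimes K_i$, $\Delta(E_i)=E_i\otimes K_i+1\otimes E_i$, $\Delta(F_i)=F_i\otimes1+K_i^{-1}\otimes F_i$. $A:=\mathcal O_q(\mathrm{SU}_{n+1})$ is the Hopf algebra of matrix coefficients of the finite-dimensional type-1 representations of $U_q(\mathfrak{sl}_{n+1})$. It is generated by $u_{ij}$, $i,j=1,\dots,n+1$, with $\Delta(u_{ij})=\sum_au_{ia}\otimes u_{aj}$, $\varepsilon(u_{ij})=\delta_{ij}$; the evaluation pairing $\langle-,-\rangle$ satisfies $\langle E_i,u_{i+1,i}\rangle=1$, $\langle F_i,u_{i,i+1}\rangle=1$, $\langle K_j^{\pm1},u_{ii}\rangle=q^{\pm(\delta_{j+1,i}-\delta_{ij})}$, all other pairings of generators being zero. For $1\le i<j\le n+1$ put $E_{ji}:=[E_{j-1},[E_{j-2},[\cdots[E_{i+1},E_i]_{q^{-1}}\cdots]_{q^{-1}}]_{q^{-1}}$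 (with $E_{i+1,i}=E_i$), and $T^{(0,1)}:=\mathrm{span}_{\mathbb C}\{E_{ji}\}$. Put $A^+=\ker\varepsilon$, $a^+:=a-\varepsilon(a)1$, $I:=\{x\in A^+\mid\langle X,x\rangle=0\ \forall X\in T^{(0,1)}\}$ (a right ideal of $A$ contained in $A^+$), and $\Lambda^{(0,1)}_q:=A^+/I$, with $[-]$ denoting cosets. The elements $e_{\alpha_{ij}}:=e_{ji}:=[u_{ji}]$, $i<j$, form the basis dual to $\{E_{ji}\}$. With $$I^{(2)}:=\{[x_{(1)}^+]\otimes[x_{(2)}^+]\mid x\in I\}\subseteq\Lambda^{(0,1)}_q\otimes\Lambda^{(0,1)}_q ,$$ the quantum exterior algebra is $\Lambda^{(0,\bullet)}_q:=\mathcal T(\Lambda^{(0,1)}_q)/\langle I^{(2)}\rangle$, with multiplication denoted $\wedge$. *)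

theory Defs
  imports
    "Jordan_Normal_Form.VS_Connect"
    "HOL-Algebra.QuotRing"
    "HOL-Library.Poly_Mapping"
    "HOL-Library.Product_Plus"
begin

section \<open>Free algebras, quotients and tensor algebras\<close>

datatype 'g word = Word (letters: "'g list")

text \<open>
  The additive monoid structure on words is concatenation, so that the convolution product of
  finitely supported functions makes \<^typ>\<open>'g word \<Rightarrow>\<^sub>0 complex\<close> the free associative unital algebra
  on \<^typ>\<open>'g\<close>, and \<^typ>\<open>'g word \<times> 'g word \<Rightarrow>\<^sub>0 complex\<close> the tensor square of that algebra.
\<close>

instantiation word :: (type) monoid_add
begin
definition zero_word :: "'a word" where "zero_word = Word []"
definition plus_word :: "'a word \<Rightarrow> 'a word \<Rightarrow> 'a word"
  where "plus_word v w = Word (letters v @ letters w)"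
instance by standard (auto simp: zero_word_def plus_word_def)
end

definition letter :: "'g \<Rightarrow> 'g word \<Rightarrow>\<^sub>0 complex"
  where "letter g = Poly_Mapping.single (Word [g]) 1"

definition scalar :: "complex \<Rightarrow> 'm::zero \<Rightarrow>\<^sub>0 complex"
  where "scalar c = Poly_Mapping.single 0 c"

definition free_algebra :: "'g set \<Rightarrow> (complex, 'g word \<Rightarrow>\<^sub>0 complex) module"
  where "free_algebra S =
    \<lparr>carrier = {p. \<forall>w\<in>Poly_Mapping.keys p. set (letters w) \<subseteq> S},
     mult = (*), one = 1, zero = 0, add = (+), smult = (\<lambda>c p. scalar c * p)\<rparr>"

definition linear_extension :: "('m \<Rightarrow> complex) \<Rightarrow> ('m \<Rightarrow>\<^sub>0 complex) \<Rightarrow> complex"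
  where "linear_extension \<phi> p = (\<Sum>w\<in>Poly_Mapping.keys p. Poly_Mapping.lookup p w * \<phi> w)"

definition quotient_space :: "('r, 'v, 'm) module_scheme \<Rightarrow> 'v set \<Rightarrow> ('r, 'v set) module"
  where "quotient_space V N =
    \<lparr>carrier = a_rcosets\<^bsub>V\<^esub> N, mult = undefined, one = undefined, zero = N, add = set_add V,
     smult = (\<lambda>c X. \<Union>x\<in>X. N +>\<^bsub>V\<^esub> (c \<odot>\<^bsub>V\<^esub> x))\<rparr>"

text \<open>The library's quotient ring, together with the induced scalar multiplication.\<close>

definition quotient_algebra :: "('r, 'a, 'm) module_scheme \<Rightarrow> 'a set \<Rightarrow> ('r, 'a set) module"
  where "quotient_algebra R J =
    ring.extend (R Quot J) (module.fields (smult (quotient_space R J)))"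

text \<open>
  The tensor algebra of a complex vector space \<open>V\<close>: the free algebra on the set \<open>carrier V\<close>,
  modulo the relations that make the inclusion of generators linear.
\<close>

definition linearity_relations ::
    "(complex, 'v, 'm) module_scheme \<Rightarrow> ('v word \<Rightarrow>\<^sub>0 complex) set"
  where "linearity_relations V =
    {letter (v \<oplus>\<^bsub>V\<^esub> w) - letter v - letter w | v w. v \<in> carrier V \<and> w \<in> carrier V} \<union>
    {letter (c \<odot>\<^bsub>V\<^esub> v) - scalar c * letter v | c v. v \<in> carrier V}"

definition tensor_ideal :: "(complex, 'v, 'm) module_scheme \<Rightarrow> ('v word \<Rightarrow>\<^sub>0 complex) set"
  where "tensor_ideal V = Idl\<^bsub>free_algebra (carrier V)\<^esub> (linearity_relations V)"

definition tensor_algebra ::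
    "(complex, 'v, 'm) module_scheme \<Rightarrow> (complex, ('v word \<Rightarrow>\<^sub>0 complex) set) module"
  where "tensor_algebra V = quotient_algebra (free_algebra (carrier V)) (tensor_ideal V)"

definition tensor2 ::
    "(complex, 'v, 'm) module_scheme \<Rightarrow> 'v \<Rightarrow> 'v \<Rightarrow> ('v word \<Rightarrow>\<^sub>0 complex) set"
  where "tensor2 V v w =
    (tensor_ideal V +>\<^bsub>free_algebra (carrier V)\<^esub> letter v) \<otimes>\<^bsub>tensor_algebra V\<^esub>
    (tensor_ideal V +>\<^bsub>free_algebra (carrier V)\<^esub> letter w)"

section \<open>The Drinfeld--Jimbo algebra\<close>

datatype uq_gen = GenE nat | GenF nat | GenK nat | GenKinv nat

definition uq_gens :: "nat \<Rightarrow> uq_gen set"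
  where "uq_gens n = (\<Union>i\<in>{1..n}. {GenE i, GenF i, GenK i, GenKinv i})"

abbreviation "E\<^sub>f i \<equiv> letter (GenE i)"
abbreviation "F\<^sub>f i \<equiv> letter (GenF i)"
abbreviation "K\<^sub>f i \<equiv> letter (GenK i)"
abbreviation "Kinv\<^sub>f i \<equiv> letter (GenKinv i)"

definition cartan :: "nat \<Rightarrow> nat \<Rightarrow> int"
  where "cartan i j = (if i = j then 2 else if i = Suc j \<or> j = Suc i then - 1 else 0)"

definition uq_relations :: "nat \<Rightarrow> real \<Rightarrow> (uq_gen word \<Rightarrow>\<^sub>0 complex) set"
  where "uq_relations n q =
    (let c = (\<lambda>r::real. scalar (complex_of_real r)) in
    (\<Union>i\<in>{1..n}. {K\<^sub>f i * Kinv\<^sub>f i - 1, Kinv\<^sub>f i * K\<^sub>f i - 1}) \<union>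
    (\<Union>i\<in>{1..n}. \<Union>j\<in>{1..n}.
      {K\<^sub>f i * K\<^sub>f j - K\<^sub>f j * K\<^sub>f i,
       K\<^sub>f i * E\<^sub>f j - c (q powi cartan i j) * E\<^sub>f j * K\<^sub>f i,
       K\<^sub>f i * F\<^sub>f j - c (q powi (- cartan i j)) * F\<^sub>f j * K\<^sub>f i,
       E\<^sub>f i * F\<^sub>f j - F\<^sub>f j * E\<^sub>f i -
         (if i = j then c (1 / (q - inverse q)) * (K\<^sub>f i - Kinv\<^sub>f i) else 0)}) \<union>
    (\<Union>i\<in>{1..n}. \<Union>j\<in>{j\<in>{1..n}. cartan i j = 0}.
      {E\<^sub>f i * E\<^sub>f j - E\<^sub>f j * E\<^sub>f i,
       F\<^sub>f i * F\<^sub>f j - F\<^sub>f j * F\<^sub>f i}) \<union>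
    (\<Union>i\<in>{1..n}. \<Union>j\<in>{j\<in>{1..n}. cartan i j = - 1}.
      {E\<^sub>f i * E\<^sub>f i * E\<^sub>f j - c (q + inverse q) * E\<^sub>f i * E\<^sub>f j * E\<^sub>f i + E\<^sub>f j * E\<^sub>f i * E\<^sub>f i,
       F\<^sub>f i * F\<^sub>f i * F\<^sub>f j - c (q + inverse q) * F\<^sub>f i * F\<^sub>f j * F\<^sub>f i + F\<^sub>f j * F\<^sub>f i * F\<^sub>f i}))"

definition uq_ideal :: "nat \<Rightarrow> real \<Rightarrow> (uq_gen word \<Rightarrow>\<^sub>0 complex) set"
  where "uq_ideal n q = Idl\<^bsub>free_algebra (uq_gens n)\<^esub> (uq_relations n q)"

type_synonym uq_elem = "(uq_gen word \<Rightarrow>\<^sub>0 complex) set"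

definition Uq :: "nat \<Rightarrow> real \<Rightarrow> (complex, uq_elem) module"
  where "Uq n q = quotient_algebra (free_algebra (uq_gens n)) (uq_ideal n q)"

definition uq_class :: "nat \<Rightarrow> real \<Rightarrow> (uq_gen word \<Rightarrow>\<^sub>0 complex) \<Rightarrow> uq_elem"
  where "uq_class n q x = uq_ideal n q +>\<^bsub>free_algebra (uq_gens n)\<^esub> x"

text \<open>Coproduct and counit are given on the free algebra; they respect the defining relations and so descend to \<open>U\<^sub>q\<close>.\<close>

definition tensor_poly ::
    "('m \<Rightarrow>\<^sub>0 complex) \<Rightarrow> ('m \<Rightarrow>\<^sub>0 complex) \<Rightarrow> ('m \<times> 'm) \<Rightarrow>\<^sub>0 complex" (infixl "\<otimes>\<^sub>p" 70)
  where "x \<otimes>\<^sub>p y = (\<Sum>u\<in>Poly_Mapping.keys x. \<Sum>v\<in>Poly_Mapping.keys y.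
    Poly_Mapping.single (u, v) (Poly_Mapping.lookup x u * Poly_Mapping.lookup y v))"

fun uq_coproduct_gen :: "uq_gen \<Rightarrow> (uq_gen word \<times> uq_gen word) \<Rightarrow>\<^sub>0 complex"
  where
    "uq_coproduct_gen (GenE i) = E\<^sub>f i \<otimes>\<^sub>p K\<^sub>f i + 1 \<otimes>\<^sub>p E\<^sub>f i"
  | "uq_coproduct_gen (GenF i) = F\<^sub>f i \<otimes>\<^sub>p 1 + Kinv\<^sub>f i \<otimes>\<^sub>p F\<^sub>f i"
  | "uq_coproduct_gen (GenK i) = K\<^sub>f i \<otimes>\<^sub>p K\<^sub>f i"
  | "uq_coproduct_gen (GenKinv i) = Kinv\<^sub>f i \<otimes>\<^sub>p Kinv\<^sub>f i"

definition uq_coproduct ::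
    "(uq_gen word \<Rightarrow>\<^sub>0 complex) \<Rightarrow> (uq_gen word \<times> uq_gen word) \<Rightarrow>\<^sub>0 complex"
  where "uq_coproduct x = (\<Sum>w\<in>Poly_Mapping.keys x.
    scalar (Poly_Mapping.lookup x w) * prod_list (map uq_coproduct_gen (letters w)))"

fun uq_counit_gen :: "uq_gen \<Rightarrow> complex"
  where
    "uq_counit_gen (GenE i) = 0"
  | "uq_counit_gen (GenF i) = 0"
  | "uq_counit_gen (GenK i) = 1"
  | "uq_counit_gen (GenKinv i) = 1"

definition uq_counit :: "(uq_gen word \<Rightarrow>\<^sub>0 complex) \<Rightarrow> complex"
  where "uq_counit = linear_extension (\<lambda>w. prod_list (map uq_counit_gen (letters w)))"

text \<open>
  The functional on \<open>U\<^sub>q\<close> induced by a linear functional on the free algebra that vanishes on the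
  defining ideal, hence is constant on cosets.
\<close>

definition descend ::
    "nat \<Rightarrow> real \<Rightarrow> ((uq_gen word \<Rightarrow>\<^sub>0 complex) \<Rightarrow> complex) \<Rightarrow> uq_elem \<Rightarrow> complex"
  where "descend n q \<phi> = (\<lambda>X\<in>carrier (Uq n q). the_elem (\<phi> ` X))"

section \<open>The quantum coordinate algebra\<close>

text \<open>
  Type 1 means that the module is spanned by common eigenvectors of the \<open>K\<^sub>i\<close> whose eigenvalues are
  integer powers of \<open>q\<close>; the columns of \<open>P\<close> are a basis of such vectors.
\<close>

definition type1_rep :: "nat \<Rightarrow> real \<Rightarrow> nat \<Rightarrow> (uq_elem \<Rightarrow> complex mat) \<Rightarrow> bool"
  where "type1_rep n q d \<rho> \<longleftrightarrow>
    \<rho> \<in> Ring.ring_hom (Uq n q) (ring_mat TYPE(complex) d ()) \<and>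
    (\<forall>c. \<forall>X\<in>carrier (Uq n q). \<rho> (c \<odot>\<^bsub>Uq n q\<^esub> X) = c \<cdot>\<^sub>m \<rho> X) \<and>
    (\<exists>P\<in>carrier_mat d d. invertible_mat P \<and>
      (\<forall>j<d. \<forall>i\<in>{1..n}. \<exists>m::int.
        \<rho> (uq_class n q (K\<^sub>f i)) *\<^sub>v col P j = (complex_of_real q powi m) \<cdot>\<^sub>v col P j))"

text \<open>
  The coordinate algebra consists of functionals on \<open>U\<^sub>q\<close> (extensional outside its carrier); its
  multiplication is dual to the coproduct of \<open>U\<^sub>q\<close>, its unit is the counit of \<open>U\<^sub>q\<close>.  The pairing
  \<open>\<langle>X, f\<rangle>\<close> is \<open>f X\<close>.
\<close>

definition Oq :: "nat \<Rightarrow> real \<Rightarrow> (complex, uq_elem \<Rightarrow> complex) module"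
  where "Oq n q =
    \<lparr>carrier = {\<lambda>X\<in>carrier (Uq n q). scalar_prod w (\<rho> X *\<^sub>v v) | d \<rho> v w.
        type1_rep n q d \<rho> \<and> v \<in> carrier_vec d \<and> w \<in> carrier_vec d},
     mult = (\<lambda>f g. descend n q (\<lambda>x.
        linear_extension (\<lambda>(u, v). f (uq_class n q (Poly_Mapping.single u 1)) *
          g (uq_class n q (Poly_Mapping.single v 1))) (uq_coproduct x))),
     one = descend n q uq_counit,
     zero = (\<lambda>X\<in>carrier (Uq n q). 0),
     add = (\<lambda>f g. \<lambda>X\<in>carrier (Uq n q). f X + g X),
     smult = (\<lambda>c f. \<lambda>X\<in>carrier (Uq n q). c * f X)\<rparr>"

text \<open>The counit of the coordinate algebra, dual to the unit of \<open>U\<^sub>q\<close>.\<close>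

definition Oq_counit :: "nat \<Rightarrow> real \<Rightarrow> (uq_elem \<Rightarrow> complex) \<Rightarrow> complex"
  where "Oq_counit n q f = f \<one>\<^bsub>Uq n q\<^esub>"

text \<open>
  \<open>Oq_coproduct n q x m a b\<close> says that the coproduct of \<open>x\<close> is \<open>\<Sum>k<m. a k \<otimes> b k\<close>.  The coproduct is
  dual to the multiplication of \<open>U\<^sub>q\<close>, and the tensor square of a space of functionals embeds into the
  bilinear forms, so the identity can be tested on pairs \<open>X\<close>, \<open>Y\<close>.
\<close>

definition Oq_coproduct :: "nat \<Rightarrow> real \<Rightarrow> (uq_elem \<Rightarrow> complex) \<Rightarrow> nat \<Rightarrow>
    (nat \<Rightarrow> uq_elem \<Rightarrow> complex) \<Rightarrow> (nat \<Rightarrow> uq_elem \<Rightarrow> complex) \<Rightarrow> bool"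
  where "Oq_coproduct n q x m a b \<longleftrightarrow>
    (\<forall>k<m. a k \<in> carrier (Oq n q) \<and> b k \<in> carrier (Oq n q)) \<and>
    (\<forall>X\<in>carrier (Uq n q). \<forall>Y\<in>carrier (Uq n q). x (X \<otimes>\<^bsub>Uq n q\<^esub> Y) = (\<Sum>k<m. a k X * b k Y))"

text \<open>
  The vector representation and its matrix coefficients \<open>u\<^sub>i\<^sub>j\<close>.  Rows and columns of
  \<^typ>\<open>complex mat\<close> are numbered from 0, whereas \<open>u\<^sub>i\<^sub>j\<close> has \<open>1 \<le> i, j \<le> n + 1\<close>.
\<close>

fun vector_rep_gen :: "nat \<Rightarrow> real \<Rightarrow> uq_gen \<Rightarrow> complex mat"
  where
    "vector_rep_gen n q (GenE i) =
      mat (n + 1) (n + 1) (\<lambda>(r, s). if r + 1 = i + 1 \<and> s + 1 = i then 1 else 0)"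
  | "vector_rep_gen n q (GenF i) =
      mat (n + 1) (n + 1) (\<lambda>(r, s). if r + 1 = i \<and> s + 1 = i + 1 then 1 else 0)"
  | "vector_rep_gen n q (GenK i) =
      mat (n + 1) (n + 1) (\<lambda>(r, s). if r \<noteq> s then 0
        else if r + 1 = i + 1 then complex_of_real q
        else if r + 1 = i then inverse (complex_of_real q) else 1)"
  | "vector_rep_gen n q (GenKinv i) =
      mat (n + 1) (n + 1) (\<lambda>(r, s). if r \<noteq> s then 0
        else if r + 1 = i + 1 then inverse (complex_of_real q)
        else if r + 1 = i then complex_of_real q else 1)"

definition u_coeff :: "nat \<Rightarrow> real \<Rightarrow> nat \<Rightarrow> nat \<Rightarrow> uq_elem \<Rightarrow> complex"
  where "u_coeff n q i j = descend n q (linear_extension (\<lambda>w.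
    foldr (\<lambda>g M. vector_rep_gen n q g * M) (letters w) (1\<^sub>m (n + 1)) $$ (i - 1, j - 1)))"

section \<open>Positive roots\<close>

text \<open>
  The positive root \<open>\<alpha>\<^sub>i\<^sub>j\<close> is represented by the pair \<open>(i, j)\<close>, and \<open>root_vec (i, j)\<close> is the vector
  \<open>\<epsilon>\<^sub>i - \<epsilon>\<^sub>j\<close> with coordinates in positions \<open>1, \<dots>, n + 1\<close>.  Coordinates are taken in the integers,
  so that \<open>q\<close> can be raised to the power of an inner product even if it is negative.
\<close>

definition pos_roots :: "nat \<Rightarrow> (nat \<times> nat) set"
  where "pos_roots n = {(i, j). 1 \<le> i \<and> i < j \<and> j \<le> n + 1}"

fun root_vec :: "nat \<times> nat \<Rightarrow> nat \<Rightarrow> int"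
  where "root_vec (i, j) k = (if k = i then 1 else 0) - (if k = j then 1 else 0)"

definition root_inner :: "nat \<Rightarrow> nat \<times> nat \<Rightarrow> nat \<times> nat \<Rightarrow> int"
  where "root_inner n \<beta> \<gamma> = (\<Sum>k\<in>{1..n + 1}. root_vec \<beta> k * root_vec \<gamma> k)"

fun root_le :: "nat \<times> nat \<Rightarrow> nat \<times> nat \<Rightarrow> bool"
  where "root_le (i, j) (k, l) \<longleftrightarrow> j < l \<or> (j = l \<and> i \<le> k)"

definition root_prec :: "nat \<Rightarrow> nat \<times> nat \<Rightarrow> nat \<times> nat \<Rightarrow> bool"
  where "root_prec n \<beta> \<gamma> \<longleftrightarrow> (\<exists>m :: nat \<times> nat \<Rightarrow> nat. \<forall>k\<in>{1..n + 1}.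
    root_vec \<gamma> k - root_vec \<beta> k = (\<Sum>\<delta>\<in>pos_roots n. int (m \<delta>) * root_vec \<delta> k))"

section \<open>The tangent space and the quantum exterior algebra\<close>

text \<open>
  A representative in the free algebra of the root vector \<open>E\<^sub>j\<^sub>i\<close>; only the values with
  \<open>1 \<le> i < j \<le> n + 1\<close> are meaningful.
\<close>

fun root_vector_rep :: "real \<Rightarrow> nat \<Rightarrow> nat \<Rightarrow> uq_gen word \<Rightarrow>\<^sub>0 complex"
  where
    "root_vector_rep q 0 i = 0"
  | "root_vector_rep q (Suc j) i = (if j \<le> i then E\<^sub>f i else
      E\<^sub>f j * root_vector_rep q j i -
      scalar (inverse (complex_of_real q)) * root_vector_rep q j i * E\<^sub>f j)"

definition root_vector :: "nat \<Rightarrow> real \<Rightarrow> nat \<Rightarrow> nat \<Rightarrow> uq_elem"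
  where "root_vector n q j i = uq_class n q (root_vector_rep q j i)"

definition tangent_space :: "nat \<Rightarrow> real \<Rightarrow> uq_elem set"
  where "tangent_space n q = LinearCombinations.module.span (class_ring :: complex ring) (Uq n q)
    {root_vector n q j i | i j. (i, j) \<in> pos_roots n}"

definition Oq_plus :: "nat \<Rightarrow> real \<Rightarrow> (complex, uq_elem \<Rightarrow> complex) module"
  where "Oq_plus n q = (Oq n q)\<lparr>carrier := {f \<in> carrier (Oq n q). Oq_counit n q f = 0}\<rparr>"

definition plus_part :: "nat \<Rightarrow> real \<Rightarrow> (uq_elem \<Rightarrow> complex) \<Rightarrow> uq_elem \<Rightarrow> complex"
  where "plus_part n q a = a \<oplus>\<^bsub>Oq n q\<^esub> ((- Oq_counit n q a) \<odot>\<^bsub>Oq n q\<^esub> \<one>\<^bsub>Oq n q\<^esub>)"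

definition annihilator :: "nat \<Rightarrow> real \<Rightarrow> (uq_elem \<Rightarrow> complex) set"
  where "annihilator n q = {x \<in> carrier (Oq_plus n q). \<forall>X\<in>tangent_space n q. x X = 0}"

type_synonym form = "(uq_elem \<Rightarrow> complex) set"

definition Lambda1 :: "nat \<Rightarrow> real \<Rightarrow> (complex, form) module"
  where "Lambda1 n q = quotient_space (Oq_plus n q) (annihilator n q)"

definition form_class :: "nat \<Rightarrow> real \<Rightarrow> (uq_elem \<Rightarrow> complex) \<Rightarrow> form"
  where "form_class n q x = annihilator n q +>\<^bsub>Oq_plus n q\<^esub> x"

fun e_root :: "nat \<Rightarrow> real \<Rightarrow> nat \<times> nat \<Rightarrow> form"
  where "e_root n q (i, j) = form_class n q (u_coeff n q j i)"

text \<open>The subspace \<open>I\<^sup>(\<^sup>2\<^sup>)\<close>, placed in degree two of the tensor algebra.\<close>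

definition I2 :: "nat \<Rightarrow> real \<Rightarrow> (form word \<Rightarrow>\<^sub>0 complex) set set"
  where "I2 n q =
    {\<Oplus>\<^bsub>tensor_algebra (Lambda1 n q)\<^esub>k\<in>{..<m}. tensor2 (Lambda1 n q)
        (form_class n q (plus_part n q (a k))) (form_class n q (plus_part n q (b k))) | x m a b.
      x \<in> annihilator n q \<and> Oq_coproduct n q x m a b}"

definition quantum_exterior ::
    "nat \<Rightarrow> real \<Rightarrow> (complex, (form word \<Rightarrow>\<^sub>0 complex) set set) module"
  where "quantum_exterior n q =
    (let T = tensor_algebra (Lambda1 n q) in quotient_algebra T (Idl\<^bsub>T\<^esub> (I2 n q)))"

text \<open>
  The relators (left-hand side minus right-hand side).  For orthogonal \<open>\<beta> = \<alpha>\<^sub>a\<^sub>b\<close> and \<open>\<gamma> = \<alpha>\<^sub>c\<^sub>d\<close>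
  with \<open>\<beta> \<prec> \<gamma>\<close> one has \<open>c < a < b < d\<close>, hence \<open>\<beta>' = \<alpha>\<^sub>a\<^sub>d\<close> and \<open>\<gamma>' = \<alpha>\<^sub>c\<^sub>b\<close> are again positive roots.
\<close>

definition exterior_relator ::
    "nat \<Rightarrow> real \<Rightarrow> nat \<times> nat \<Rightarrow> nat \<times> nat \<Rightarrow> (form word \<Rightarrow>\<^sub>0 complex) set"
  where "exterior_relator n q \<beta> \<gamma> =
    (let T = tensor_algebra (Lambda1 n q);
         ee = (\<lambda>\<delta> \<eta>. tensor2 (Lambda1 n q) (e_root n q \<delta>) (e_root n q \<eta>));
         \<nu> = complex_of_real (q - inverse q);
         \<beta>' = (fst \<beta>, snd \<gamma>);
         \<gamma>' = (fst \<gamma>, snd \<beta>)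
     in if root_inner n \<beta> \<gamma> = 0 \<and> root_prec n \<beta> \<gamma>
        then ee \<beta> \<gamma> \<oplus>\<^bsub>T\<^esub> ee \<gamma> \<beta> \<oplus>\<^bsub>T\<^esub> \<nu> \<odot>\<^bsub>T\<^esub> ee \<beta>' \<gamma>'
        else ee \<beta> \<gamma> \<oplus>\<^bsub>T\<^esub> complex_of_real (q powi root_inner n \<beta> \<gamma>) \<odot>\<^bsub>T\<^esub> ee \<gamma> \<beta>)"

definition exterior_relations :: "nat \<Rightarrow> real \<Rightarrow> (form word \<Rightarrow>\<^sub>0 complex) set set"
  where "exterior_relations n q =
    {exterior_relator n q \<beta> \<gamma> | \<beta> \<gamma>. \<beta> \<in> pos_roots n \<and> \<gamma> \<in> pos_roots n \<and> root_le \<beta> \<gamma>}"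

end

theory Submission
  imports Defs "HOL-Library.Function_Algebras"
begin

text \<open>
  Write \<open>E\<^sub>\<beta>\<close> for the root vector of a positive root \<open>\<beta>\<close> and \<open>\<nu> = q - q\<^sup>-\<^sup>1\<close>.  A one-form is determined by the values
  of a representing functional at the root vectors, so the forms \<open>e\<^sub>\<beta>\<close> are the basis dual to the
  \<open>E\<^sub>\<beta>\<close>.  Passing from \<open>a\<close> to \<open>a\<^sup>+\<close> does not change values at root vectors, and the coproduct of a
  functional is dual to the product of \<open>U\<^sub>q\<close>.  Hence the element of \<open>I\<^sup>(\<^sup>2\<^sup>)\<close> defined by \<open>x \<in> I\<close> is
  \<open>\<Sum> x(E\<^sub>\<beta> E\<^sub>\<gamma>) e\<^sub>\<beta> \<otimes> e\<^sub>\<gamma>\<close>, and the theorem is a statement about the matrices \<open>(x(E\<^sub>\<beta> E\<^sub>\<gamma>))\<close> that occur.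

  Every element of \<open>I\<^sup>(\<^sup>2\<^sup>)\<close> is a combination of the relators.  The Serre relations imply that, for
  \<open>\<beta> < \<gamma>\<close>, the product \<open>E\<^sub>\<gamma> E\<^sub>\<beta>\<close> equals \<open>q\<close> to the power \<open>(\<beta>, \<gamma>)\<close> times \<open>E\<^sub>\<beta> E\<^sub>\<gamma>\<close>, up to a root vector if
  \<open>\<beta> + \<gamma>\<close> is a root, and up to \<open>\<nu>\<close> times a product of two nested root vectors if \<open>\<beta>\<close> and \<open>\<gamma>\<close> cross
  (\<open>\<alpha>\<^sub>a\<^sub>b\<close> and \<open>\<alpha>\<^sub>c\<^sub>d\<close> with \<open>a < c < b < d\<close>).  Since \<open>x\<close> kills root vectors, its values at unordered pairs are
  determined by those at ordered pairs (\<open>pairing_swap\<close>).  This says exactly that the matrix of \<open>x\<close> is the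
  combination of the relators whose coefficients are the values at ordered pairs, divided by
  \<open>1 + q\<^sup>2\<close> on the diagonal (\<open>sum_by_relators\<close>).  The commutation relations reduce by induction to one
  computation in rank three (\<open>E_X_middle_core\<close>).

  Conversely, every relator arises.  The matrix coefficients of the tensor square of the vector
  representation, corrected by a multiple of some \<open>u\<^sub>d\<^sub>a\<close>, give for each ordered pair \<open>\<beta> \<le> \<gamma>\<close> a
  functional in \<open>I\<close> that vanishes at all ordered pairs except at \<open>(\<beta>, \<gamma>)\<close> and, if \<open>\<beta>\<close> and \<open>\<gamma>\<close> cross, at the
  nested pair of the same total weight, where its value is \<open>\<nu>\<close> (\<open>separating_functional\<close>).  A
  nested pair is not crossing, so the system is triangular and can be solved for the relators.

  Representations are built from operators on functions (\<open>matrix_coefficient\<close>); direct sums of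
  representations make the matrix coefficients a vector space.
\<close>

section \<open>Quotients of modules\<close>

lemma submodule_additive:
  assumes "submodule R N M"
  shows "abelian_subgroup N M"
proof -
  interpret submodule R N M by fact
  interpret M: Module.module R M by (rule module)
  have inv: "\<ominus>\<^bsub>M\<^esub> v \<in> N" if v: "v \<in> N" for v
  proof -
    have "v \<in> carrier M" using v subset by blast
    then have "\<ominus>\<^bsub>M\<^esub> v = (\<ominus>\<^bsub>R\<^esub> \<one>\<^bsub>R\<^esub>) \<odot>\<^bsub>M\<^esub> v"
      by (simp add: M.smult_l_minus)
    then show ?thesis using v by simp
  qed
  have "subgroup N (add_monoid M)"
    by (rule M.add.subgroupI) (use subset inv in \<open>auto simp: a_inv_def[symmetric] intro: zero_closed\<close>)
  then show ?thesis
    by (intro abelian_subgroupI3 additive_subgroup.intro M.abelian_group_axioms)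
qed

lemma quotient_space_simps:
  "carrier (quotient_space V N) = a_rcosets\<^bsub>V\<^esub> N"
  "zero (quotient_space V N) = N" "add (quotient_space V N) = set_add V"
  "smult (quotient_space V N) = (\<lambda>c X. \<Union>x\<in>X. N +>\<^bsub>V\<^esub> (c \<odot>\<^bsub>V\<^esub> x))"
  by (simp_all add: quotient_space_def)

lemma rcosets_image: "a_rcosets\<^bsub>V\<^esub> N = (\<lambda>x. N +>\<^bsub>V\<^esub> x) ` carrier V"
  by (auto simp: A_RCOSETS_def' RCOSETS_def a_r_coset_def)

text \<open>
  The union that defines the action of a scalar on a coset collapses: multiples of two
  representatives differ by an element of \<open>N\<close>, so all cosets in the union are equal.
\<close>

lemma quotient_space_smult:
  assumes sub: "submodule R N M" and c: "c \<in> carrier R" and x: "x \<in> carrier M"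
  shows "c \<odot>\<^bsub>quotient_space M N\<^esub> (N +>\<^bsub>M\<^esub> x) = N +>\<^bsub>M\<^esub> (c \<odot>\<^bsub>M\<^esub> x)"
proof -
  interpret submodule R N M by fact
  interpret M: Module.module R M by (rule module)
  interpret N: abelian_subgroup N M by (rule submodule_additive[OF sub])
  have "N +>\<^bsub>M\<^esub> (c \<odot>\<^bsub>M\<^esub> y) = N +>\<^bsub>M\<^esub> (c \<odot>\<^bsub>M\<^esub> x)" if y: "y \<in> N +>\<^bsub>M\<^esub> x" for y
  proof -
    obtain h where h: "h \<in> N" "y = h \<oplus>\<^bsub>M\<^esub> x" using y by (auto simp: a_r_coset_def')
    have hM: "h \<in> carrier M" using h subset by blast
    have "c \<odot>\<^bsub>M\<^esub> y = c \<odot>\<^bsub>M\<^esub> h \<oplus>\<^bsub>M\<^esub> c \<odot>\<^bsub>M\<^esub> x" using h hM c x by (simp add: M.smult_r_distr)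
    then have "c \<odot>\<^bsub>M\<^esub> y \<in> N +>\<^bsub>M\<^esub> (c \<odot>\<^bsub>M\<^esub> x)"
      using h c by (auto simp: a_r_coset_def')
    then show ?thesis using N.a_repr_independence'[of "c \<odot>\<^bsub>M\<^esub> y"] c x by simp
  qed
  moreover have "N +>\<^bsub>M\<^esub> x \<noteq> {}" using N.a_rcos_self[OF x] by blast
  ultimately show ?thesis unfolding quotient_space_simps by (intro SUP_eq_const)
qed

lemma quotient_space_add:
  assumes sub: "submodule R N M" and x: "x \<in> carrier M" "y \<in> carrier M"
  shows "(N +>\<^bsub>M\<^esub> x) \<oplus>\<^bsub>quotient_space M N\<^esub> (N +>\<^bsub>M\<^esub> y) = N +>\<^bsub>M\<^esub> (x \<oplus>\<^bsub>M\<^esub> y)"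
  using abelian_subgroup.a_rcos_sum[OF submodule_additive[OF sub] x] by (simp add: quotient_space_simps)

lemma quotient_space_module:
  assumes sub: "submodule R N M"
  shows "Module.module R (quotient_space M N)"
proof -
  interpret submodule R N M by fact
  interpret M: Module.module R M by (rule module)
  interpret N: abelian_subgroup N M by (rule submodule_additive[OF sub])
  let ?Q = "quotient_space M N"
  have car: "carrier ?Q = (\<lambda>x. N +>\<^bsub>M\<^esub> x) ` carrier M"
    by (simp add: quotient_space_simps rcosets_image)
  have zero: "\<zero>\<^bsub>?Q\<^esub> = N +>\<^bsub>M\<^esub> \<zero>\<^bsub>M\<^esub>"
    by (metis N.a_rcos_const N.zero_closed quotient_space_simps(2))
  note r = quotient_space_smult[OF sub] quotient_space_add[OF sub]
  show ?thesis
  proof (rule module_criteria)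
    show "cring R" by unfold_locales
  next
    show "\<forall>v\<in>carrier ?Q. \<exists>neg_v\<in>carrier ?Q. v \<oplus>\<^bsub>?Q\<^esub> neg_v = \<zero>\<^bsub>?Q\<^esub>"
    proof
      fix v assume "v \<in> carrier ?Q"
      then obtain x where "x \<in> carrier M" "v = N +>\<^bsub>M\<^esub> x" by (auto simp: car)
      then have "v \<oplus>\<^bsub>?Q\<^esub> (N +>\<^bsub>M\<^esub> (\<ominus>\<^bsub>M\<^esub> x)) = \<zero>\<^bsub>?Q\<^esub>" "N +>\<^bsub>M\<^esub> (\<ominus>\<^bsub>M\<^esub> x) \<in> carrier ?Q"
        by (auto simp: r zero M.r_neg car)
      then show "\<exists>neg_v\<in>carrier ?Q. v \<oplus>\<^bsub>?Q\<^esub> neg_v = \<zero>\<^bsub>?Q\<^esub>" by blast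
    qed
  qed (auto simp: car r zero M.a_ac M.smult_assoc1 M.smult_l_distr M.smult_r_distr)
qed

text \<open>
  A quotient algebra has the ring operations of the library's quotient ring, but it is a record with an
  additional field; this lemma carries the ring axioms over.
\<close>

lemma ring_record_cong:
  assumes "ring R" "carrier S = carrier R" "mult S = mult R" "one S = one R" "zero S = zero R" "add S = add R"
  shows "ring S"
proof -
  interpret ring R by fact
  have "abelian_group S"
  proof (rule abelian_groupI)
    fix x assume "x \<in> carrier S"
    then show "\<exists>y\<in>carrier S. y \<oplus>\<^bsub>S\<^esub> x = \<zero>\<^bsub>S\<^esub>"
      by (intro bexI[of _ "\<ominus>\<^bsub>R\<^esub> x"]) (simp_all add: assms(2-) l_neg)
  qed (simp_all add: assms(2-) a_ac)
  moreover have "monoid S"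
    by (rule monoidI) (simp_all add: assms(2-) m_assoc)
  ultimately show ?thesis
    by (rule ringI) (simp_all add: assms(2-) l_distr r_distr)
qed

section \<open>Free algebras and their quotients\<close>

lemma letters_plus [simp]: "letters (v + w) = letters v @ letters w"
  and letters_zero [simp]: "letters 0 = []"
  by (simp_all add: plus_word_def zero_word_def)

lemma sum_singles:
  fixes p :: "'m \<Rightarrow>\<^sub>0 'c::comm_monoid_add"
  shows "(\<Sum>w\<in>Poly_Mapping.keys p. Poly_Mapping.single w (Poly_Mapping.lookup p w)) = p"
  by (rule poly_mapping_eqI) (simp add: lookup_sum lookup_single when_def in_keys_iff)

text \<open>
  The principle by which identities that are linear in \<open>p\<close> are reduced to monomials.
\<close>

lemma single_induct:
  fixes p :: "'m \<Rightarrow>\<^sub>0 'c::comm_monoid_add"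
  assumes "P 0" "\<And>w c. w \<in> Poly_Mapping.keys p \<Longrightarrow> P (Poly_Mapping.single w c)" "\<And>a b. P a \<Longrightarrow> P b \<Longrightarrow> P (a + b)"
  shows "P p"
proof -
  have "P (\<Sum>w\<in>K. Poly_Mapping.single w (Poly_Mapping.lookup p w))" if "K \<subseteq> Poly_Mapping.keys p" for K
    using finite_subset[OF that finite_keys] that
  proof (induction K rule: finite_induct)
    case empty
    show ?case using assms(1) by simp
  next
    case (insert w K)
    then show ?case using assms(3)[OF assms(2)] by simp
  qed
  from this[of "Poly_Mapping.keys p"] show ?thesis by (simp add: sum_singles)
qed

lemma scalar_central: "p * scalar c = scalar c * (p :: 'g word \<Rightarrow>\<^sub>0 complex)"
  by (rule single_induct[where p = p]) (simp_all add: scalar_def mult_single algebra_simps)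

lemma scalar_simps [simp]:
  "scalar 0 = 0" "scalar 1 = (1 :: 'g word \<Rightarrow>\<^sub>0 complex)"
  by (simp_all add: scalar_def)

lemma scalar_add: "scalar (a + b) = scalar a + scalar b"
  and scalar_mult: "(scalar (a * b) :: 'g word \<Rightarrow>\<^sub>0 complex) = scalar a * scalar b"
  by (simp_all add: scalar_def single_add mult_single)

context
  fixes S :: "'g set"
begin

abbreviation "FA \<equiv> free_algebra S"

lemma FA_simps:
  "mult FA = (*)" "one FA = 1" "zero FA = 0" "add FA = (+)" "smult FA = (\<lambda>c p. scalar c * p)"
  by (simp_all add: free_algebra_def)

lemma FA_carrier: "p \<in> carrier FA \<longleftrightarrow> (\<forall>w\<in>Poly_Mapping.keys p. set (letters w) \<subseteq> S)"
  by (simp add: free_algebra_def)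

lemma FA_add: "p \<in> carrier FA \<Longrightarrow> r \<in> carrier FA \<Longrightarrow> p + r \<in> carrier FA"
  using keys_add[of p r] by (fastforce simp: FA_carrier)

lemma FA_mult: "p \<in> carrier FA \<Longrightarrow> r \<in> carrier FA \<Longrightarrow> p * r \<in> carrier FA"
  using keys_mult[of p r] by (fastforce simp: FA_carrier)

lemma FA_single: "set (letters w) \<subseteq> S \<Longrightarrow> Poly_Mapping.single w c \<in> carrier FA"
  by (simp add: FA_carrier)

lemma FA_scalar: "scalar c \<in> carrier FA"
  by (simp add: scalar_def FA_single)

lemma FA_letter: "letter g \<in> carrier FA \<longleftrightarrow> g \<in> S"
  by (simp add: letter_def FA_carrier)

lemma FA_uminus: "p \<in> carrier FA \<Longrightarrow> - p \<in> carrier FA"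
  by (simp add: FA_carrier in_keys_iff)

lemma FA_diff: "p \<in> carrier FA \<Longrightarrow> r \<in> carrier FA \<Longrightarrow> p - r \<in> carrier FA"
  using FA_add[of p "- r"] FA_uminus[of r] by simp

lemma FA_0_1: "0 \<in> carrier FA" "1 \<in> carrier FA"
  by (simp_all add: FA_carrier)

lemma FA_sum: "(\<And>k. k \<in> K \<Longrightarrow> f k \<in> carrier FA) \<Longrightarrow> sum f K \<in> carrier FA"
  by (induction K rule: infinite_finite_induct) (auto intro: FA_add FA_0_1)

lemmas FA_closed = FA_add FA_mult FA_scalar FA_diff FA_uminus FA_0_1 FA_sum

lemma FA_ring: "ring FA"
proof (rule ringI)
  show "abelian_group FA"
  proof (rule abelian_groupI)
    fix x assume "x \<in> carrier FA"
    then show "\<exists>y\<in>carrier FA. y \<oplus>\<^bsub>FA\<^esub> x = \<zero>\<^bsub>FA\<^esub>"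
      by (intro bexI[of _ "- x"]) (simp_all add: FA_simps FA_uminus)
  qed (simp_all add: FA_simps FA_closed add_ac)
  show "monoid FA"
    by (rule monoidI) (simp_all add: FA_simps FA_closed mult.assoc)
qed (simp_all add: FA_simps algebra_simps)

lemma FA_module: "Module.module class_ring FA"
  by (rule moduleI)
    (simp_all add: FA_simps FA_closed algebra_simps scalar_add scalar_mult class_cring.is_cring ring.is_abelian_group[OF FA_ring])

interpretation FA: ring FA by (rule FA_ring)

text \<open>
  Algebras presented by generators \<open>S\<close> and relations \<open>R\<close>.  Both \<open>U\<^sub>q\<close> and the tensor algebra are of this form,
  and computations in them are carried out with representatives in the free algebra, where the
  operations are those of a type class.
\<close>

context
  fixes R :: "('g word \<Rightarrow>\<^sub>0 complex) set"
  assumes R: "R \<subseteq> carrier FA"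
begin

abbreviation "rel_ideal \<equiv> Idl\<^bsub>FA\<^esub> R"
abbreviation "presented \<equiv> quotient_algebra FA rel_ideal"
abbreviation "pres_class p \<equiv> rel_ideal +>\<^bsub>FA\<^esub> p"

interpretation J: ideal rel_ideal FA by (rule FA.genideal_ideal[OF R])

lemma presented_submodule: "submodule class_ring rel_ideal FA"
proof -
  have 1: "rel_ideal \<subseteq> carrier FA" by (rule J.a_subset)
  have 2: "v + w \<in> rel_ideal" if "v \<in> rel_ideal" "w \<in> rel_ideal" for v w
    using J.a_closed[OF that] by (simp add: FA_simps)
  have 3: "0 \<in> rel_ideal" using J.zero_closed by (simp add: FA_simps)
  have 4: "scalar c * v \<in> rel_ideal" if "v \<in> rel_ideal" for c v
    using J.I_l_closed[OF that FA_scalar] by (simp add: FA_simps)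
  show ?thesis
    using 1 2 3 4 by (intro submodule.intro FA_module) (auto simp: FA_simps)
qed

lemma presented_simps:
  "carrier presented = pres_class ` carrier FA" "mult presented = mult (FA Quot rel_ideal)" "one presented = pres_class 1"
  "zero presented = rel_ideal" "add presented = add (quotient_space FA rel_ideal)" "smult presented = smult (quotient_space FA rel_ideal)"
  by (simp_all add: quotient_algebra_def ring.extend_def module.fields_def FactRing_def rcosets_image quotient_space_simps FA_simps)

lemma presented_ring: "ring presented"
  by (rule ring_record_cong[OF J.quotient_is_ring])
    (simp_all add: presented_simps FactRing_def quotient_space_simps rcosets_image FA_simps)

lemma presented_module: "Module.module class_ring presented"
proof -
  interpret M: Module.module class_ring "quotient_space FA rel_ideal"
    by (rule quotient_space_module[OF presented_submodule])
  have eq: "carrier presented = carrier (quotient_space FA rel_ideal)" "zero presented = zero (quotient_space FA rel_ideal)"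
    by (simp_all add: presented_simps quotient_space_simps rcosets_image)
  show ?thesis
    by (rule moduleI)
      (simp_all add: presented_simps(5,6) eq M.smult_assoc1[simplified] M.smult_l_distr[simplified] M.smult_r_distr M.smult_one[simplified] class_cring.is_cring ring.is_abelian_group[OF presented_ring])
qed

lemma pres_class_in: "p \<in> carrier FA \<Longrightarrow> pres_class p \<in> carrier presented"
  by (simp add: presented_simps)

lemma pres_class_mult: "p \<in> carrier FA \<Longrightarrow> r \<in> carrier FA \<Longrightarrow> pres_class p \<otimes>\<^bsub>presented\<^esub> pres_class r = pres_class (p * r)"
  using J.rcoset_mult_add[of p r] by (simp add: presented_simps FactRing_def FA_simps)

lemma pres_class_add: "p \<in> carrier FA \<Longrightarrow> r \<in> carrier FA \<Longrightarrow> pres_class p \<oplus>\<^bsub>presented\<^esub> pres_class r = pres_class (p + r)"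
  using quotient_space_add[OF presented_submodule, of p r] by (simp add: presented_simps FA_simps)

lemma pres_class_smult: "p \<in> carrier FA \<Longrightarrow> c \<odot>\<^bsub>presented\<^esub> pres_class p = pres_class (scalar c * p)"
  using quotient_space_smult[OF presented_submodule, of c p] by (simp add: presented_simps FA_simps)

lemma pres_class_zero: "\<zero>\<^bsub>presented\<^esub> = pres_class 0"
  using J.a_rcos_const[OF J.zero_closed] by (simp add: presented_simps FA_simps)

lemma pres_class_sum:
  assumes "finite K" "\<And>k. k \<in> K \<Longrightarrow> f k \<in> carrier FA"
  shows "(\<Oplus>\<^bsub>presented\<^esub>k\<in>K. pres_class (f k)) = pres_class (\<Sum>k\<in>K. f k)"
proof -
  interpret Q: ring presented by (rule presented_ring)
  show ?thesis using assms
    by (induction K rule: finite_induct) (auto simp: pres_class_zero pres_class_add FA_sum pres_class_in)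
qed

lemma FA_minus: "p \<in> carrier FA \<Longrightarrow> r \<in> carrier FA \<Longrightarrow> p \<ominus>\<^bsub>FA\<^esub> r = p - r"
proof -
  assume p: "p \<in> carrier FA" and r: "r \<in> carrier FA"
  have "\<ominus>\<^bsub>FA\<^esub> r = - r"
    using FA.minus_equality[of "- r" r] r by (simp add: FA_simps FA_closed)
  then show ?thesis by (simp add: a_minus_def FA_simps)
qed

lemma relation_in_ideal: "r \<in> R \<Longrightarrow> r \<in> rel_ideal"
  using FA.genideal_self[OF R] by blast

lemma pres_class_eq_iff:
  assumes "p \<in> carrier FA" "r \<in> carrier FA"
  shows "pres_class p = pres_class r \<longleftrightarrow> p - r \<in> rel_ideal"
proof -
  have "pres_class p = pres_class r \<longleftrightarrow> p \<in> pres_class r"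
    using J.a_repr_independence'[of p r] J.a_rcos_self[of p] assms by blast
  then show ?thesis
    using J.a_rcos_module_minus[OF FA_ring, of r p] assms by (simp add: FA_minus)
qed

end
end

section \<open>Operators, representations and matrix coefficients\<close>

lemma linear_extension_simps [simp]:
  "linear_extension \<phi> 0 = 0"
  "linear_extension \<phi> (Poly_Mapping.single w c) = c * \<phi> w"
  "linear_extension \<phi> (p + r) = linear_extension \<phi> p + linear_extension \<phi> r"
  using setsum_keys_plus_distrib[of "\<lambda>w c. c * \<phi> w" p r]
  by (auto simp: linear_extension_def distrib_right)

text \<open>
  Modules are described by operators on functions instead of matrices, so that products become
  compositions and relations can be checked at each argument without sums.  A word acts by the
  composition of its letters, hence the \<open>foldr\<close>.
\<close>

definition op_elem :: "('g \<Rightarrow> ('i \<Rightarrow> complex) \<Rightarrow> 'i \<Rightarrow> complex) \<Rightarrow> ('g word \<Rightarrow>\<^sub>0 complex) \<Rightarrow> ('i \<Rightarrow> complex) \<Rightarrow> 'i \<Rightarrow> complex"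
  where "op_elem T p f r = linear_extension (\<lambda>w. foldr T (letters w) f r) p"

definition linear_op :: "(('i \<Rightarrow> complex) \<Rightarrow> 'j \<Rightarrow> complex) \<Rightarrow> bool"
  where "linear_op T \<longleftrightarrow> (\<forall>f h. T (\<lambda>r. f r + h r) = (\<lambda>r. T f r + T h r)) \<and> (\<forall>c f. T (\<lambda>r. c * f r) = (\<lambda>r. c * T f r))"

lemma linear_op_add: "linear_op T \<Longrightarrow> T (\<lambda>r. f r + h r) = (\<lambda>r. T f r + T h r)"
  and linear_op_scale: "linear_op T \<Longrightarrow> T (\<lambda>r. c * f r) = (\<lambda>r. c * T f r)"
  by (auto simp: linear_op_def)

lemma linear_op_zero: "linear_op T \<Longrightarrow> T (\<lambda>r. 0) = (\<lambda>r. 0)"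
  using linear_op_scale[of T 0] by simp

lemma linear_op_sum:
  assumes "linear_op T"
  shows "T (\<lambda>r. \<Sum>k\<in>K. f k r) = (\<lambda>r. \<Sum>k\<in>K. T (f k) r)"
  by (induction K rule: infinite_finite_induct)
    (simp_all add: linear_op_zero[OF assms] linear_op_add[OF assms])

locale operator_action =
  fixes T :: "'g \<Rightarrow> ('i \<Rightarrow> complex) \<Rightarrow> 'i \<Rightarrow> complex"
  assumes linear: "linear_op (T g)"
begin

lemma op_word_linear: "linear_op (\<lambda>f. foldr T gs f)"
  by (induction gs) (use linear in \<open>simp_all add: linear_op_def\<close>)

lemma op_elem_simps:
  "op_elem T 0 f = (\<lambda>r. 0)"
  "op_elem T (p + p') f = (\<lambda>r. op_elem T p f r + op_elem T p' f r)"
  "op_elem T (letter g) f = T g f"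
  "op_elem T 1 f = f"
  "op_elem T (scalar c) f = (\<lambda>r. c * f r)"
  by (auto simp: op_elem_def letter_def scalar_def simp flip: single_one)

lemma op_elem_linear: "linear_op (op_elem T p)"
proof (rule single_induct[where p = p])
  show "linear_op (op_elem T (Poly_Mapping.single w c))" for w c
    using op_word_linear[of "letters w"] by (auto simp: linear_op_def op_elem_def fun_eq_iff algebra_simps)
qed (auto simp: op_elem_simps linear_op_def fun_eq_iff algebra_simps)

lemma op_elem_mult: "op_elem T (p * p') f = op_elem T p (op_elem T p' f)"
proof (rule single_induct[where p = p])
  show "op_elem T (Poly_Mapping.single w c * p') f = op_elem T (Poly_Mapping.single w c) (op_elem T p' f)" for w c
  proof (rule single_induct[where p = p'])
    show "op_elem T (Poly_Mapping.single w c * Poly_Mapping.single w' c') f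
      = op_elem T (Poly_Mapping.single w c) (op_elem T (Poly_Mapping.single w' c') f)" for w' c'
    proof -
      have *: "op_elem T (Poly_Mapping.single w' c') f = (\<lambda>r. c' * foldr T (letters w') f r)"
        by (simp add: op_elem_def fun_eq_iff)
      show ?thesis
        by (rule ext) (simp add: * op_elem_def[of T "Poly_Mapping.single w c"]
          op_elem_def[of T "Poly_Mapping.single (w + w') (c * c')"] mult_single linear_op_scale[OF op_word_linear])
    qed
  qed (auto simp: op_elem_simps distrib_left linear_op_add[OF op_elem_linear] linear_op_zero[OF op_elem_linear])
qed (auto simp: op_elem_simps distrib_right)

lemma op_elem_uminus: "op_elem T (- p) f = (\<lambda>r. - op_elem T p f r)"
proof
  fix r
  have "op_elem T (- p) f r + op_elem T p f r = 0"
    using op_elem_simps(2)[of "- p" p f] op_elem_simps(1)[of f] by (simp add: fun_eq_iff)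
  then show "op_elem T (- p) f r = - op_elem T p f r" by (simp add: add_eq_0_iff)
qed

lemma op_elem_diff: "op_elem T (p - p') f = (\<lambda>r. op_elem T p f r - op_elem T p' f r)"
  using op_elem_simps(2)[of p "- p'" f] by (simp add: op_elem_uminus)

lemmas op_elem_eval = op_elem_simps op_elem_mult op_elem_uminus op_elem_diff

end

lemma uq_gensI: "i \<in> {1..n} \<Longrightarrow> GenE i \<in> uq_gens n" "i \<in> {1..n} \<Longrightarrow> GenF i \<in> uq_gens n"
  "i \<in> {1..n} \<Longrightarrow> GenK i \<in> uq_gens n" "i \<in> {1..n} \<Longrightarrow> GenKinv i \<in> uq_gens n"
  by (auto simp: uq_gens_def)

abbreviation "FU n \<equiv> free_algebra (uq_gens n)"

lemma uq_relations_carrier: "uq_relations n q \<subseteq> carrier (FU n)"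
  unfolding uq_relations_def Let_def
  by (auto simp: FA_letter uq_gensI intro!: FA_closed)

lemma Uq_eq: "Uq n q = quotient_algebra (FU n) (Idl\<^bsub>FU n\<^esub> (uq_relations n q))"
  by (simp add: Uq_def uq_ideal_def)

lemma uq_class_eq: "uq_class n q p = Idl\<^bsub>FU n\<^esub> (uq_relations n q) +>\<^bsub>FU n\<^esub> p"
  by (simp add: uq_class_def uq_ideal_def)

lemmas Uq_ring = presented_ring[OF uq_relations_carrier[of n q], folded Uq_eq] for n q
lemmas Uq_module = presented_module[OF uq_relations_carrier[of n q], folded Uq_eq] for n q
lemmas uq_class_in = pres_class_in[OF uq_relations_carrier[of n q], folded Uq_eq uq_class_eq] for n q
lemmas uq_class_mult = pres_class_mult[OF uq_relations_carrier[of n q], folded Uq_eq uq_class_eq] for n q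
lemmas uq_class_add = pres_class_add[OF uq_relations_carrier[of n q], folded Uq_eq uq_class_eq] for n q
lemmas uq_class_smult = pres_class_smult[OF uq_relations_carrier[of n q], folded Uq_eq uq_class_eq] for n q

lemma Uq_carrier: "carrier (Uq n q) = uq_class n q ` carrier (FU n)"
  using presented_simps(1)[OF uq_relations_carrier[of n q], folded Uq_eq] by (auto simp: uq_class_eq)

lemma uq_class_one: "\<one>\<^bsub>Uq n q\<^esub> = uq_class n q 1"
  using presented_simps(3)[OF uq_relations_carrier[of n q], folded Uq_eq] by (auto simp: uq_class_eq)

lemma uq_class_eqD:
  "uq_class n q p = uq_class n q r \<Longrightarrow> p \<in> carrier (FU n) \<Longrightarrow> r \<in> carrier (FU n) \<Longrightarrow> p - r \<in> uq_ideal n q"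
  using pres_class_eq_iff[OF uq_relations_carrier[of n q]] by (simp add: uq_class_def uq_ideal_def)

lemma the_elem_const: "X \<noteq> {} \<Longrightarrow> (\<And>x. x \<in> X \<Longrightarrow> f x = c) \<Longrightarrow> the_elem (f ` X) = c"
proof -
  assume "X \<noteq> {}" "\<And>x. x \<in> X \<Longrightarrow> f x = c"
  then have "f ` X = {c}" by auto
  then show ?thesis by simp
qed

text \<open>
  A function \<open>\<phi>\<close> that is constant on the class of \<open>p\<close> descends to it; this serves functionals as well as
  matrix-valued representations.
\<close>

lemma descend_class:
  assumes p: "p \<in> carrier (FU n)"
    and ker: "\<And>r. r \<in> carrier (FU n) \<Longrightarrow> p - r \<in> uq_ideal n q \<Longrightarrow> \<phi> r = \<phi> p"
  shows "the_elem (\<phi> ` uq_class n q p) = \<phi> p"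
proof -
  interpret FU: ring "FU n" by (rule FA_ring)
  interpret J: ideal "uq_ideal n q" "FU n"
    unfolding uq_ideal_def by (rule FU.genideal_ideal[OF uq_relations_carrier])
  have self: "p \<in> uq_class n q p" unfolding uq_class_def by (rule J.a_rcos_self[OF p])
  have const: "\<phi> r = \<phi> p" if r: "r \<in> uq_class n q p" for r
  proof -
    have rc: "r \<in> carrier (FU n)" using r unfolding uq_class_def
      by (rule J.a_elemrcos_carrier[OF p])
    have "uq_class n q p = uq_class n q r"
      using r p unfolding uq_class_def by (intro J.a_repr_independence')
    then show ?thesis using ker[OF rc uq_class_eqD[OF _ p rc]] by simp
  qed
  have "uq_class n q p \<noteq> {}" using self by blast
  then show ?thesis using const by (rule the_elem_const)
qed

definition delta :: "'i \<Rightarrow> 'i \<Rightarrow> complex" where "delta s r = (if r = s then 1 else 0)"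

text \<open>
  An action of \<open>U\<^sub>q\<close> on functions of indices of any type, of which only a finite set \<open>I\<close> matters: by
  \<open>local\<close>, the values on \<open>I\<close> of the transformed function depend only on the values on \<open>I\<close>, so that
  restriction to \<open>I\<close> gives a finite-dimensional representation.
\<close>

locale uq_action = operator_action T for T :: "uq_gen \<Rightarrow> ('i \<Rightarrow> complex) \<Rightarrow> 'i \<Rightarrow> complex" +
  fixes n :: nat and q :: real and I :: "'i set"
  assumes finite_I: "finite I"
    and local: "g \<in> uq_gens n \<Longrightarrow> (\<And>r. r \<in> I \<Longrightarrow> f r = h r) \<Longrightarrow> r \<in> I \<Longrightarrow> T g f r = T g h r"
    and relations: "p \<in> uq_relations n q \<Longrightarrow> op_elem T p f = (\<lambda>r. 0)"
    and weight: "i \<in> {1..n} \<Longrightarrow> \<exists>m::'i \<Rightarrow> int. \<forall>f r. T (GenK i) f r = complex_of_real q powi m r * f r"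
begin

text \<open>
  The elements that act by zero form an ideal, and it contains the relations.
\<close>

lemma op_elem_ideal: "p \<in> uq_ideal n q \<Longrightarrow> op_elem T p f = (\<lambda>r. 0)"
proof -
  interpret FU: ring "FU n" by (rule FA_ring)
  let ?K = "{p \<in> carrier (FU n). \<forall>f. op_elem T p f = (\<lambda>r. 0)}"
  have z: "op_elem T p (\<lambda>r. 0) = (\<lambda>r. 0)" for p
    by (rule linear_op_zero[OF op_elem_linear])
  have "ideal ?K (FU n)"
  proof (rule idealI[OF FA_ring])
    show "subgroup ?K (add_monoid (FU n))"
    proof (rule FU.add.subgroupI)
      fix a assume a: "a \<in> ?K"
      then have "\<ominus>\<^bsub>FU n\<^esub> a = - a"
        using FU.minus_equality[of "- a" a] by (simp add: FA_simps FA_closed)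
      then show "\<ominus>\<^bsub>FU n\<^esub> a \<in> ?K"
        using a by (simp add: FA_closed op_elem_eval)
    next
      have "0 \<in> ?K" by (simp add: FA_closed op_elem_eval)
      then show "?K \<noteq> {}" by blast
    next
      show "a \<oplus>\<^bsub>FU n\<^esub> b \<in> ?K" if "a \<in> ?K" "b \<in> ?K" for a b
        using that by (simp add: FA_simps FA_closed op_elem_eval)
    qed simp
  next
    show "x \<otimes>\<^bsub>FU n\<^esub> a \<in> ?K" "a \<otimes>\<^bsub>FU n\<^esub> x \<in> ?K" if "a \<in> ?K" "x \<in> carrier (FU n)" for a x
      using that by (simp_all add: FA_simps FA_closed op_elem_eval z)
  qed
  moreover have "uq_relations n q \<subseteq> ?K"
    using subsetD[OF uq_relations_carrier] by (intro subsetI) (simp add: relations)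
  ultimately have "uq_ideal n q \<subseteq> ?K"
    unfolding uq_ideal_def by (rule FU.genideal_minimal)
  moreover assume "p \<in> uq_ideal n q"
  ultimately have "\<forall>f. op_elem T p f = (\<lambda>r. 0)" by (auto dest: subsetD)
  then show ?thesis by (rule spec)
qed

lemma op_word_local:
  "set gs \<subseteq> uq_gens n \<Longrightarrow> (\<And>r. r \<in> I \<Longrightarrow> f r = h r) \<Longrightarrow> r \<in> I \<Longrightarrow> foldr T gs f r = foldr T gs h r"
  by (induction gs arbitrary: r) (auto intro: local)

lemma op_elem_local:
  assumes "p \<in> carrier (FU n)" "\<And>r. r \<in> I \<Longrightarrow> f r = h r" "r \<in> I"
  shows "op_elem T p f r = op_elem T p h r"
  unfolding op_elem_def linear_extension_def
  using assms by (intro sum.cong) (auto simp: FA_carrier intro!: op_word_local)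

lemma op_elem_expand:
  assumes p: "p \<in> carrier (FU n)" and r: "r \<in> I"
  shows "op_elem T p f r = (\<Sum>s\<in>I. op_elem T p (delta s) r * f s)"
proof -
  have "op_elem T p f r = op_elem T p (\<lambda>r. \<Sum>s\<in>I. f s * delta s r) r"
    using p r finite_I by (intro op_elem_local) (auto simp: delta_def if_distrib cong: if_cong)
  also have "\<dots> = (\<Sum>s\<in>I. f s * op_elem T p (delta s) r)"
    by (simp add: linear_op_sum[OF op_elem_linear] linear_op_scale[OF op_elem_linear])
  finally show ?thesis by (simp add: mult.commute)
qed

text \<open>
  The representation is \<open>p \<mapsto> (op_elem T p (delta s) r)\<close> with \<open>r, s \<in> I\<close>, written as a matrix by means of an
  enumeration of \<open>I\<close>.  It is multiplicative by \<open>op_elem_expand\<close>, and it is of type 1 because the standard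
  basis consists of weight vectors.
\<close>

lemma matrix_coefficient:
  assumes r: "r \<in> I" and s: "s \<in> I"
  shows "\<exists>x\<in>carrier (Oq n q). \<forall>p\<in>carrier (FU n). x (uq_class n q p) = op_elem T p (delta s) r"
proof -
  define d where "d = card I"
  obtain ix where ix: "bij_betw ix {0..<d} I"
    using ex_bij_betw_nat_finite[OF finite_I] d_def by blast
  define M where "M p = mat d d (\<lambda>(a, b). op_elem T p (delta (ix b)) (ix a))" for p
  define \<rho> where "\<rho> X = the_elem (M ` X)" for X
  have ixI: "a < d \<Longrightarrow> ix a \<in> I" for a using ix by (auto simp: bij_betw_def)
  have ix_eq: "a < d \<Longrightarrow> b < d \<Longrightarrow> ix a = ix b \<longleftrightarrow> a = b" for a b
    using ix by (auto simp: bij_betw_def inj_on_def)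
  have M_carrier: "M p \<in> carrier_mat d d" for p by (simp add: M_def)
  have M_add: "M (p + p') = M p + M p'" for p p'
    by (rule eq_matI) (auto simp: M_def op_elem_eval)
  have M_scale: "M (scalar c * p) = c \<cdot>\<^sub>m M p" for c p
    by (rule eq_matI) (auto simp: M_def op_elem_eval)
  have M_one: "M 1 = 1\<^sub>m d"
    by (rule eq_matI) (auto simp: M_def op_elem_eval delta_def ix_eq)
  have M_mult: "M (p * p') = M p * M p'" if p: "p \<in> carrier (FU n)" for p p'
  proof (rule eq_matI)
    fix a b assume "a < dim_row (M p * M p')" "b < dim_col (M p * M p')"
    then have ab: "a < d" "b < d" by (auto simp: M_def)
    have "M (p * p') $$ (a, b) = (\<Sum>s\<in>I. op_elem T p (delta s) (ix a) * op_elem T p' (delta (ix b)) s)"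
      using ab ixI by (simp add: M_def op_elem_mult) (rule op_elem_expand[OF p])
    also have "\<dots> = (\<Sum>c\<in>{0..<d}. op_elem T p (delta (ix c)) (ix a) * op_elem T p' (delta (ix b)) (ix c))"
      by (rule sum.reindex_bij_betw[OF ix, symmetric])
    also have "\<dots> = (M p * M p') $$ (a, b)"
      using ab by (simp add: M_def scalar_prod_def)
    finally show "M (p * p') $$ (a, b) = (M p * M p') $$ (a, b)" .
  qed (auto simp: M_def)
  have \<rho>: "\<rho> (uq_class n q p) = M p" if p: "p \<in> carrier (FU n)" for p
    unfolding \<rho>_def
  proof (rule descend_class[OF p])
    fix p' assume "p - p' \<in> uq_ideal n q"
    then have "op_elem T (p - p') f = (\<lambda>r. 0)" for f by (rule op_elem_ideal)
    then have "op_elem T p' = op_elem T p"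
      by (simp add: op_elem_eval fun_eq_iff)
    then show "M p' = M p" by (simp add: M_def)
  qed
  have hom: "\<rho> \<in> Ring.ring_hom (Uq n q) (ring_mat TYPE(complex) d ())"
    by (rule ring_hom_memI)
      (auto simp: Uq_carrier \<rho> M_carrier M_mult M_add M_one ring_mat_simps uq_class_mult uq_class_add uq_class_one FA_closed)
  have "type1_rep n q d \<rho>"
    unfolding type1_rep_def
  proof (intro conjI hom allI ballI bexI[of _ "1\<^sub>m d"] impI)
    show "\<rho> (c \<odot>\<^bsub>Uq n q\<^esub> X) = c \<cdot>\<^sub>m \<rho> X" if "X \<in> carrier (Uq n q)" for c X
      using that by (auto simp: Uq_carrier uq_class_smult \<rho> M_scale FA_closed)
    show "invertible_mat (1\<^sub>m d)"
      unfolding invertible_mat_def inverts_mat_def by (auto intro!: exI[of _ "1\<^sub>m d"])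
    show "\<exists>m. \<rho> (uq_class n q (K\<^sub>f i)) *\<^sub>v col (1\<^sub>m d) j = (complex_of_real q powi m) \<cdot>\<^sub>v col (1\<^sub>m d) j"
      if j: "j < d" and i: "i \<in> {1..n}" for i j
    proof -
      obtain m :: "'i \<Rightarrow> int" where m: "\<And>f r. T (GenK i) f r = complex_of_real q powi m r * f r"
        using weight[OF i] by blast
      have K: "K\<^sub>f i \<in> carrier (FU n)" using i by (simp add: FA_letter uq_gensI)
      have "\<rho> (uq_class n q (K\<^sub>f i)) *\<^sub>v col (1\<^sub>m d) j = (complex_of_real q powi m (ix j)) \<cdot>\<^sub>v col (1\<^sub>m d) j"
        using j by (intro eq_vecI) (auto simp: \<rho>[OF K] M_def op_elem_eval m delta_def ix_eq scalar_prod_def unit_vec_def if_distrib cong: if_cong)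
      then show ?thesis by blast
    qed
  qed auto
  moreover obtain a b where ab: "a < d" "ix a = r" "b < d" "ix b = s"
    using ix r s unfolding bij_betw_def by (metis atLeastLessThan_iff imageE)
  ultimately have "(\<lambda>X\<in>carrier (Uq n q). scalar_prod (unit_vec d a) (\<rho> X *\<^sub>v unit_vec d b)) \<in> carrier (Oq n q)"
    unfolding Oq_def by fastforce
  moreover have "scalar_prod (unit_vec d a) (\<rho> (uq_class n q p) *\<^sub>v unit_vec d b) = op_elem T p (delta s) r"
    if "p \<in> carrier (FU n)" for p
  proof -
    have "M p *\<^sub>v unit_vec d b \<in> carrier_vec d"
      by (rule mult_mat_vec_carrier[OF M_carrier]) simp
    then have "scalar_prod (unit_vec d a) (M p *\<^sub>v unit_vec d b) = (M p *\<^sub>v unit_vec d b) $ a"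
      using ab by (simp add: scalar_prod_left_unit)
    also have "\<dots> = op_elem T p (delta s) r"
      using ab by (simp add: M_def scalar_prod_right_unit)
    finally show ?thesis using that by (simp add: \<rho>)
  qed
  ultimately show ?thesis
    by (intro bexI) (auto simp: uq_class_in)
qed

end

section \<open>The coordinate algebra as a vector space\<close>

definition block_diag :: "nat \<Rightarrow> nat \<Rightarrow> complex mat \<Rightarrow> complex mat \<Rightarrow> complex mat"
  where "block_diag d e A B = four_block_mat A (0\<^sub>m d e) (0\<^sub>m e d) B"

lemma block_diag_simps:
  assumes "A \<in> carrier_mat d d" "A' \<in> carrier_mat d d" "B \<in> carrier_mat e e" "B' \<in> carrier_mat e e"
  shows "block_diag d e A B * block_diag d e A' B' = block_diag d e (A * A') (B * B')"
    "block_diag d e A B + block_diag d e A' B' = block_diag d e (A + A') (B + B')"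
    "v \<in> carrier_vec d \<Longrightarrow> w \<in> carrier_vec e \<Longrightarrow> block_diag d e A B *\<^sub>v (v @\<^sub>v w) = (A *\<^sub>v v) @\<^sub>v (B *\<^sub>v w)"
  using assms mult_four_block_mat[of A d d "0\<^sub>m d e" e "0\<^sub>m e d" e B A' d "0\<^sub>m d e" e "0\<^sub>m e d" B']
    add_four_block_mat[of A d d "0\<^sub>m d e" e "0\<^sub>m e d" e B A' "0\<^sub>m d e" "0\<^sub>m e d" B']
    four_block_mat_mult_vec[of A d d "0\<^sub>m d e" e "0\<^sub>m e d" e B v w]
  by (auto simp: block_diag_def)

lemma block_diag_carrier:
  assumes "A \<in> carrier_mat d d" "B \<in> carrier_mat e e"
  shows "block_diag d e A B \<in> carrier_mat (d + e) (d + e)"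
    "c \<cdot>\<^sub>m block_diag d e A B = block_diag d e (c \<cdot>\<^sub>m A) (c \<cdot>\<^sub>m B)"
  using assms smult_four_block_mat[of A d d "0\<^sub>m d e" e "0\<^sub>m e d" e B c]
  by (auto simp: block_diag_def)

lemma block_diag_one: "block_diag d e (1\<^sub>m d) (1\<^sub>m e) = 1\<^sub>m (d + e)"
  by (simp add: block_diag_def)

lemma invertible_matE:
  assumes "invertible_mat P" "P \<in> carrier_mat d d"
  obtains Q where "Q \<in> carrier_mat d d" "P * Q = 1\<^sub>m d" "Q * P = 1\<^sub>m d"
proof -
  obtain Q where Q: "P * Q = 1\<^sub>m d" "Q * P = 1\<^sub>m (dim_row Q)"
    using assms by (auto simp: invertible_mat_def inverts_mat_def)
  have "dim_col Q = d" using arg_cong[OF Q(1), of dim_col] by simp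
  moreover have "dim_row Q = d" using arg_cong[OF Q(2), of dim_col] assms(2) by simp
  ultimately show ?thesis using Q that by auto
qed

lemma type1_rep_carrier: "type1_rep n q d \<rho> \<Longrightarrow> X \<in> carrier (Uq n q) \<Longrightarrow> \<rho> X \<in> carrier_mat d d"
  using ring_hom_closed[of \<rho> "Uq n q" "ring_mat TYPE(complex) d ()" X]
  by (simp add: type1_rep_def ring_mat_simps)

text \<open>
  Direct sums are the reason why matrix coefficients are closed under addition.
\<close>

lemma type1_rep_direct_sum:
  assumes \<rho>: "type1_rep n q d \<rho>" and \<sigma>: "type1_rep n q e \<sigma>"
  shows "type1_rep n q (d + e) (\<lambda>X. block_diag d e (\<rho> X) (\<sigma> X))"
proof -
  interpret U: ring "Uq n q" by (rule Uq_ring)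
  note car = type1_rep_carrier[OF \<rho>] type1_rep_carrier[OF \<sigma>]
  have hom: "\<rho> \<in> Ring.ring_hom (Uq n q) (ring_mat TYPE(complex) d ())"
    "\<sigma> \<in> Ring.ring_hom (Uq n q) (ring_mat TYPE(complex) e ())"
    using \<rho> \<sigma> by (auto simp: type1_rep_def)
  have "(\<lambda>X. block_diag d e (\<rho> X) (\<sigma> X)) \<in> Ring.ring_hom (Uq n q) (ring_mat TYPE(complex) (d + e) ())"
    using ring_hom_mult[OF hom(1)] ring_hom_mult[OF hom(2)] ring_hom_add[OF hom(1)] ring_hom_add[OF hom(2)]
      ring_hom_one[OF hom(1)] ring_hom_one[OF hom(2)]
    by (intro ring_hom_memI) (simp_all add: ring_mat_simps block_diag_simps block_diag_carrier block_diag_one car)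
  moreover obtain P where P: "P \<in> carrier_mat d d" "invertible_mat P"
    "\<And>i j. j < d \<Longrightarrow> i \<in> {1..n} \<Longrightarrow> \<exists>m::int. \<rho> (uq_class n q (K\<^sub>f i)) *\<^sub>v col P j = (complex_of_real q powi m) \<cdot>\<^sub>v col P j"
    using \<rho> unfolding type1_rep_def by blast
  moreover obtain R where R: "R \<in> carrier_mat e e" "invertible_mat R"
    "\<And>i j. j < e \<Longrightarrow> i \<in> {1..n} \<Longrightarrow> \<exists>m::int. \<sigma> (uq_class n q (K\<^sub>f i)) *\<^sub>v col R j = (complex_of_real q powi m) \<cdot>\<^sub>v col R j"
    using \<sigma> unfolding type1_rep_def by blast
  moreover have "\<exists>m::int. block_diag d e (\<rho> (uq_class n q (K\<^sub>f i))) (\<sigma> (uq_class n q (K\<^sub>f i))) *\<^sub>v col (block_diag d e P R) j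
      = (complex_of_real q powi m) \<cdot>\<^sub>v col (block_diag d e P R) j"
    if j: "j < d + e" and i: "i \<in> {1..n}" for i j
  proof -
    let ?A = "\<rho> (uq_class n q (K\<^sub>f i))" and ?B = "\<sigma> (uq_class n q (K\<^sub>f i))"
    have K: "uq_class n q (K\<^sub>f i) \<in> carrier (Uq n q)"
      using i by (intro uq_class_in) (simp add: FA_letter uq_gensI)
    note AB = car(1)[OF K] car(2)[OF K]
    note blk = block_diag_simps(3)[OF AB(1,1) AB(2,2)]
    show ?thesis
    proof (cases "j < d")
      case True
      then have c: "col (block_diag d e P R) j = col P j @\<^sub>v 0\<^sub>v e"
        using col_four_block_mat(1)[OF P(1) zero_carrier_mat zero_carrier_mat R(1), of j]
        by (simp add: block_diag_def)
      obtain m where m: "?A *\<^sub>v col P j = (complex_of_real q powi m) \<cdot>\<^sub>v col P j"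
        using P(3)[OF True i] by blast
      have z: "?B *\<^sub>v 0\<^sub>v e = 0\<^sub>v e" using AB by (intro eq_vecI) auto
      show ?thesis unfolding c
        using P(1) by (intro exI[of _ m], subst blk) (auto simp: m z)
    next
      case False
      then have c: "col (block_diag d e P R) j = 0\<^sub>v d @\<^sub>v col R (j - d)"
        using col_four_block_mat(2)[OF P(1) zero_carrier_mat zero_carrier_mat R(1), of j] j
        by (simp add: block_diag_def)
      have jd: "j - d < e" using False j by simp
      obtain m where m: "?B *\<^sub>v col R (j - d) = (complex_of_real q powi m) \<cdot>\<^sub>v col R (j - d)"
        using R(3)[OF jd i] by blast
      have z: "?A *\<^sub>v 0\<^sub>v d = 0\<^sub>v d" using AB by (intro eq_vecI) auto
      show ?thesis unfolding c
        using R(1) by (intro exI[of _ m], subst blk) (auto simp: m z)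
    qed
  qed
  moreover have "invertible_mat (block_diag d e P R)"
  proof -
    obtain P' where P': "P' \<in> carrier_mat d d" "P * P' = 1\<^sub>m d" "P' * P = 1\<^sub>m d"
      using invertible_matE[OF P(2,1)] .
    obtain R' where R': "R' \<in> carrier_mat e e" "R * R' = 1\<^sub>m e" "R' * R = 1\<^sub>m e"
      using invertible_matE[OF R(2,1)] .
    have "block_diag d e P R * block_diag d e P' R' = 1\<^sub>m (d + e)" "block_diag d e P' R' * block_diag d e P R = 1\<^sub>m (d + e)"
      using block_diag_simps(1)[OF P(1) P'(1) R(1) R'(1)] block_diag_simps(1)[OF P'(1) P(1) R'(1) R(1)] P' R'
      by (simp_all add: block_diag_def)
    then show ?thesis
      using block_diag_carrier(1)[OF P(1) R(1)] block_diag_carrier(1)[OF P'(1) R'(1)]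
      by (auto simp: invertible_mat_def inverts_mat_def intro!: exI[of _ "block_diag d e P' R'"])
  qed
  moreover have "block_diag d e (\<rho> (c \<odot>\<^bsub>Uq n q\<^esub> X)) (\<sigma> (c \<odot>\<^bsub>Uq n q\<^esub> X)) = c \<cdot>\<^sub>m block_diag d e (\<rho> X) (\<sigma> X)"
    if "X \<in> carrier (Uq n q)" for c X
    using \<rho> \<sigma> that block_diag_carrier(2)[OF car[OF that]] by (simp add: type1_rep_def)
  ultimately show ?thesis
    unfolding type1_rep_def using block_diag_carrier(1)[OF P(1) R(1)] by blast
qed

lemma Oq_simps:
  "zero (Oq n q) = (\<lambda>X\<in>carrier (Uq n q). 0)"
  "add (Oq n q) = (\<lambda>f g. \<lambda>X\<in>carrier (Uq n q). f X + g X)"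
  "smult (Oq n q) = (\<lambda>c f. \<lambda>X\<in>carrier (Uq n q). c * f X)"
  "one (Oq n q) = descend n q uq_counit"
  by (simp_all add: Oq_def)

lemma OqI:
  "type1_rep n q d \<rho> \<Longrightarrow> v \<in> carrier_vec d \<Longrightarrow> w \<in> carrier_vec d \<Longrightarrow>
    (\<lambda>X\<in>carrier (Uq n q). scalar_prod w (\<rho> X *\<^sub>v v)) \<in> carrier (Oq n q)"
  by (auto simp: Oq_def)

lemma OqE:
  assumes "x \<in> carrier (Oq n q)"
  obtains d \<rho> v w where "type1_rep n q d \<rho>" "v \<in> carrier_vec d" "w \<in> carrier_vec d"
    "x = (\<lambda>X\<in>carrier (Uq n q). scalar_prod w (\<rho> X *\<^sub>v v))"
  using assms by (auto simp: Oq_def)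

lemma Oq_extensional: "x \<in> carrier (Oq n q) \<Longrightarrow> x \<in> extensional (carrier (Uq n q))"
  by (auto simp: Oq_def)

lemma Oq_add_closed:
  assumes "x \<in> carrier (Oq n q)" "y \<in> carrier (Oq n q)"
  shows "x \<oplus>\<^bsub>Oq n q\<^esub> y \<in> carrier (Oq n q)"
proof -
  obtain d \<rho> v w where x: "type1_rep n q d \<rho>" "v \<in> carrier_vec d" "w \<in> carrier_vec d"
    "x = (\<lambda>X\<in>carrier (Uq n q). scalar_prod w (\<rho> X *\<^sub>v v))" using OqE[OF assms(1)] .
  obtain e \<sigma> v' w' where y: "type1_rep n q e \<sigma>" "v' \<in> carrier_vec e" "w' \<in> carrier_vec e"
    "y = (\<lambda>X\<in>carrier (Uq n q). scalar_prod w' (\<sigma> X *\<^sub>v v'))" using OqE[OF assms(2)] .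
  note car = type1_rep_carrier[OF x(1)] type1_rep_carrier[OF y(1)]
  have "x \<oplus>\<^bsub>Oq n q\<^esub> y = (\<lambda>X\<in>carrier (Uq n q). scalar_prod (w @\<^sub>v w') (block_diag d e (\<rho> X) (\<sigma> X) *\<^sub>v (v @\<^sub>v v')))"
  proof (simp only: Oq_simps, rule restrict_ext)
    fix X assume X: "X \<in> carrier (Uq n q)"
    note cX = car(1)[OF X] car(2)[OF X]
    show "x X + y X = scalar_prod (w @\<^sub>v w') (block_diag d e (\<rho> X) (\<sigma> X) *\<^sub>v (v @\<^sub>v v'))"
      using X x y block_diag_simps(3)[OF cX(1,1) cX(2,2) x(2) y(2)]
        scalar_prod_append[OF x(3) y(3) mult_mat_vec_carrier[OF cX(1) x(2)] mult_mat_vec_carrier[OF cX(2) y(2)]]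
      by simp
  qed
  also have "\<dots> \<in> carrier (Oq n q)"
    by (rule OqI[OF type1_rep_direct_sum[OF x(1) y(1)]]) (use x y in auto)
  finally show ?thesis .
qed

lemma Oq_smult_closed:
  assumes "x \<in> carrier (Oq n q)"
  shows "c \<odot>\<^bsub>Oq n q\<^esub> x \<in> carrier (Oq n q)"
proof -
  obtain d \<rho> v w where x: "type1_rep n q d \<rho>" "v \<in> carrier_vec d" "w \<in> carrier_vec d"
    "x = (\<lambda>X\<in>carrier (Uq n q). scalar_prod w (\<rho> X *\<^sub>v v))" using OqE[OF assms] .
  have "c \<odot>\<^bsub>Oq n q\<^esub> x = (\<lambda>X\<in>carrier (Uq n q). scalar_prod (c \<cdot>\<^sub>v w) (\<rho> X *\<^sub>v v))"
  proof (simp only: Oq_simps, rule restrict_ext)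
    fix X assume X: "X \<in> carrier (Uq n q)"
    show "c * x X = scalar_prod (c \<cdot>\<^sub>v w) (\<rho> X *\<^sub>v v)"
      using X x mult_mat_vec_carrier[OF type1_rep_carrier[OF x(1) X] x(2)] by simp
  qed
  also have "\<dots> \<in> carrier (Oq n q)"
    by (rule OqI) (use x in auto)
  finally show ?thesis .
qed

text \<open>
  The counit is the matrix coefficient of the trivial representation, realised on functions of the single
  index \<open>0\<close>.
\<close>

interpretation counit_action: operator_action "\<lambda>g (f :: nat \<Rightarrow> complex) r. uq_counit_gen g * f r"
  by unfold_locales (auto simp: linear_op_def fun_eq_iff algebra_simps)

lemma counit_relations:
  "p \<in> uq_relations n q \<Longrightarrow> op_elem (\<lambda>g (f :: nat \<Rightarrow> complex) r. uq_counit_gen g * f r) p f = (\<lambda>r. 0)"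
  unfolding uq_relations_def Let_def
  by (auto simp: counit_action.op_elem_eval)

lemma uq_action_counit: "uq_action (\<lambda>g (f :: nat \<Rightarrow> complex) r. uq_counit_gen g * f r) n q {0}"
  by unfold_locales (auto simp: counit_relations intro!: exI[of _ "\<lambda>_. 0"])

lemma uq_counit_eq:
  "uq_counit p = op_elem (\<lambda>g (f :: nat \<Rightarrow> complex) r. uq_counit_gen g * f r) p (delta 0) 0"
proof -
  have "foldr (\<lambda>g (f :: nat \<Rightarrow> complex) r. uq_counit_gen g * f r) gs (delta 0) 0 = prod_list (map uq_counit_gen gs)" for gs
    by (induction gs) (auto simp: delta_def)
  then show ?thesis by (simp add: uq_counit_def op_elem_def)
qed

text \<open>
  To identify a functional that is defined by descent, it suffices to know a matrix coefficient with the
  same values on representatives; this also shows that the functional descends.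
\<close>

lemma descend_eqI:
  assumes x: "x \<in> carrier (Oq n q)" and eq: "\<And>p. p \<in> carrier (FU n) \<Longrightarrow> x (uq_class n q p) = \<phi> p"
  shows "descend n q \<phi> = x"
proof -
  have "descend n q \<phi> X = x X" for X
  proof (cases "X \<in> carrier (Uq n q)")
    case True
    then obtain p where p: "p \<in> carrier (FU n)" "X = uq_class n q p" by (auto simp: Uq_carrier)
    have "the_elem (\<phi> ` uq_class n q p) = \<phi> p"
    proof (rule descend_class[OF p(1)])
      fix r assume r: "r \<in> carrier (FU n)" "p - r \<in> uq_ideal n q"
      then have "uq_class n q p = uq_class n q r"
        using pres_class_eq_iff[OF uq_relations_carrier p(1) r(1)] by (simp add: uq_class_def uq_ideal_def)
      then show "\<phi> r = \<phi> p" using eq p(1) r(1) by metis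
    qed
    then show ?thesis using True p eq by (simp add: descend_def)
  next
    case False
    then show ?thesis using Oq_extensional[OF x] by (simp add: descend_def extensional_def)
  qed
  then show ?thesis by blast
qed

lemma Oq_one_closed: "\<one>\<^bsub>Oq n q\<^esub> \<in> carrier (Oq n q)"
  and Oq_one_class: "p \<in> carrier (FU n) \<Longrightarrow> \<one>\<^bsub>Oq n q\<^esub> (uq_class n q p) = uq_counit p"
proof -
  obtain x where x: "x \<in> carrier (Oq n q)" "\<And>p. p \<in> carrier (FU n) \<Longrightarrow> x (uq_class n q p) = uq_counit p"
    using uq_action.matrix_coefficient[OF uq_action_counit, of 0 0 n q] by (auto simp: uq_counit_eq)
  then have "\<one>\<^bsub>Oq n q\<^esub> = x" by (simp add: Oq_simps descend_eqI)
  then show "\<one>\<^bsub>Oq n q\<^esub> \<in> carrier (Oq n q)" "p \<in> carrier (FU n) \<Longrightarrow> \<one>\<^bsub>Oq n q\<^esub> (uq_class n q p) = uq_counit p"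
    using x by auto
qed

lemma Oq_apply:
  "X \<in> carrier (Uq n q) \<Longrightarrow> (x \<oplus>\<^bsub>Oq n q\<^esub> y) X = x X + y X"
  "X \<in> carrier (Uq n q) \<Longrightarrow> (c \<odot>\<^bsub>Oq n q\<^esub> x) X = c * x X"
  "X \<in> carrier (Uq n q) \<Longrightarrow> \<zero>\<^bsub>Oq n q\<^esub> X = 0"
  by (simp_all add: Oq_simps)

lemma Oq_eqI:
  assumes "x \<in> carrier (Oq n q)" "y \<in> carrier (Oq n q)" "\<And>X. X \<in> carrier (Uq n q) \<Longrightarrow> x X = y X"
  shows "x = y"
  using Oq_extensional[OF assms(1)] Oq_extensional[OF assms(2)] assms(3) by (rule extensionalityI)

lemma Oq_zero_closed: "\<zero>\<^bsub>Oq n q\<^esub> \<in> carrier (Oq n q)"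
proof -
  have "\<zero>\<^bsub>Oq n q\<^esub> = 0 \<odot>\<^bsub>Oq n q\<^esub> \<one>\<^bsub>Oq n q\<^esub>" by (simp add: Oq_simps)
  then show ?thesis by (simp only: Oq_smult_closed[OF Oq_one_closed])
qed

lemma Oq_module: "Module.module class_ring (Oq n q)"
proof (rule module_criteria)
  show "\<forall>v\<in>carrier (Oq n q). \<exists>neg_v\<in>carrier (Oq n q). v \<oplus>\<^bsub>Oq n q\<^esub> neg_v = \<zero>\<^bsub>Oq n q\<^esub>"
  proof
    fix v assume v: "v \<in> carrier (Oq n q)"
    have "v \<oplus>\<^bsub>Oq n q\<^esub> ((-1) \<odot>\<^bsub>Oq n q\<^esub> v) = \<zero>\<^bsub>Oq n q\<^esub>"
      by (auto simp: Oq_simps)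
    then show "\<exists>neg_v\<in>carrier (Oq n q). v \<oplus>\<^bsub>Oq n q\<^esub> neg_v = \<zero>\<^bsub>Oq n q\<^esub>"
      using Oq_smult_closed[OF v] by blast
  qed
qed (auto simp: Oq_add_closed Oq_smult_closed Oq_zero_closed class_cring.is_cring Oq_apply
    intro!: Oq_eqI[of _ n q] simp: algebra_simps)

lemma Oq_linear:
  assumes x: "x \<in> carrier (Oq n q)" and X: "X \<in> carrier (Uq n q)" "Y \<in> carrier (Uq n q)"
  shows "x (X \<oplus>\<^bsub>Uq n q\<^esub> Y) = x X + x Y" "x (c \<odot>\<^bsub>Uq n q\<^esub> X) = c * x X"
proof -
  interpret U: Module.module class_ring "Uq n q" by (rule Uq_module)
  obtain d \<rho> v w where \<rho>: "type1_rep n q d \<rho>" "v \<in> carrier_vec d" "w \<in> carrier_vec d"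
    "x = (\<lambda>X\<in>carrier (Uq n q). scalar_prod w (\<rho> X *\<^sub>v v))" using OqE[OF x] .
  note car = type1_rep_carrier[OF \<rho>(1) X(1)] type1_rep_carrier[OF \<rho>(1) X(2)]
  have hom: "\<rho> \<in> Ring.ring_hom (Uq n q) (ring_mat TYPE(complex) d ())" "\<rho> (c \<odot>\<^bsub>Uq n q\<^esub> X) = c \<cdot>\<^sub>m \<rho> X"
    using \<rho>(1) X by (auto simp: type1_rep_def)
  have "\<rho> (X \<oplus>\<^bsub>Uq n q\<^esub> Y) = \<rho> X + \<rho> Y"
    using ring_hom_add[OF hom(1) X] by (simp add: ring_mat_simps)
  then show "x (X \<oplus>\<^bsub>Uq n q\<^esub> Y) = x X + x Y"
    using X \<rho>(2,3) car mult_mat_vec_carrier[OF car(1) \<rho>(2)] mult_mat_vec_carrier[OF car(2) \<rho>(2)]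
    by (simp add: \<rho>(4) add_mult_distrib_mat_vec[OF car \<rho>(2)] scalar_prod_add_distrib)
  have "(c \<cdot>\<^sub>m \<rho> X) *\<^sub>v v = c \<cdot>\<^sub>v (\<rho> X *\<^sub>v v)"
    using car(1) \<rho>(2) by (intro eq_vecI) auto
  then show "x (c \<odot>\<^bsub>Uq n q\<^esub> X) = c * x X"
    using X \<rho>(2,3) car mult_mat_vec_carrier[OF car(1) \<rho>(2)]
    by (simp add: \<rho>(4) hom(2) scalar_prod_smult_distrib U.smult_closed)
qed

section \<open>Commutation relations of the root vectors\<close>

text \<open>
  The commutation relations are derived for linear operators \<open>E\<^sub>i\<close> that satisfy the Serre relations, rather than
  in \<open>U\<^sub>q\<close>: application of operators needs no associativity law and no side conditions on carriers, so
  the relations can be used as rewrite rules.  Operators with an index that does not occur may be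
  taken to be zero, hence the relations are required for all indices.
\<close>

locale serre_operators = vector_space sc for sc :: "complex \<Rightarrow> 'v::ab_group_add \<Rightarrow> 'v" (infixr "*s" 75) +
  fixes E :: "nat \<Rightarrow> 'v \<Rightarrow> 'v" and q :: complex
  assumes q_nonzero: "q \<noteq> 0" and q_sq: "q * q \<noteq> - 1"
    and E_add: "E i (x + y) = E i x + E i y"
    and E_scale: "E i (c *s x) = c *s E i x"
    and far: "Suc i < j \<Longrightarrow> E i (E j x) = E j (E i x)"
    and serre: "i = Suc j \<or> j = Suc i \<Longrightarrow> E i (E i (E j x)) = (q + inverse q) *s E i (E j (E i x)) - E j (E i (E i x))"
begin

lemmas vec_simps = scale_right_distrib scale_left_distrib scale_right_diff_distrib scale_left_diff_distrib

text \<open>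
  The operator \<open>X j i\<close> is the root vector \<open>E\<^sub>j\<^sub>i\<close>, by the recursion of \<^const>\<open>root_vector_rep\<close>.
\<close>

fun X :: "nat \<Rightarrow> nat \<Rightarrow> 'v \<Rightarrow> 'v" where
  "X 0 i x = 0"
| "X (Suc j) i x = (if j \<le> i then E i x else E j (X j i x) - inverse q *s X j i (E j x))"

lemma E_zero: "E i 0 = 0"
  using E_scale[of i 0 0] by simp

lemma E_minus: "E i (- x) = - E i x"
  using E_add[of i x "- x"] E_zero[of i] by (simp add: eq_neg_iff_add_eq_0 add.commute)

lemma E_diff: "E i (x - y) = E i x - E i y"
  using E_add[of i x "- y"] by (simp add: E_minus)

lemmas E_linear = E_add E_scale E_zero E_diff E_minus

lemma X_add: "X j i (x + y) = X j i x + X j i y"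
  by (induction j arbitrary: x y) (auto simp: E_linear algebra_simps)

lemma X_scale: "X j i (c *s x) = c *s X j i x"
  by (induction j arbitrary: x) (auto simp: E_linear algebra_simps)

lemma X_zero: "X j i 0 = 0"
  using X_scale[of j i 0 0] by simp

lemma X_diff: "X j i (x - y) = X j i x - X j i y"
  using X_add[of j i "x - y" y] by (simp add: algebra_simps)

lemmas X_linear = X_add X_scale X_zero X_diff

lemma X_step: "i < j \<Longrightarrow> X (Suc j) i x = E j (X j i x) - inverse q *s X j i (E j x)"
  and X_simple: "X (Suc i) i x = E i x"
  by auto

lemma E_X_far: "i < j \<Longrightarrow> j < k \<or> Suc k < i \<Longrightarrow> E k (X j i x) = X j i (E k x)"
proof (induction j arbitrary: x)
  case (Suc j)
  show ?case
  proof (cases "j = i")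
    case True
    then show ?thesis using Suc.prems far[of i k x] far[of k i x] by (auto simp del: X.simps simp: X_simple)
  next
    case False
    then have "i < j" using Suc.prems by simp
    moreover have "E k (E j y) = E j (E k y)" for y
      using Suc.prems far[of j k y] far[of k j y] \<open>i < j\<close> by auto
    moreover have "E k (X j i y) = X j i (E k y)" for y
      using Suc \<open>i < j\<close> by auto
    ultimately show ?thesis by (simp add: X_step E_linear del: X.simps)
  qed
qed simp

text \<open>
  A root vector is the q-commutator of its two parts, wherever it is cut: the generator \<open>E\<^sub>l\<close> that is added
  in the induction commutes with \<open>E\<^sub>j\<^sub>i\<close> and can be moved inside.
\<close>

lemma X_split: "i < j \<Longrightarrow> j < l \<Longrightarrow> X l i x = X l j (X j i x) - inverse q *s X j i (X l j x)"
proof (induction l arbitrary: x)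
  case (Suc l)
  show ?case
  proof (cases "l = j")
    case True
    then show ?thesis using Suc.prems by (simp del: X.simps add: X_simple X_step)
  next
    case False
    then have jl: "j < l" using Suc.prems by simp
    have c: "E l (X j i y) = X j i (E l y)" for y using E_X_far[of i j l y] jl Suc.prems by simp
    have ih: "X l i y = X l j (X j i y) - inverse q *s X j i (X l j y)" for y
      by (rule Suc.IH[OF Suc.prems(1) jl])
    show ?thesis
      using Suc.prems jl by (simp del: X.simps add: X_step c ih E_linear X_linear algebra_simps)
  qed
qed simp

lemma inv_q: "inverse q * q = 1" "q * inverse q = 1"
  using q_nonzero by simp_all

text \<open>
  For \<open>j = i + 2\<close> this is a Serre relation.  In general \<open>E\<^sub>j\<^sub>i\<close> is the q-commutator of \<open>E\<^sub>j\<^sub>,\<^sub>i\<^sub>+\<^sub>2\<close>, which commutes with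
  \<open>E\<^sub>i\<close>, and \<open>E\<^sub>i\<^sub>+\<^sub>2\<^sub>,\<^sub>i\<close>.  The next lemma is the mirror image.
\<close>

lemma X_E_low: "Suc i < j \<Longrightarrow> X j i (E i x) = q *s E i (X j i x)"
proof -
  \<comment> \<open>The Serre relation with \<open>E\<^sub>i\<close> as the repeated factor.\<close>
  have base: "X (Suc (Suc i)) i (E i x) = q *s E i (X (Suc (Suc i)) i x)" for x
    using serre[of i "Suc i" x]
    by (simp add: E_linear algebra_simps inv_q del: One_nat_def)
  assume "Suc i < j"
  then consider "j = Suc (Suc i)" | "Suc (Suc i) < j" by linarith
  then show ?thesis
  proof cases
    case 2
    have s: "X j i y = X j (Suc (Suc i)) (X (Suc (Suc i)) i y) - inverse q *s X (Suc (Suc i)) i (X j (Suc (Suc i)) y)" for y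
      using 2 by (intro X_split) auto
    have c: "X j (Suc (Suc i)) (E i y) = E i (X j (Suc (Suc i)) y)" for y
      using 2 by (intro E_X_far[symmetric]) auto
    show ?thesis by (simp del: X.simps add: s c base E_linear X_linear algebra_simps)
  qed (simp only: base)
qed

lemma E_X_high: "i < j \<Longrightarrow> E j (X (Suc j) i x) = q *s X (Suc j) i (E j x)"
proof -
  have base: "E (Suc i) (X (Suc (Suc i)) i x) = q *s X (Suc (Suc i)) i (E (Suc i) x)" for i x
    using serre[of "Suc i" i x]
    by (simp add: E_linear algebra_simps inv_q del: One_nat_def)
  assume "i < j"
  then obtain k where j: "j = Suc k" "i \<le> k" by (cases j) auto
  show ?thesis
  proof (cases "i = k")
    case True
    then show ?thesis using base j by simp
  next
    case False
    have s: "X (Suc j) i y = X (Suc j) k (X k i y) - inverse q *s X k i (X (Suc j) k y)" for y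
      using j False by (intro X_split) auto
    have c: "E j (X k i y) = X k i (E j y)" for y
      using j False by (intro E_X_far) auto
    have b: "E j (X (Suc j) k y) = q *s X (Suc j) k (E j y)" for y
      using base[of k] j by simp
    show ?thesis by (simp del: X.simps add: s c b E_linear X_linear algebra_simps)
  qed
qed

text \<open>
  Let \<open>c\<close> be the commutator of \<open>B = E\<^sub>i\<^sub>+\<^sub>1\<close> with \<open>Y = E\<^sub>i\<^sub>+\<^sub>3\<^sub>,\<^sub>i\<close>, and \<open>k\<close> the commutator of \<open>R = E\<^sub>i\<^sub>+\<^sub>3\<^sub>,\<^sub>i\<^sub>+\<^sub>1\<close> with
  \<open>P = E\<^sub>i\<^sub>+\<^sub>2\<^sub>,\<^sub>i\<close>.  The two ways to cut \<open>Y\<close> express \<open>c\<close> through \<open>k\<close> with opposite signs of \<open>k\<close>; adding the two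
  expressions gives \<open>(1 + q\<^sup>-\<^sup>2) c = 0\<close>.
\<close>

lemma E_X_middle_core: "E (Suc i) (X (Suc (Suc (Suc i))) i x) = X (Suc (Suc (Suc i))) i (E (Suc i) x)"
proof -
  define A where "A = E i" define B where "B = E (Suc i)" define C where "C = E (Suc (Suc i))"
  define P where "P = X (Suc (Suc i)) i" define R where "R = X (Suc (Suc (Suc i))) (Suc i)"
  define Y where "Y = X (Suc (Suc (Suc i))) i"
  define s where "s = inverse q"
  have sq: "s * q = 1" "q * s = 1" by (simp_all add: s_def inv_q)
  have sq2: "s * (q * z) = z" "q * (s * z) = z" for z by (simp_all add: sq flip: mult.assoc)
  have lin: "f (x + y) = f x + f y" "f (x - y) = f x - f y" "f (c *s x) = c *s f x"
    if "f \<in> {A, B, C, P, R, Y}" for f x y c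
    using that by (auto simp: A_def B_def C_def P_def R_def Y_def E_linear X_linear simp del: X.simps)
  note l = lin[of A, simplified] lin[of B, simplified] lin[of C, simplified] lin[of P, simplified] lin[of R, simplified] lin[of Y, simplified]
  have P: "P x = B (A x) - s *s A (B x)" for x
    by (simp add: P_def A_def B_def s_def)
  have R: "R x = C (B x) - s *s B (C x)" for x
    by (simp add: R_def C_def B_def s_def)
  have YR: "Y x = R (A x) - s *s A (R x)" for x
    using X_split[of i "Suc i" "Suc (Suc (Suc i))"] by (simp add: Y_def R_def A_def s_def X_simple del: X.simps)
  have YP: "Y x = C (P x) - s *s P (C x)" for x
    by (simp add: Y_def P_def C_def s_def del: X.simps add: X_step)
  have RB: "R (B x) = q *s B (R x)" for x
    using X_E_low[of "Suc i" "Suc (Suc (Suc i))"] by (simp add: R_def B_def)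
  have BP: "B (P x) = q *s P (B x)" for x
    using E_X_high[of i "Suc i"] by (simp add: P_def B_def)
  define c where "c = B (Y x) - Y (B x)"
  define k where "k = R (P x) - P (R x)"
  have c1: "c = s *s k - (s * (q - s)) *s Y (B x)"
    by (simp add: c_def k_def YR P RB l vec_simps sq sq2 algebra_simps)
  have c2: "c = - (s *s k) + (s * (q - s)) *s B (Y x)"
    by (simp add: c_def k_def YP R BP l vec_simps sq sq2 algebra_simps)
  have "c + c = (s * (q - s)) *s c"
  proof -
    have "c + c = (s *s k - (s * (q - s)) *s Y (B x)) + (- (s *s k) + (s * (q - s)) *s B (Y x))"
      using c1 c2 by metis
    then show ?thesis by (simp add: c_def algebra_simps)
  qed
  also have "s * (q - s) = 1 - s * s" by (simp add: algebra_simps sq)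
  finally have "(1 + s * s) *s c = 0" by (simp add: vec_simps algebra_simps)
  moreover have "1 + s * s \<noteq> 0"
  proof
    assume "1 + s * s = 0"
    then have "q * q * (1 + s * s) = 0" by simp
    then have "q * q + 1 = 0" by (simp add: algebra_simps sq sq2)
    then show False using q_sq by (simp add: add_eq_0_iff2)
  qed
  ultimately have "c = 0" by simp
  then show ?thesis by (simp add: c_def B_def Y_def)
qed

text \<open>
  Cutting \<open>E\<^sub>j\<^sub>i\<close> before \<open>k - 1\<close> and after \<open>k + 2\<close> leaves the case of rank three; the outer parts commute with \<open>E\<^sub>k\<close>
  since their indices are far away.
\<close>

lemma E_X_middle: "i < k \<Longrightarrow> Suc k < j \<Longrightarrow> E k (X j i x) = X j i (E k x)"
proof -
  assume "i < k" "Suc k < j"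
  then obtain m where k: "k = Suc m" "i \<le> m" by (cases k) auto
  let ?t = "Suc (Suc k)"
  have core: "E k (X ?t m y) = X ?t m (E k y)" for y
    using E_X_middle_core[of m] k by simp
  have low: "E k (X ?t i y) = X ?t i (E k y)" for y
  proof (cases "i = m")
    case False
    have s: "X ?t i y = X ?t m (X m i y) - inverse q *s X m i (X ?t m y)" for y
      using k False by (intro X_split) auto
    have c: "E k (X m i y) = X m i (E k y)" for y
      using k False by (intro E_X_far) auto
    show ?thesis by (simp del: X.simps add: s c core E_linear X_linear)
  qed (use core in simp)
  show ?thesis
  proof (cases "j = ?t")
    case False
    have s: "X j i y = X j ?t (X ?t i y) - inverse q *s X ?t i (X j ?t y)" for y
      using \<open>i < k\<close> \<open>Suc k < j\<close> False by (intro X_split) auto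
    have c: "E k (X j ?t y) = X j ?t (E k y)" for y
      using \<open>Suc k < j\<close> False by (intro E_X_far) auto
    show ?thesis by (simp del: X.simps add: s c low E_linear X_linear)
  qed (use low in simp)
qed

text \<open>
  The relations between two root vectors follow from those between a generator and a root vector, by
  expanding one of the two.
\<close>

lemma X_commute:
  assumes f: "\<And>x y. f (x - y) = f x - f y" "\<And>c x. f (c *s x) = c *s f x"
    and "i < j" and "\<And>k x. i \<le> k \<Longrightarrow> k < j \<Longrightarrow> f (E k x) = E k (f x)"
  shows "f (X j i x) = X j i (f x)"
  using assms(3,4)
proof (induction j arbitrary: x)
  case (Suc j)
  show ?case
  proof (cases "j = i")
    case True
    then show ?thesis using Suc.prems by (simp add: X_simple del: X.simps)
  next
    case False
    then have ij: "i < j" using Suc.prems by simp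
    have "f (X j i y) = X j i (f y)" for y using Suc ij by simp
    then show ?thesis using Suc.prems(2)[of j] ij by (simp add: X_step f del: X.simps)
  qed
qed simp

lemma X_disjoint: "i < j \<Longrightarrow> j < k \<Longrightarrow> k < l \<Longrightarrow> X l k (X j i x) = X j i (X l k x)"
  by (rule X_commute[where f = "X l k"]) (auto simp: X_linear E_X_far simp del: X.simps)

lemma X_nested: "k < i \<Longrightarrow> i < j \<Longrightarrow> j < l \<Longrightarrow> X l k (X j i x) = X j i (X l k x)"
  by (rule X_commute[where f = "X l k"]) (auto simp: X_linear E_X_middle simp del: X.simps)

lemma X_same_start: "i < j \<Longrightarrow> j < l \<Longrightarrow> X l i (X j i x) = q *s X j i (X l i x)"
proof -
  assume ij: "i < j" and jl: "j < l"
  have E: "X l i (E i y) = q *s E i (X l i y)" for y using ij jl by (intro X_E_low) simp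
  show ?thesis
  proof (cases "j = Suc i")
    case True
    then show ?thesis using E by (simp add: X_simple del: X.simps)
  next
    case False
    have s: "X j i y = X j (Suc i) (E i y) - inverse q *s E i (X j (Suc i) y)" for y
      using X_split[of i "Suc i" j] ij False by (simp add: X_simple del: X.simps)
    have c: "X l i (X j (Suc i) y) = X j (Suc i) (X l i y)" for y
      using ij jl False by (intro X_nested) auto
    show ?thesis by (simp del: X.simps add: s c E X_linear E_linear algebra_simps)
  qed
qed

lemma X_same_end: "i < k \<Longrightarrow> k < j \<Longrightarrow> X j k (X j i x) = q *s X j i (X j k x)"
proof -
  assume ik: "i < k" and "k < j"
  then obtain m where j: "j = Suc m" "k \<le> m" by (cases j) auto
  have E: "E m (X j i y) = q *s X j i (E m y)" for y using ik j by (simp add: E_X_high del: X.simps)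
  show ?thesis
  proof (cases "k = m")
    case True
    then show ?thesis using E j by (simp add: X_simple del: X.simps)
  next
    case False
    have s: "X j k y = E m (X m k y) - inverse q *s X m k (E m y)" for y
      using j False by (simp add: X_step del: X.simps)
    have c: "X m k (X j i y) = X j i (X m k y)" for y
      using ik j False X_nested[of i k m j] by simp
    show ?thesis by (simp del: X.simps add: s c E X_linear E_linear algebra_simps)
  qed
qed

text \<open>
  Cut \<open>E\<^sub>l\<^sub>k\<close> at \<open>j\<close> and move its parts past \<open>E\<^sub>j\<^sub>i\<close> one after the other: \<open>E\<^sub>j\<^sub>k\<close> has the same end as \<open>E\<^sub>j\<^sub>i\<close>, and moving \<open>E\<^sub>l\<^sub>j\<close>
  creates \<open>E\<^sub>l\<^sub>i\<close>, which commutes with the nested \<open>E\<^sub>j\<^sub>k\<close>.  The two terms that arise in this way have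
  coefficients \<open>q\<close> and \<open>- q\<^sup>-\<^sup>1\<close>.
\<close>

lemma X_crossing:
  assumes "i < k" "k < j" "j < l"
  shows "X l k (X j i x) = X j i (X l k x) + (q - inverse q) *s X j k (X l i x)"
proof -
  have s: "X l k y = X l j (X j k y) - inverse q *s X j k (X l j y)" for y
    using assms by (intro X_split) auto
  have BC: "X j k (X j i y) = q *s X j i (X j k y)" for y
    using assms by (intro X_same_end) auto
  have AC: "X l j (X j i y) = X l i y + inverse q *s X j i (X l j y)" for y
    using X_split[of i j l y] assms by simp
  have D: "X l i (X j k y) = X j k (X l i y)" for y
    using assms by (intro X_nested) auto
  show ?thesis
    by (simp del: X.simps add: s BC AC D X_linear algebra_simps inv_q)
qed

end

section \<open>The vector representation and its tensor square\<close>

text \<open>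
  The defining relations of \<open>U\<^sub>q\<close>, in the form in which they are checked for operators on functions.
\<close>

lemma uq_relationsI:
  fixes T :: "uq_gen \<Rightarrow> ('i \<Rightarrow> complex) \<Rightarrow> 'i \<Rightarrow> complex" and n :: nat and q :: real
  assumes T: "operator_action T"
    and inverse: "\<And>i f. T (GenK i) (T (GenKinv i) f) = f" "\<And>i f. T (GenKinv i) (T (GenK i) f) = f"
    and KK: "\<And>i j f. T (GenK i) (T (GenK j) f) = T (GenK j) (T (GenK i) f)"
    and KE: "\<And>i j f r. T (GenK i) (T (GenE j) f) r = complex_of_real q powi cartan i j * T (GenE j) (T (GenK i) f) r"
    and KF: "\<And>i j f r. T (GenK i) (T (GenF j) f) r = complex_of_real q powi (- cartan i j) * T (GenF j) (T (GenK i) f) r"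
    and EF: "\<And>i j f r. i \<noteq> j \<Longrightarrow> T (GenE i) (T (GenF j) f) r = T (GenF j) (T (GenE i) f) r"
      "\<And>i f r. T (GenE i) (T (GenF i) f) r - T (GenF i) (T (GenE i) f) r
        = (T (GenK i) f r - T (GenKinv i) f r) / (complex_of_real q - inverse (complex_of_real q))"
    and far: "\<And>i j f r. cartan i j = 0 \<Longrightarrow> T (GenE i) (T (GenE j) f) r = T (GenE j) (T (GenE i) f) r"
      "\<And>i j f r. cartan i j = 0 \<Longrightarrow> T (GenF i) (T (GenF j) f) r = T (GenF j) (T (GenF i) f) r"
    and serre: "\<And>i j f r. cartan i j = - 1 \<Longrightarrow> T (GenE i) (T (GenE i) (T (GenE j) f)) r + T (GenE j) (T (GenE i) (T (GenE i) f)) r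
        = (complex_of_real q + inverse (complex_of_real q)) * T (GenE i) (T (GenE j) (T (GenE i) f)) r"
      "\<And>i j f r. cartan i j = - 1 \<Longrightarrow> T (GenF i) (T (GenF i) (T (GenF j) f)) r + T (GenF j) (T (GenF i) (T (GenF i) f)) r
        = (complex_of_real q + inverse (complex_of_real q)) * T (GenF i) (T (GenF j) (T (GenF i) f)) r"
    and p: "p \<in> uq_relations n q"
  shows "op_elem T p f = (\<lambda>r. 0)"
proof -
  interpret operator_action T by fact
  have EF': "T (GenE i) (T (GenF j) f) r - T (GenF j) (T (GenE i) f) r
    = (if i = j then (T (GenK i) f r - T (GenKinv i) f r) / (complex_of_real q - inverse (complex_of_real q)) else 0)" for i j f r
    using EF by auto
  have serre': "T (GenE i) (T (GenE i) (T (GenE j) f)) r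
      - (complex_of_real q + inverse (complex_of_real q)) * T (GenE i) (T (GenE j) (T (GenE i) f)) r + T (GenE j) (T (GenE i) (T (GenE i) f)) r = 0"
    "T (GenF i) (T (GenF i) (T (GenF j) f)) r
      - (complex_of_real q + inverse (complex_of_real q)) * T (GenF i) (T (GenF j) (T (GenF i) f)) r + T (GenF j) (T (GenF i) (T (GenF i) f)) r = 0"
    if "cartan i j = - 1" for i j f r
    using serre[OF that, of f r] by (simp_all add: algebra_simps)
  have "\<forall>p\<in>uq_relations n q. \<forall>r. op_elem T p f r = 0"
    unfolding uq_relations_def Let_def
    by (simp add: ball_Un op_elem_eval inverse KK KE KF EF' serre')
      (intro ballI allI impI conjI far; elim conjE; assumption)
  with p show ?thesis by (intro ext) simp
qed

text \<open>
  \<open>K\<^sub>i\<close> acts on the \<open>r\<close>-th basis vector of the vector representation by \<open>q\<close> to the power \<open>K_weight i r\<close>.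
\<close>

definition K_weight :: "nat \<Rightarrow> nat \<Rightarrow> int"
  where "K_weight i r = (if r = Suc i then 1 else if r = i then - 1 else 0)"

fun V_op :: "complex \<Rightarrow> uq_gen \<Rightarrow> (nat \<Rightarrow> complex) \<Rightarrow> nat \<Rightarrow> complex" where
  "V_op q (GenE i) f r = (if r = Suc i then f i else 0)"
| "V_op q (GenF i) f r = (if r = i then f (Suc i) else 0)"
| "V_op q (GenK i) f r = q powi K_weight i r * f r"
| "V_op q (GenKinv i) f r = q powi (- K_weight i r) * f r"

text \<open>
  The tensor square, with the action through the coproduct \<open>\<Delta>(E\<^sub>i) = E\<^sub>i \<otimes> K\<^sub>i + 1 \<otimes> E\<^sub>i\<close>,
  \<open>\<Delta>(F\<^sub>i) = F\<^sub>i \<otimes> 1 + K\<^sub>i\<^sup>-\<^sup>1 \<otimes> F\<^sub>i\<close>.  A vector is a function of its coordinates, so \<open>E\<^sub>i\<close>, which maps the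
  \<open>i\<close>-th basis vector to the next one, reads the argument \<open>i\<close> at the place \<open>i + 1\<close>.
\<close>

fun VV_op :: "complex \<Rightarrow> uq_gen \<Rightarrow> (nat \<times> nat \<Rightarrow> complex) \<Rightarrow> nat \<times> nat \<Rightarrow> complex" where
  "VV_op q (GenE i) f (r, s) = (if r = Suc i then q powi K_weight i s * f (i, s) else 0) + (if s = Suc i then f (r, i) else 0)"
| "VV_op q (GenF i) f (r, s) = (if r = i then f (Suc i, s) else 0) + (if s = i then q powi (- K_weight i r) * f (r, Suc i) else 0)"
| "VV_op q (GenK i) f (r, s) = q powi (K_weight i r + K_weight i s) * f (r, s)"
| "VV_op q (GenKinv i) f (r, s) = q powi (- K_weight i r - K_weight i s) * f (r, s)"

lemma V_op_linear: "linear_op (V_op q g)"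
  by (cases g) (auto simp: linear_op_def fun_eq_iff algebra_simps)

lemma VV_op_linear: "linear_op (VV_op q g)"
  by (cases g) (auto simp: linear_op_def fun_eq_iff algebra_simps)

interpretation V_op: operator_action "V_op q" for q by unfold_locales (rule V_op_linear)
interpretation VV_op: operator_action "VV_op q" for q by unfold_locales (rule VV_op_linear)

context
  fixes n :: nat and q :: real
  assumes q: "q \<noteq> - 1" "q \<noteq> 0" "q \<noteq> 1"
begin

abbreviation "qc \<equiv> complex_of_real q"

lemma q_facts: "qc \<noteq> 0" "qc * qc \<noteq> 1" "qc * qc \<noteq> - 1" "qc - inverse qc \<noteq> 0"
proof -
  have "q * q \<noteq> 1" using q by (simp add: square_eq_1_iff)
  then show "qc * qc \<noteq> 1" by (metis of_real_eq_1_iff of_real_mult)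
  have "q * q \<noteq> - 1" using zero_le_square[of q] by linarith
  then show "qc * qc \<noteq> - 1" by (metis of_real_eq_iff of_real_minus of_real_mult of_real_1)
  show "qc \<noteq> 0" using q by simp
  then show "qc - inverse qc \<noteq> 0" using \<open>qc * qc \<noteq> 1\<close> by (auto simp: field_simps)
qed

lemmas powi_simps = K_weight_def cartan_def power_int_minus power_int_diff power_int_add power2_eq_square field_simps

lemma V_relations: "p \<in> uq_relations n q \<Longrightarrow> op_elem (V_op qc) p f = (\<lambda>r. 0)"
  by (erule uq_relationsI[OF V_op.operator_action_axioms, rotated -1])
    (use q_facts in \<open>auto simp: powi_simps\<close>)

lemma VV_relations: "p \<in> uq_relations n q \<Longrightarrow> op_elem (VV_op qc) p f = (\<lambda>r. 0)"
  by (erule uq_relationsI[OF VV_op.operator_action_axioms, rotated -1]; (intro ext)?; unfold split_paired_all)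
    (use q_facts in \<open>auto simp: powi_simps split: if_splits\<close>)

lemma V_root_vector:
  "i < j \<Longrightarrow> op_elem (V_op qc) (root_vector_rep q j i) f = (\<lambda>r. if r = j then f i else 0)"
proof (induction j arbitrary: f)
  case (Suc j)
  show ?case
  proof (cases "j = i")
    case False
    then have "op_elem (V_op qc) (root_vector_rep q j i) f = (\<lambda>r. if r = j then f i else 0)" for f
      using Suc by simp
    then show ?thesis using Suc.prems False by (auto simp: V_op.op_elem_eval fun_eq_iff)
  qed (auto simp: V_op.op_elem_eval)
qed simp

text \<open>
  The first two summands come from the terms \<open>E\<^sub>j\<^sub>i \<otimes> K\<close> and \<open>1 \<otimes> E\<^sub>j\<^sub>i\<close> of \<open>\<Delta>(E\<^sub>j\<^sub>i)\<close>, with \<open>K = K\<^sub>i \<cdots> K\<^sub>j\<^sub>-\<^sub>1\<close>, and the last one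
  from its mixed terms, which are multiples of \<open>E\<^sub>p\<^sub>i \<otimes> E\<^sub>j\<^sub>p K\<^sub>i \<cdots> K\<^sub>p\<^sub>-\<^sub>1\<close> for \<open>i < p < j\<close> and send
  \<open>e\<^sub>i \<otimes> e\<^sub>p\<close> to \<open>\<nu> e\<^sub>p \<otimes> e\<^sub>j\<close>.
\<close>

lemma VV_root_vector:
  "i < j \<Longrightarrow> op_elem (VV_op qc) (root_vector_rep q j i) f (r, s) =
     (if r = j then qc powi ((if s = j then 1 else 0) - (if s = i then 1 else 0)) * f (i, s) else 0)
     + (if s = j then f (r, i) else 0)
     + (if s = j \<and> i < r \<and> r < j then (qc - inverse qc) * f (i, r) else 0)"
proof (induction j arbitrary: f r s)
  case (Suc j)
  show ?case
  proof (cases "j = i")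
    case True
    then show ?thesis using q_facts by (auto simp: VV_op.op_elem_eval K_weight_def)
  next
    case False
    then have "i < j" using Suc.prems by simp
    then show ?thesis using Suc.prems False q_facts
      by (auto simp: VV_op.op_elem_eval Suc.IH[OF \<open>i < j\<close>] powi_simps)
  qed
qed simp

end

lemma uq_action_V:
  assumes q: "q \<noteq> - 1" "q \<noteq> 0" "q \<noteq> 1"
  shows "uq_action (V_op (complex_of_real q)) n q {1..n + 1}"
proof
  show "op_elem (V_op (complex_of_real q)) p f = (\<lambda>r. 0)" if "p \<in> uq_relations n q" for p f
    using V_relations[OF q that] .
  show "V_op (complex_of_real q) g f r = V_op (complex_of_real q) g h r"
    if "g \<in> uq_gens n" "\<And>r. r \<in> {1..n + 1} \<Longrightarrow> f r = h r" "r \<in> {1..n + 1}" for g f h r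
    using that by (cases g) (auto simp: uq_gens_def)
  show "\<exists>m::nat \<Rightarrow> int. \<forall>f r. V_op (complex_of_real q) (GenK i) f r = complex_of_real q powi m r * f r" for i
    by auto
qed simp

lemma uq_action_VV:
  assumes q: "q \<noteq> - 1" "q \<noteq> 0" "q \<noteq> 1"
  shows "uq_action (VV_op (complex_of_real q)) n q ({1..n + 1} \<times> {1..n + 1})"
proof
  show "op_elem (VV_op (complex_of_real q)) p f = (\<lambda>r. 0)" if "p \<in> uq_relations n q" for p f
    using VV_relations[OF q that] .
  show "VV_op (complex_of_real q) g f r = VV_op (complex_of_real q) g h r"
    if "g \<in> uq_gens n" "\<And>r. r \<in> {1..n + 1} \<times> {1..n + 1} \<Longrightarrow> f r = h r" "r \<in> {1..n + 1} \<times> {1..n + 1}" for g f h r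
    using that by (cases g; cases r) (auto simp: uq_gens_def)
  show "\<exists>m::nat \<times> nat \<Rightarrow> int. \<forall>f r. VV_op (complex_of_real q) (GenK i) f r = complex_of_real q powi m r * f r" for i
    by (rule exI[of _ "\<lambda>(r, s). K_weight i r + K_weight i s"]) auto
qed simp

text \<open>
  Rows and columns of matrices are numbered from 0, basis vectors from 1; hence the successors.
\<close>

lemma vector_rep_word:
  assumes "set gs \<subseteq> uq_gens n" "a < n + 1" "b < n + 1"
  shows "foldr (\<lambda>g M. vector_rep_gen n q g * M) gs (1\<^sub>m (n + 1)) $$ (a, b)
    = foldr (V_op (complex_of_real q)) gs (delta (Suc b)) (Suc a)"
  using assms(1,2)
proof (induction gs arbitrary: a)
  case Nil
  then show ?case using assms by (auto simp: delta_def)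
next
  case (Cons g gs)
  let ?M = "foldr (\<lambda>g M. vector_rep_gen n q g * M) gs (1\<^sub>m (n + 1))"
  let ?f = "foldr (V_op (complex_of_real q)) gs (delta (Suc b))"
  have dim: "foldr (\<lambda>g M. vector_rep_gen n q g * M) gs (1\<^sub>m (n + 1)) \<in> carrier_mat (n + 1) (n + 1)" for gs
  proof (induction gs)
    case (Cons g gs)
    then show ?case by (cases g) (auto intro!: mult_carrier_mat)
  qed simp
  have g: "vector_rep_gen n q g \<in> carrier_mat (n + 1) (n + 1)" by (cases g) auto
  have IH: "c < n + 1 \<Longrightarrow> ?M $$ (c, b) = ?f (Suc c)" for c
    using Cons by simp
  have "(vector_rep_gen n q g * ?M) $$ (a, b) = (\<Sum>c\<in>{0..<n + 1}. vector_rep_gen n q g $$ (a, c) * ?M $$ (c, b))"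
    using dim[of gs] g Cons.prems assms(3) by (simp add: scalar_prod_def)
  also have "\<dots> = (\<Sum>c\<in>{0..<n + 1}. vector_rep_gen n q g $$ (a, c) * ?f (Suc c))"
    using IH by (intro sum.cong) auto
  also have "\<dots> = V_op (complex_of_real q) g ?f (Suc a)"
  proof (cases g)
    case (GenE i)
    then have i: "1 \<le> i" "i \<le> n" using Cons.prems by (auto simp: uq_gens_def)
    have "(\<Sum>c\<in>{0..<n + 1}. vector_rep_gen n q g $$ (a, c) * ?f (Suc c))
      = (\<Sum>c\<in>{0..<n + 1}. if c = i - 1 then (if a = i then ?f i else 0) else 0)"
      using GenE i Cons.prems by (intro sum.cong) auto
    also have "\<dots> = V_op (complex_of_real q) g ?f (Suc a)"
    proof -
      have "i - 1 < n + 1" using i by simp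
      then show ?thesis using GenE i by (auto simp: sum.delta)
    qed
    finally show ?thesis .
  next
    case (GenF i)
    then have i: "1 \<le> i" "i \<le> n" using Cons.prems by (auto simp: uq_gens_def)
    have "(\<Sum>c\<in>{0..<n + 1}. vector_rep_gen n q g $$ (a, c) * ?f (Suc c))
      = (\<Sum>c\<in>{0..<n + 1}. if c = i then (if Suc a = i then ?f (Suc i) else 0) else 0)"
      using GenF i Cons.prems by (intro sum.cong) auto
    also have "\<dots> = V_op (complex_of_real q) g ?f (Suc a)" using GenF i by (simp add: sum.delta)
    finally show ?thesis .
  next
    case (GenK i)
    have "(\<Sum>c\<in>{0..<n + 1}. vector_rep_gen n q g $$ (a, c) * ?f (Suc c))
      = (\<Sum>c\<in>{0..<n + 1}. if c = a then complex_of_real q powi K_weight i (Suc a) * ?f (Suc a) else 0)"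
      using GenK Cons.prems by (intro sum.cong) (auto simp: K_weight_def power_int_minus)
    also have "\<dots> = V_op (complex_of_real q) g ?f (Suc a)" using GenK Cons.prems by (simp add: sum.delta)
    finally show ?thesis .
  next
    case (GenKinv i)
    have "(\<Sum>c\<in>{0..<n + 1}. vector_rep_gen n q g $$ (a, c) * ?f (Suc c))
      = (\<Sum>c\<in>{0..<n + 1}. if c = a then complex_of_real q powi (- K_weight i (Suc a)) * ?f (Suc a) else 0)"
      using GenKinv Cons.prems by (intro sum.cong) (auto simp: K_weight_def power_int_minus)
    also have "\<dots> = V_op (complex_of_real q) g ?f (Suc a)" using GenKinv Cons.prems by (simp add: sum.delta)
    finally show ?thesis .
  qed
  finally show ?case by simp
qed

lemma u_coeff:
  assumes q: "q \<noteq> - 1" "q \<noteq> 0" "q \<noteq> 1" and ij: "i \<in> {1..n + 1}" "j \<in> {1..n + 1}"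
  shows "u_coeff n q i j \<in> carrier (Oq n q)"
    and "p \<in> carrier (FU n) \<Longrightarrow> u_coeff n q i j (uq_class n q p) = op_elem (V_op (complex_of_real q)) p (delta j) i"
proof -
  obtain x where x: "x \<in> carrier (Oq n q)"
    "\<And>p. p \<in> carrier (FU n) \<Longrightarrow> x (uq_class n q p) = op_elem (V_op (complex_of_real q)) p (delta j) i"
    using uq_action.matrix_coefficient[OF uq_action_V[OF q] ij] by blast
  have "u_coeff n q i j = x"
    unfolding u_coeff_def
  proof (rule descend_eqI[OF x(1)])
    fix p assume p: "p \<in> carrier (FU n)"
    have "op_elem (V_op (complex_of_real q)) p (delta j) i
      = linear_extension (\<lambda>w. foldr (\<lambda>g M. vector_rep_gen n q g * M) (letters w) (1\<^sub>m (n + 1)) $$ (i - 1, j - 1)) p"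
      unfolding op_elem_def linear_extension_def
    proof (rule sum.cong)
      fix w assume "w \<in> Poly_Mapping.keys p"
      then show "Poly_Mapping.lookup p w * foldr (V_op (complex_of_real q)) (letters w) (delta j) i
        = Poly_Mapping.lookup p w * foldr (\<lambda>g M. vector_rep_gen n q g * M) (letters w) (1\<^sub>m (n + 1)) $$ (i - 1, j - 1)"
      proof -
        have "i - 1 < n + 1" "j - 1 < n + 1" "Suc (i - 1) = i" "Suc (j - 1) = j" using ij by auto
        then show ?thesis
          using p vector_rep_word[of "letters w" n "i - 1" "j - 1" q] \<open>w \<in> _\<close> by (simp add: FA_carrier)
      qed
    qed simp
    then show "x (uq_class n q p) = linear_extension (\<lambda>w. foldr (\<lambda>g M. vector_rep_gen n q g * M) (letters w) (1\<^sub>m (n + 1)) $$ (i - 1, j - 1)) p"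
      using x(2)[OF p] by simp
  qed
  then show "u_coeff n q i j \<in> carrier (Oq n q)"
    "p \<in> carrier (FU n) \<Longrightarrow> u_coeff n q i j (uq_class n q p) = op_elem (V_op (complex_of_real q)) p (delta j) i"
    using x by auto
qed

section \<open>Commutation relations for values of functionals\<close>

lemma root_vector_rep_carrier:
  "1 \<le> i \<Longrightarrow> i < j \<Longrightarrow> j \<le> n + 1 \<Longrightarrow> root_vector_rep q j i \<in> carrier (FU n)"
proof (induction j)
  case (Suc j)
  then show ?case
    by (cases "j = i") (auto simp: FA_letter uq_gensI intro!: FA_closed)
qed simp

definition fun_scale :: "complex \<Rightarrow> (nat \<Rightarrow> complex) \<Rightarrow> nat \<Rightarrow> complex"
  where "fun_scale c f = (\<lambda>r. c * f r)"

definition mat_op :: "nat \<Rightarrow> complex mat \<Rightarrow> (nat \<Rightarrow> complex) \<Rightarrow> nat \<Rightarrow> complex"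
  where "mat_op d A f r = (if r < d then \<Sum>s<d. A $$ (r, s) * f s else 0)"

lemma mat_op_simps:
  "mat_op d A (f + h) = mat_op d A f + mat_op d A h"
  "mat_op d A (fun_scale c f) = fun_scale c (mat_op d A f)"
  by (auto simp: mat_op_def fun_scale_def fun_eq_iff distrib_left sum.distrib sum_distrib_left algebra_simps)

lemma mat_op_mat:
  assumes "A \<in> carrier_mat d d" "B \<in> carrier_mat d d"
  shows "mat_op d (A * B) f = mat_op d A (mat_op d B f)"
    "mat_op d (A + B) f = mat_op d A f + mat_op d B f"
    "mat_op d (c \<cdot>\<^sub>m A) f = fun_scale c (mat_op d A f)"
proof -
  have "(\<Sum>s<d. (\<Sum>t<d. A $$ (r, t) * B $$ (t, s)) * f s) = (\<Sum>t<d. A $$ (r, t) * (\<Sum>s<d. B $$ (t, s) * f s))" for r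
  proof -
    have "(\<Sum>s<d. (\<Sum>t<d. A $$ (r, t) * B $$ (t, s)) * f s) = (\<Sum>s<d. \<Sum>t<d. A $$ (r, t) * (B $$ (t, s) * f s))"
      by (simp add: sum_distrib_right mult.assoc)
    also have "\<dots> = (\<Sum>t<d. \<Sum>s<d. A $$ (r, t) * (B $$ (t, s) * f s))" by (rule sum.swap)
    finally show ?thesis by (simp add: sum_distrib_left)
  qed
  then show "mat_op d (A * B) f = mat_op d A (mat_op d B f)"
    using assms by (auto simp: mat_op_def fun_eq_iff scalar_prod_def atLeast0LessThan)
  show "mat_op d (A + B) f = mat_op d A f + mat_op d B f" "mat_op d (c \<cdot>\<^sub>m A) f = fun_scale c (mat_op d A f)"
    using assms by (auto simp: mat_op_def fun_scale_def fun_eq_iff distrib_right sum.distrib sum_distrib_left mult.assoc)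
qed

lemma vector_space_fun_scale: "vector_space fun_scale"
  by unfold_locales (auto simp: fun_scale_def fun_eq_iff algebra_simps)

text \<open>
  The transfer from \<open>U\<^sub>q\<close> to operators: a matrix coefficient of a representation \<open>\<rho>\<close> is a fixed functional applied
  to the action of \<open>\<rho>\<close> on a fixed vector, and the matrices \<open>\<rho>(E\<^sub>i)\<close> satisfy the Serre relations.
\<close>

lemma Oq_serre_operators:
  assumes x: "x \<in> carrier (Oq n q)" and q: "q \<noteq> - 1" "q \<noteq> 0" "q \<noteq> 1"
  obtains E and \<phi> :: "(nat \<Rightarrow> complex) \<Rightarrow> complex" and v
  where "serre_operators fun_scale E (complex_of_real q)"
    "\<And>f h. \<phi> (f + h) = \<phi> f + \<phi> h" "\<And>c f. \<phi> (fun_scale c f) = c * \<phi> f"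
    "\<And>i j. (i, j) \<in> pos_roots n \<Longrightarrow>
      x (root_vector n q j i) = \<phi> (serre_operators.X fun_scale E (complex_of_real q) j i v)"
    "\<And>i j k l. (i, j) \<in> pos_roots n \<Longrightarrow> (k, l) \<in> pos_roots n \<Longrightarrow>
      x (root_vector n q j i \<otimes>\<^bsub>Uq n q\<^esub> root_vector n q l k)
      = \<phi> (serre_operators.X fun_scale E (complex_of_real q) j i (serre_operators.X fun_scale E (complex_of_real q) l k v))"
proof -
  let ?q = "complex_of_real q"
  obtain d \<rho> v w where \<rho>: "type1_rep n q d \<rho>" "v \<in> carrier_vec d" "w \<in> carrier_vec d"
    "x = (\<lambda>X\<in>carrier (Uq n q). scalar_prod w (\<rho> X *\<^sub>v v))" using OqE[OF x] .
  define op where "op p = mat_op d (\<rho> (uq_class n q p))" for p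
  \<comment> \<open>The cut-off makes the relations hold for all indices.\<close>
  define E where "E i = (if i \<in> {1..n} then op (E\<^sub>f i) else (\<lambda>f. 0))" for i
  define \<phi> where "\<phi> f = (\<Sum>r<d. w $ r * f r)" for f :: "nat \<Rightarrow> complex"
  define v' where "v' r = v $ r" for r
  have hom: "\<rho> \<in> Ring.ring_hom (Uq n q) (ring_mat TYPE(complex) d ())"
    and smult: "\<And>c X. X \<in> carrier (Uq n q) \<Longrightarrow> \<rho> (c \<odot>\<^bsub>Uq n q\<^esub> X) = c \<cdot>\<^sub>m \<rho> X"
    using \<rho>(1) by (auto simp: type1_rep_def)
  have car: "p \<in> carrier (FU n) \<Longrightarrow> \<rho> (uq_class n q p) \<in> carrier_mat d d" for p
    by (rule type1_rep_carrier[OF \<rho>(1) uq_class_in])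
  have op_add: "op (p + p') f = op p f + op p' f" if "p \<in> carrier (FU n)" "p' \<in> carrier (FU n)" for p p' f
    using ring_hom_add[OF hom uq_class_in uq_class_in, OF that] that
    by (simp add: op_def uq_class_add ring_mat_simps mat_op_mat car)
  have op_mult: "op (p * p') f = op p (op p' f)" if "p \<in> carrier (FU n)" "p' \<in> carrier (FU n)" for p p' f
    using ring_hom_mult[OF hom uq_class_in uq_class_in, OF that] that
    by (simp add: op_def uq_class_mult ring_mat_simps mat_op_mat car)
  have op_scale: "op (scalar c * p) f = fun_scale c (op p f)" if "p \<in> carrier (FU n)" for c p f
    using smult[OF uq_class_in[OF that], of c] that
    by (simp add: op_def uq_class_smult mat_op_mat[OF car car])
  have op_uminus: "op (- p) f = - op p f" if "p \<in> carrier (FU n)" for p f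
  proof -
    have "- p = scalar (- 1) * p" by (simp add: scalar_def single_uminus)
    then show ?thesis using op_scale[OF that, of "- 1" f] by (simp add: fun_scale_def fun_eq_iff)
  qed
  have op_diff: "op (p - p') f = op p f - op p' f" if "p \<in> carrier (FU n)" "p' \<in> carrier (FU n)" for p p' f
    using op_add[OF that(1) FA_uminus[OF that(2)], of f] op_uminus[OF that(2), of f] by simp
  have op_relation: "op p f = 0" if p: "p \<in> uq_relations n q" for p f
  proof -
    have "p \<in> uq_ideal n q" unfolding uq_ideal_def by (rule relation_in_ideal[OF uq_relations_carrier p])
    moreover have pc: "p \<in> carrier (FU n)" using p uq_relations_carrier by blast
    ultimately have "uq_class n q p = uq_class n q (scalar 0 * p)"
      using pres_class_eq_iff[OF uq_relations_carrier pc, of 0 q] by (simp add: uq_class_def uq_ideal_def FA_closed)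
    then have "op p f = op (scalar 0 * p) f" unfolding op_def by (simp only:)
    then show ?thesis using op_scale[OF pc, of 0 f] by (simp add: fun_scale_def fun_eq_iff)
  qed
  have Ec: "i \<in> {1..n} \<Longrightarrow> E\<^sub>f i \<in> carrier (FU n)" for i by (simp add: FA_letter uq_gensI)
  have op_lin: "op p (f + h) = op p f + op p h" "op p (fun_scale c f) = fun_scale c (op p f)" for p f h c
    by (simp_all add: op_def mat_op_simps)
  have op_scalar: "op (scalar c) (op p f) = fun_scale c (op p f)" if "p \<in> carrier (FU n)" for c p f
    using op_mult[OF FA_scalar that, of c f] op_scale[OF that, of c f] by simp
  note op_rules = op_add op_mult op_diff op_scalar FA_closed
  interpret vs: vector_space fun_scale by (rule vector_space_fun_scale)
  have z: "op p 0 = 0" for p using op_lin(2)[of p 0 0] by simp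
  have far: "E i (E j f) = E j (E i f)" if "Suc i < j" for i j f
  proof (cases "i \<in> {1..n} \<and> j \<in> {1..n}")
    case True
    have "E\<^sub>f i * E\<^sub>f j - E\<^sub>f j * E\<^sub>f i \<in> uq_relations n q"
      unfolding uq_relations_def Let_def using True that
      by - (rule UnI1, rule UnI2, rule UN_I[of i], simp, rule UN_I[of j], auto simp: cartan_def)
    from op_relation[OF this, of f] True Ec show ?thesis
      by (simp add: op_rules E_def)
  qed (auto simp: E_def z)
  have serre: "E i (E i (E j f)) = fun_scale (?q + inverse ?q) (E i (E j (E i f))) - E j (E i (E i f))"
    if "i = Suc j \<or> j = Suc i" for i j f
  proof (cases "i \<in> {1..n} \<and> j \<in> {1..n}")
    case True
    have "E\<^sub>f i * E\<^sub>f i * E\<^sub>f j - scalar (complex_of_real (q + inverse q)) * E\<^sub>f i * E\<^sub>f j * E\<^sub>f i + E\<^sub>f j * E\<^sub>f i * E\<^sub>f i \<in> uq_relations n q"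
      unfolding uq_relations_def Let_def using True that
      by - (rule UnI2, rule UN_I[of i], simp, rule UN_I[of j], auto simp: cartan_def)
    from op_relation[OF this, of f] True Ec show ?thesis
      by (simp add: op_rules E_def algebra_simps)
  qed (auto simp: E_def z)
  have "serre_operators fun_scale E ?q"
  proof (intro serre_operators.intro vector_space_fun_scale serre_operators_axioms.intro far serre)
    show "?q * ?q \<noteq> - 1" "?q \<noteq> 0" using q_facts[OF q] by auto
    show "E i (f + h) = E i f + E i h" "E i (fun_scale c f) = fun_scale c (E i f)" for i f h c
      by (simp_all add: E_def op_lin)
  qed
  then interpret S: serre_operators fun_scale E ?q .
  have op_root: "1 \<le> i \<Longrightarrow> i < j \<Longrightarrow> j \<le> n + 1 \<Longrightarrow> op (root_vector_rep q j i) f = S.X j i f" for i j f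
  proof (induction j arbitrary: f)
    case (Suc j)
    show ?case
    proof (cases "j = i")
      case True
      then have "op (root_vector_rep q (Suc j) i) f = E i f" using Suc.prems by (simp add: E_def)
      then show ?thesis using True by (simp add: S.X_simple del: S.X.simps)
    next
      case False
      then have r: "root_vector_rep q j i \<in> carrier (FU n)" and e: "E\<^sub>f j \<in> carrier (FU n)"
        using Suc.prems by (auto intro!: root_vector_rep_carrier Ec)
      have "op (root_vector_rep q j i) f = S.X j i f" for f using Suc False by simp
      moreover have "op (E\<^sub>f j) f = E j f" for f using Suc.prems False by (simp add: E_def)
      moreover have "op (root_vector_rep q (Suc j) i) f
        = op (E\<^sub>f j) (op (root_vector_rep q j i) f) - fun_scale (inverse ?q) (op (root_vector_rep q j i) (op (E\<^sub>f j) f))"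
        using Suc.prems False r e by (simp add: op_diff op_mult op_scalar FA_closed mult.assoc)
      ultimately show ?thesis using Suc.prems False by (simp add: S.X_step del: S.X.simps)
    qed
  qed simp
  have x_op: "x (uq_class n q p) = \<phi> (op p v')" if p: "p \<in> carrier (FU n)" for p
    using car[OF p] \<rho>(2,3) p
    by (simp add: \<rho>(4) uq_class_in \<phi>_def op_def mat_op_def scalar_prod_def v'_def atLeast0LessThan)
  show ?thesis
  proof (rule that[of E \<phi> v'])
    show "serre_operators fun_scale E ?q" by fact
    show "\<phi> (f + h) = \<phi> f + \<phi> h" "\<phi> (fun_scale c f) = c * \<phi> f" for f h c
      by (simp_all add: \<phi>_def fun_scale_def distrib_left sum.distrib sum_distrib_left mult.left_commute)
    show "x (root_vector n q j i) = \<phi> (S.X j i v')" if "(i, j) \<in> pos_roots n" for i j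
      using that by (simp add: root_vector_def x_op root_vector_rep_carrier op_root pos_roots_def)
    show "x (root_vector n q j i \<otimes>\<^bsub>Uq n q\<^esub> root_vector n q l k) = \<phi> (S.X j i (S.X l k v'))"
      if "(i, j) \<in> pos_roots n" "(k, l) \<in> pos_roots n" for i j k l
      using that by (simp add: root_vector_def uq_class_mult x_op root_vector_rep_carrier op_root op_mult FA_mult pos_roots_def)
  qed
qed

abbreviation E_root :: "nat \<Rightarrow> real \<Rightarrow> nat \<times> nat \<Rightarrow> uq_elem"
  where "E_root n q \<beta> \<equiv> root_vector n q (snd \<beta>) (fst \<beta>)"

definition pairing :: "nat \<Rightarrow> real \<Rightarrow> (uq_elem \<Rightarrow> complex) \<Rightarrow> nat \<times> nat \<Rightarrow> nat \<times> nat \<Rightarrow> complex"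
  where "pairing n q x \<beta> \<gamma> = x (E_root n q \<beta> \<otimes>\<^bsub>Uq n q\<^esub> E_root n q \<gamma>)"

lemma pos_roots_iff: "(i, j) \<in> pos_roots n \<longleftrightarrow> 1 \<le> i \<and> i < j \<and> j \<le> n + 1"
  by (simp add: pos_roots_def)

lemma finite_pos_roots: "finite (pos_roots n)"
  by (rule finite_subset[of _ "{..n + 1} \<times> {..n + 1}"]) (auto simp: pos_roots_def)

lemma root_inner_eq:
  assumes "(a, b) \<in> pos_roots n" "(c, d) \<in> pos_roots n"
  shows "root_inner n (a, b) (c, d)
    = (if a = c then 1 else 0) - (if a = d then 1 else 0) - (if b = c then 1 else 0) + (if b = d then 1 else 0)"
proof -
  have "root_inner n (a, b) (c, d) = (\<Sum>k\<in>{1..n + 1}. (if k = a then (if a = c then 1 else 0) - (if a = d then 1 else 0) else 0)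
      - (if k = b then (if b = c then 1 else 0) - (if b = d then 1 else 0) else 0))"
    unfolding root_inner_def by (intro sum.cong) auto
  also have "\<dots> = ((if a = c then 1 else 0) - (if a = d then 1 else 0)) - ((if b = c then 1 else 0) - (if b = d then 1 else 0))"
    using assms by (simp add: sum_subtractf sum.delta pos_roots_iff)
  finally show ?thesis by simp
qed

text \<open>
  Exchanging the starting points turns crossing roots into nested ones with the same sum, and conversely.
\<close>

definition nested :: "nat \<times> nat \<Rightarrow> nat \<times> nat \<Rightarrow> bool"
  where "nested \<beta> \<gamma> \<longleftrightarrow> fst \<gamma> < fst \<beta> \<and> snd \<beta> < snd \<gamma>"

definition crossing :: "nat \<times> nat \<Rightarrow> nat \<times> nat \<Rightarrow> bool"
  where "crossing \<beta> \<gamma> \<longleftrightarrow> fst \<beta> < fst \<gamma> \<and> fst \<gamma> < snd \<beta> \<and> snd \<beta> < snd \<gamma>"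

text \<open>
  The sum of the first coordinates up to any place is nonnegative for a positive root, hence also for
  \<open>\<gamma> - \<beta>\<close> if \<open>\<beta> \<prec> \<gamma>\<close>.  If \<open>\<beta> = \<alpha>\<^sub>a\<^sub>b\<close> and \<open>\<gamma> = \<alpha>\<^sub>c\<^sub>d\<close> are orthogonal, \<open>b < d\<close> and \<open>a < c\<close>, then the sum up to place \<open>a\<close> is
  \<open>- 1\<close>.  If they are nested, then \<open>\<gamma> - \<beta> = \<alpha>\<^sub>c\<^sub>a + \<alpha>\<^sub>b\<^sub>d\<close>.
\<close>

lemma nested_iff:
  assumes \<beta>: "\<beta> \<in> pos_roots n" and \<gamma>: "\<gamma> \<in> pos_roots n" and le: "root_le \<beta> \<gamma>"
  shows "root_inner n \<beta> \<gamma> = 0 \<and> root_prec n \<beta> \<gamma> \<longleftrightarrow> nested \<beta> \<gamma>"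
proof -
  obtain a b c d where eq: "\<beta> = (a, b)" "\<gamma> = (c, d)" by (cases \<beta>; cases \<gamma>)
  note pos = \<beta>[unfolded eq pos_roots_iff] \<gamma>[unfolded eq pos_roots_iff]
  have inner: "root_inner n \<beta> \<gamma> = (if a = c then 1 else 0) - (if a = d then 1 else 0) - (if b = c then 1 else 0) + (if b = d then 1 else 0)"
    using root_inner_eq[of a b n c d] \<beta> \<gamma> by (simp add: eq)
  have "nested \<beta> \<gamma>" if i: "root_inner n \<beta> \<gamma> = 0" and p: "root_prec n \<beta> \<gamma>"
  proof (rule ccontr)
    assume nn: "\<not> nested \<beta> \<gamma>"
    from i inner pos le have ne: "a \<noteq> c" "b \<noteq> d" "b \<noteq> c" by (auto simp: eq split: if_splits)
    then have ac: "a < c" and bd: "b < d" using nn le by (auto simp: nested_def eq)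
    obtain m :: "nat \<times> nat \<Rightarrow> nat" where m: "\<And>k. k \<in> {1..n + 1} \<Longrightarrow>
      root_vec \<gamma> k - root_vec \<beta> k = (\<Sum>\<delta>\<in>pos_roots n. int (m \<delta>) * root_vec \<delta> k)"
      using p unfolding root_prec_def by blast
    \<comment> \<open>Sum the coordinates \<open>1, \<dots>, a\<close> of \<open>\<gamma> - \<beta>\<close>.\<close>
    have sub: "{1..a} \<subseteq> {1..n + 1}" using pos by auto
    have part: "(\<Sum>k\<in>{1..a}. root_vec (i, j) k) = (if i \<in> {1..a} then 1 else 0) - (if j \<in> {1..a} then 1 else 0)" for i j
      by (simp add: sum_subtractf sum.delta)
    have "(\<Sum>k\<in>{1..a}. root_vec \<gamma> k - root_vec \<beta> k) = - 1"
      unfolding sum_subtractf eq part using ac bd pos by auto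
    moreover have "(\<Sum>k\<in>{1..a}. root_vec \<gamma> k - root_vec \<beta> k)
      = (\<Sum>k\<in>{1..a}. \<Sum>\<delta>\<in>pos_roots n. int (m \<delta>) * root_vec \<delta> k)"
      using m sub by (intro sum.cong) auto
    moreover have "\<dots> = (\<Sum>\<delta>\<in>pos_roots n. int (m \<delta>) * (\<Sum>k\<in>{1..a}. root_vec \<delta> k))"
      by (subst sum.swap) (simp add: sum_distrib_left)
    moreover have "\<dots> \<ge> 0"
    proof (rule sum_nonneg)
      fix \<delta> assume "\<delta> \<in> pos_roots n"
      then obtain i j where "\<delta> = (i, j)" "1 \<le> i" "i < j" by (auto simp: pos_roots_def)
      then have "(\<Sum>k\<in>{1..a}. root_vec \<delta> k) \<ge> 0" using part[of i j] by auto
      then show "0 \<le> int (m \<delta>) * (\<Sum>k\<in>{1..a}. root_vec \<delta> k)" by simp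
    qed
    ultimately show False by simp
  qed
  moreover have "root_inner n \<beta> \<gamma> = 0 \<and> root_prec n \<beta> \<gamma>" if "nested \<beta> \<gamma>"
  proof
    have lt: "c < a" "b < d" using that by (auto simp: nested_def eq)
    then show "root_inner n \<beta> \<gamma> = 0" using inner pos by auto
    have in1: "(c, a) \<in> pos_roots n" "(b, d) \<in> pos_roots n" using pos lt by (auto simp: pos_roots_iff)
    have ne: "(c, a) \<noteq> (b, d)" using lt pos by auto
    have "root_vec \<gamma> k - root_vec \<beta> k
      = (\<Sum>\<delta>\<in>pos_roots n. int (if \<delta> = (c, a) \<or> \<delta> = (b, d) then 1 else 0) * root_vec \<delta> k)" for k
    proof -
      have "(\<Sum>\<delta>\<in>pos_roots n. int (if \<delta> = (c, a) \<or> \<delta> = (b, d) then 1 else 0) * root_vec \<delta> k)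
        = (\<Sum>\<delta>\<in>{(c, a), (b, d)}. int (if \<delta> = (c, a) \<or> \<delta> = (b, d) then 1 else 0) * root_vec \<delta> k)"
        using in1 finite_pos_roots by (intro sum.mono_neutral_right) auto
      also have "\<dots> = root_vec (c, a) k + root_vec (b, d) k" using ne by simp
      finally show ?thesis by (simp add: eq)
    qed
    then show "root_prec n \<beta> \<gamma>" unfolding root_prec_def
      by (intro exI[of _ "\<lambda>\<delta>. if \<delta> = (c, a) \<or> \<delta> = (b, d) then 1 else 0"]) simp
  qed
  ultimately show ?thesis by blast
qed

text \<open>
  The commutation relation of \<open>E\<^sub>\<gamma>\<close> and \<open>E\<^sub>\<beta>\<close>, as seen by a functional that vanishes at root vectors: the root
  vector of \<open>\<beta> + \<gamma>\<close> that appears if \<open>\<beta> + \<gamma>\<close> is a root drops out.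
\<close>

lemma pairing_swap:
  assumes x: "x \<in> carrier (Oq n q)" and q: "q \<noteq> - 1" "q \<noteq> 0" "q \<noteq> 1"
    and vanish: "\<And>\<delta>. \<delta> \<in> pos_roots n \<Longrightarrow> x (E_root n q \<delta>) = 0"
    and \<beta>: "\<beta> \<in> pos_roots n" and \<gamma>: "\<gamma> \<in> pos_roots n" and le: "root_le \<beta> \<gamma>" and ne: "\<beta> \<noteq> \<gamma>"
  shows "pairing n q x \<gamma> \<beta> = complex_of_real (q powi root_inner n \<beta> \<gamma>) * pairing n q x \<beta> \<gamma>
    + (if crossing \<beta> \<gamma> then complex_of_real (q - inverse q) * pairing n q x (fst \<gamma>, snd \<beta>) (fst \<beta>, snd \<gamma>) else 0)"
proof -
  let ?q = "complex_of_real q"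
  obtain E and \<phi> :: "(nat \<Rightarrow> complex) \<Rightarrow> complex" and v where S: "serre_operators fun_scale E ?q"
    and \<phi>: "\<And>f h. \<phi> (f + h) = \<phi> f + \<phi> h" "\<And>c f. \<phi> (fun_scale c f) = c * \<phi> f"
    and x1: "\<And>i j. (i, j) \<in> pos_roots n \<Longrightarrow>
      x (root_vector n q j i) = \<phi> (serre_operators.X fun_scale E ?q j i v)"
    and x2: "\<And>i j k l. (i, j) \<in> pos_roots n \<Longrightarrow> (k, l) \<in> pos_roots n \<Longrightarrow>
      x (root_vector n q j i \<otimes>\<^bsub>Uq n q\<^esub> root_vector n q l k)
      = \<phi> (serre_operators.X fun_scale E ?q j i (serre_operators.X fun_scale E ?q l k v))"
    using Oq_serre_operators[OF x q] by blast
  interpret S: serre_operators fun_scale E ?q by (rule S)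
  obtain a b c d where eq: "\<beta> = (a, b)" "\<gamma> = (c, d)" by (cases \<beta>; cases \<gamma>)
  note pos = \<beta>[unfolded eq pos_roots_iff] \<gamma>[unfolded eq pos_roots_iff]
  have P: "pairing n q x (i, j) (k, l) = \<phi> (S.X j i (S.X l k v))"
    if "(i, j) \<in> pos_roots n" "(k, l) \<in> pos_roots n" for i j k l
    using x2[OF that] by (simp add: pairing_def)
  have inner: "root_inner n \<beta> \<gamma> = (if a = c then 1 else 0) - (if a = d then 1 else 0) - (if b = c then 1 else 0) + (if b = d then 1 else 0)"
    using root_inner_eq[of a b n c d] \<beta> \<gamma> by (simp add: eq)
  have ev: "pairing n q x \<gamma> \<beta> = \<phi> (S.X d c (S.X b a v))" "pairing n q x \<beta> \<gamma> = \<phi> (S.X b a (S.X d c v))"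
    using P \<beta> \<gamma> by (simp_all add: eq del: S.X.simps)
  consider (same_end) "b = d" "a < c" | (same_start) "b < d" "a = c" | (chain) "b = c" | (disjoint) "b < c"
    | (nested) "b < d" "c < a" | (crossing) "a < c" "c < b" "b < d"
    using le ne pos unfolding eq root_le.simps prod.inject by linarith
  then show ?thesis
  proof cases
    case same_end
    then show ?thesis unfolding ev using S.X_same_end[of a c d v] pos inner by (simp add: eq crossing_def \<phi> del: S.X.simps)
  next
    case same_start
    then show ?thesis unfolding ev using S.X_same_start[of a b d v] pos inner by (simp add: eq crossing_def \<phi> del: S.X.simps)
  next
    case chain
    have "\<phi> (S.X d a v) = 0"
      using vanish[of "(a, d)"] x1[of a d] pos chain by (simp add: pos_roots_iff del: S.X.simps)
    moreover have "S.X d c (S.X c a v) = S.X d a v + fun_scale (inverse ?q) (S.X c a (S.X d c v))"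
      using S.X_split[of a c d v] pos chain by (simp del: S.X.simps)
    ultimately show ?thesis unfolding ev using pos inner chain
      by (simp add: eq crossing_def \<phi> power_int_minus del: S.X.simps)
  next
    case disjoint
    then show ?thesis unfolding ev using S.X_disjoint[of a b c d v] pos inner by (simp add: eq crossing_def \<phi> del: S.X.simps)
  next
    case nested
    then show ?thesis unfolding ev using S.X_nested[of c a b d v] pos inner by (simp add: eq crossing_def \<phi> del: S.X.simps)
  next
    case crossing
    moreover have "pairing n q x (c, b) (a, d) = \<phi> (S.X b c (S.X d a v))"
      using pos crossing by (intro P) (auto simp: pos_roots_iff)
    ultimately show ?thesis unfolding ev using S.X_crossing[of a c b d v] pos inner
      by (simp add: eq crossing_def \<phi> del: S.X.simps)
  qed
qed

section \<open>Functionals separating ordered pairs of roots\<close>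

lemma E_root_in: "\<beta> \<in> pos_roots n \<Longrightarrow> E_root n q \<beta> \<in> carrier (Uq n q)"
  by (cases \<beta>) (simp add: root_vector_def pos_roots_iff uq_class_in root_vector_rep_carrier)

lemma Oq_plus_simps:
  "carrier (Oq_plus n q) = {x \<in> carrier (Oq n q). x \<one>\<^bsub>Uq n q\<^esub> = 0}"
  "add (Oq_plus n q) = add (Oq n q)" "zero (Oq_plus n q) = zero (Oq n q)"
  "smult (Oq_plus n q) = smult (Oq n q)"
  by (simp_all add: Oq_plus_def Oq_counit_def)

lemma annihilator_iff:
  "x \<in> annihilator n q \<longleftrightarrow> x \<in> carrier (Oq n q) \<and> x \<one>\<^bsub>Uq n q\<^esub> = 0 \<and> (\<forall>\<beta>\<in>pos_roots n. x (E_root n q \<beta>) = 0)"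
proof -
  interpret U: Module.module class_ring "Uq n q" by (rule Uq_module)
  let ?B = "{root_vector n q j i |i j. (i, j) \<in> pos_roots n}"
  have B: "?B = E_root n q ` pos_roots n" by force
  have sub: "?B \<subseteq> carrier (Uq n q)" unfolding B by (auto intro: E_root_in)
  have span: "x X = 0" if x: "x \<in> carrier (Oq n q)" "\<forall>\<beta>\<in>pos_roots n. x (E_root n q \<beta>) = 0" and X: "X \<in> tangent_space n q" for X
  proof -
    obtain a A where A: "finite A" "A \<subseteq> ?B" "X = U.lincomb a A"
      using X unfolding tangent_space_def U.span_def by blast
    have "(\<Oplus>\<^bsub>Uq n q\<^esub>v\<in>A. a v \<odot>\<^bsub>Uq n q\<^esub> v) \<in> carrier (Uq n q) \<and> x (\<Oplus>\<^bsub>Uq n q\<^esub>v\<in>A. a v \<odot>\<^bsub>Uq n q\<^esub> v) = 0"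
      using A(1,2)
    proof (induction A rule: finite_induct)
      case empty
      have "x (0 \<odot>\<^bsub>Uq n q\<^esub> \<zero>\<^bsub>Uq n q\<^esub>) = 0" using Oq_linear(2)[OF x(1), of "\<zero>\<^bsub>Uq n q\<^esub>" "\<zero>\<^bsub>Uq n q\<^esub>" 0] by simp
      then show ?case using U.smult_l_null[of "\<zero>\<^bsub>Uq n q\<^esub>"] by simp
    next
      case (insert v A)
      then have v: "v \<in> carrier (Uq n q)" "x v = 0" using sub x(2) B by auto
      have f: "(\<lambda>v. a v \<odot>\<^bsub>Uq n q\<^esub> v) \<in> A \<rightarrow> carrier (Uq n q)"
      proof
        fix w assume "w \<in> A"
        then have "w \<in> carrier (Uq n q)" using insert.prems sub by blast
        then show "a w \<odot>\<^bsub>Uq n q\<^esub> w \<in> carrier (Uq n q)" by simp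
      qed
      have av: "a v \<odot>\<^bsub>Uq n q\<^esub> v \<in> carrier (Uq n q)" using v by simp
      have IH: "(\<Oplus>\<^bsub>Uq n q\<^esub>v\<in>A. a v \<odot>\<^bsub>Uq n q\<^esub> v) \<in> carrier (Uq n q)" "x (\<Oplus>\<^bsub>Uq n q\<^esub>v\<in>A. a v \<odot>\<^bsub>Uq n q\<^esub> v) = 0"
        using insert by auto
      show ?case
        using insert.hyps f av IH v Oq_linear(1)[OF x(1) av IH(1)] Oq_linear(2)[OF x(1) v(1) v(1)]
        by (simp add: U.finsum_insert)
    qed
    then show ?thesis by (simp add: A(3) U.lincomb_def)
  qed
  have "E_root n q \<beta> \<in> tangent_space n q" if "\<beta> \<in> pos_roots n" for \<beta>
    unfolding tangent_space_def using U.in_own_span[OF sub] that B by auto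
  then show ?thesis
    using span by (auto simp: annihilator_def Oq_plus_simps)
qed

text \<open>
  For \<open>\<beta> = \<alpha>\<^sub>a\<^sub>b\<close> and \<open>\<gamma> = \<alpha>\<^sub>c\<^sub>d\<close> take the matrix coefficient from \<open>e\<^sub>a \<otimes> e\<^sub>c\<close> to \<open>e\<^sub>b \<otimes> e\<^sub>d\<close> in the tensor square.  It vanishes at
  \<open>1\<close> and at root vectors, except that \<open>E\<^sub>d\<^sub>a\<close> maps \<open>e\<^sub>a \<otimes> e\<^sub>b\<close> to \<open>\<nu> e\<^sub>b \<otimes> e\<^sub>d\<close> plus other basis vectors; if \<open>b = c\<close>, this
  is corrected by a multiple of \<open>u\<^sub>d\<^sub>a\<close>.  The correction vanishes at products \<open>E\<^sub>\<delta> E\<^sub>\<eta>\<close> with \<open>\<delta> \<le> \<eta>\<close>, because the end of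
  \<open>\<eta>\<close> is not the start of \<open>\<delta>\<close>.  The value of the coefficient at such a product is found by following \<open>e\<^sub>a \<otimes> e\<^sub>c\<close> through
  \<open>E\<^sub>\<eta>\<close> and then \<open>E\<^sub>\<delta>\<close>.
\<close>

lemma separating_functional:
  assumes q: "q \<noteq> - 1" "q \<noteq> 0" "q \<noteq> 1"
    and \<beta>: "\<beta> \<in> pos_roots n" and \<gamma>: "\<gamma> \<in> pos_roots n" and le: "root_le \<beta> \<gamma>"
  obtains y \<kappa> where "y \<in> annihilator n q" "\<kappa> \<noteq> 0"
    "\<And>\<delta> \<eta>. \<delta> \<in> pos_roots n \<Longrightarrow> \<eta> \<in> pos_roots n \<Longrightarrow> root_le \<delta> \<eta> \<Longrightarrow> pairing n q y \<delta> \<eta>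
      = (if \<delta> = \<beta> \<and> \<eta> = \<gamma> then \<kappa>
         else if crossing \<beta> \<gamma> \<and> \<delta> = (fst \<gamma>, snd \<beta>) \<and> \<eta> = (fst \<beta>, snd \<gamma>) then complex_of_real (q - inverse q) else 0)"
proof -
  let ?q = "complex_of_real q"
  obtain a b c d where eq: "\<beta> = (a, b)" "\<gamma> = (c, d)" by (cases \<beta>; cases \<gamma>)
  note pos = \<beta>[unfolded eq pos_roots_iff] \<gamma>[unfolded eq pos_roots_iff]
  have in1: "(b, d) \<in> {1..n + 1} \<times> {1..n + 1}" "(a, c) \<in> {1..n + 1} \<times> {1..n + 1}" using pos by auto
  have in2: "d \<in> {1..n + 1}" "a \<in> {1..n + 1}" using pos by auto
  obtain x where x: "x \<in> carrier (Oq n q)"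
    "\<And>p. p \<in> carrier (FU n) \<Longrightarrow> x (uq_class n q p) = op_elem (VV_op ?q) p (delta (a, c)) (b, d)"
    using uq_action.matrix_coefficient[OF uq_action_VV[OF q] in1] by blast
  note u = u_coeff[OF q in2]
  \<comment> \<open>Removes the value at \<open>E\<^sub>d\<^sub>a\<close>, which is \<open>\<nu>\<close> if \<open>b = c\<close>.\<close>
  define k where "k = (if b = c then - (?q - inverse ?q) else 0)"
  define y where "y = x \<oplus>\<^bsub>Oq n q\<^esub> (k \<odot>\<^bsub>Oq n q\<^esub> u_coeff n q d a)"
  have y_in: "y \<in> carrier (Oq n q)"
    unfolding y_def by (intro Oq_add_closed Oq_smult_closed x u)
  have y: "y (uq_class n q p) = op_elem (VV_op ?q) p (delta (a, c)) (b, d) + k * op_elem (V_op ?q) p (delta a) d"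
    if "p \<in> carrier (FU n)" for p
    using that by (simp add: y_def Oq_apply uq_class_in x u)
  have y_one: "y \<one>\<^bsub>Uq n q\<^esub> = 0"
    using y[OF FA_0_1(2)] pos by (simp add: uq_class_one VV_op.op_elem_eval V_op.op_elem_eval delta_def k_def)
  have y_root: "y (E_root n q \<delta>) = 0" if \<delta>: "\<delta> \<in> pos_roots n" for \<delta>
  proof -
    obtain i j where ij: "\<delta> = (i, j)" "1 \<le> i" "i < j" "j \<le> n + 1" using \<delta> by (auto simp: pos_roots_def)
    have ab: "a < b" and cd: "c < d" and bd: "b \<le> d" using pos le by (auto simp: eq)
    have "op_elem (VV_op ?q) (root_vector_rep q j i) (delta (a, c)) (b, d) = (if b = c \<and> i = a \<and> j = d then ?q - inverse ?q else 0)"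
      unfolding VV_root_vector[OF q ij(3)] delta_def using ab cd bd by auto
    moreover have "op_elem (V_op ?q) (root_vector_rep q j i) (delta a) d = (if i = a \<and> j = d then 1 else 0)"
      unfolding V_root_vector[OF q ij(3)] delta_def by auto
    ultimately have "y (uq_class n q (root_vector_rep q j i)) = 0"
      using ij by (simp add: y root_vector_rep_carrier k_def)
    then show ?thesis by (simp add: ij(1) root_vector_def)
  qed
  have ann: "y \<in> annihilator n q" using y_in y_one y_root by (simp add: annihilator_iff)
  \<comment> \<open>For \<open>\<beta> = \<gamma>\<close> either tensor factor may be moved first, hence two terms.\<close>
  define \<kappa> where "\<kappa> = (if \<beta> = \<gamma> then ?q + inverse ?q else if b = d then ?q else 1)"
  have \<kappa>: "\<kappa> \<noteq> 0"
  proof -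
    have "?q + inverse ?q \<noteq> 0"
    proof
      assume "?q + inverse ?q = 0"
      then have "?q * (?q + inverse ?q) = 0" by simp
      then have "?q * ?q + 1 = 0" using q by (simp add: distrib_left)
      then show False using q_facts(3)[OF q] by (simp add: add_eq_0_iff2)
    qed
    then show ?thesis using q by (auto simp: \<kappa>_def)
  qed
  show ?thesis
  proof (rule that[OF ann \<kappa>])
    fix \<delta> \<eta> assume \<delta>: "\<delta> \<in> pos_roots n" and \<eta>: "\<eta> \<in> pos_roots n" and le': "root_le \<delta> \<eta>"
    obtain i j k' l where eq': "\<delta> = (i, j)" "\<eta> = (k', l)" by (cases \<delta>; cases \<eta>)
    note pos' = \<delta>[unfolded eq' pos_roots_iff] \<eta>[unfolded eq' pos_roots_iff]
    have r: "root_vector_rep q j i \<in> carrier (FU n)" "root_vector_rep q l k' \<in> carrier (FU n)"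
      using pos' by (auto intro: root_vector_rep_carrier)
    have "pairing n q y \<delta> \<eta> = op_elem (VV_op ?q) (root_vector_rep q j i) (op_elem (VV_op ?q) (root_vector_rep q l k') (delta (a, c))) (b, d)
        + k * op_elem (V_op ?q) (root_vector_rep q j i) (op_elem (V_op ?q) (root_vector_rep q l k') (delta a)) d"
      using r by (simp add: pairing_def eq' root_vector_def uq_class_mult y FA_mult VV_op.op_elem_mult V_op.op_elem_mult)
    also have "op_elem (V_op ?q) (root_vector_rep q j i) (op_elem (V_op ?q) (root_vector_rep q l k') (delta a)) d = 0"
      using pos' le' by (auto simp: V_root_vector[OF q] eq')
    finally have P: "pairing n q y \<delta> \<eta> = op_elem (VV_op ?q) (root_vector_rep q j i) (op_elem (VV_op ?q) (root_vector_rep q l k') (delta (a, c))) (b, d)"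
      by simp
    let ?F = "op_elem (VV_op ?q) (root_vector_rep q l k') (delta (a, c))"
    have kl: "k' < l" and ij: "i < j" and jl: "j \<le> l" "j = l \<Longrightarrow> i \<le> k'" using pos' le' by (auto simp: eq')
    have ab: "a < b" and cd: "c < d" and bd: "b \<le> d" "b = d \<Longrightarrow> a \<le> c" using pos le by (auto simp: eq)
    note F = VV_root_vector[OF q kl, of "delta (a, c)"]
    have F1: "?F (i, d) = (if d = l then (if i = a \<and> k' = c then 1 else 0) + (if k' = a \<and> i = c \<and> a < c then ?q - inverse ?q else 0) else 0)"
      using ij jl by (auto simp: F delta_def)
    have F2: "?F (b, i) = (if b = l \<and> k' = a \<and> i = c then ?q powi (- (if i = k' then 1 else 0)) else 0)"
      using ij jl by (auto simp: F delta_def)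
    have F3: "?F (i, b) = 0" if "i < b" "b < j"
      using that ij jl by (auto simp: F)
    have P': "pairing n q y \<delta> \<eta> = (if b = j then ?q powi ((if d = j then 1 else 0) - (if d = i then 1 else 0)) * ?F (i, d) else 0)
      + (if d = j then ?F (b, i) else 0)"
      using F3 by (simp add: P VV_root_vector[OF q ij])
    consider (main) "\<delta> = \<beta>" "\<eta> = \<gamma>" | (cross) "crossing \<beta> \<gamma>" "\<delta> = (c, b)" "\<eta> = (a, d)"
      | (other) "\<not> (\<delta> = \<beta> \<and> \<eta> = \<gamma>)" "\<not> (crossing \<beta> \<gamma> \<and> \<delta> = (c, b) \<and> \<eta> = (a, d))" by blast
    then show "pairing n q y \<delta> \<eta> = (if \<delta> = \<beta> \<and> \<eta> = \<gamma> then \<kappa>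
         else if crossing \<beta> \<gamma> \<and> \<delta> = (fst \<gamma>, snd \<beta>) \<and> \<eta> = (fst \<beta>, snd \<gamma>) then complex_of_real (q - inverse q) else 0)"
    proof cases
      case main
      then have m: "i = a" "j = b" "k' = c" "l = d" by (auto simp: eq eq')
      show ?thesis using main ab bd cd unfolding P' F1 F2 unfolding m
        by (auto simp: eq \<kappa>_def power_int_minus)
    next
      case cross
      then have m: "i = c" "j = b" "k' = a" "l = d" by (auto simp: eq')
      show ?thesis using cross ab bd cd unfolding P' F1 F2 unfolding m
        by (auto simp: eq crossing_def)
    next
      case other
      have n1: "\<not> (b = j \<and> d = l \<and> i = a \<and> k' = c)" using other(1) by (auto simp: eq eq')
      have n2: "\<not> (b = j \<and> d = l \<and> k' = a \<and> i = c \<and> a < c)"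
      proof
        assume h: "b = j \<and> d = l \<and> k' = a \<and> i = c \<and> a < c"
        then have "b \<noteq> d" using jl by auto
        then show False using h other(2) bd ij by (simp add: eq eq' crossing_def)
      qed
      have n3: "\<not> (d = j \<and> b = l \<and> k' = a \<and> i = c)"
      proof
        assume h: "d = j \<and> b = l \<and> k' = a \<and> i = c"
        then have "b = d" using jl bd by simp
        then have "a = c" using h jl bd by simp
        then show False using h \<open>b = d\<close> n1 by simp
      qed
      have z1: "?F (i, d) = 0" if "b = j"
      proof (cases "d = l")
        case True
        then have "\<not> (i = a \<and> k' = c)" "\<not> (k' = a \<and> i = c \<and> a < c)" using n1 n2 that by blast+
        then show ?thesis unfolding F1 by (simp only: if_False if_cancel add_0)
      qed (simp add: F1)
      have z2: "?F (b, i) = 0" if "d = j"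
      proof -
        have "\<not> (b = l \<and> k' = a \<and> i = c)" using n3 that by blast
        then show ?thesis unfolding F2 by (simp only: if_False)
      qed
      have "pairing n q y \<delta> \<eta> = 0" unfolding P' by (simp add: z1 z2)
      moreover have "\<not> (\<delta> = \<beta> \<and> \<eta> = \<gamma>)" "\<not> (crossing \<beta> \<gamma> \<and> \<delta> = (fst \<gamma>, snd \<beta>) \<and> \<eta> = (fst \<beta>, snd \<gamma>))"
        using other unfolding eq fst_conv snd_conv .
      ultimately show ?thesis by (simp only: if_False)
    qed
  qed
qed

section \<open>The space of one-forms\<close>

lemma Oq_plus_module: "Module.module class_ring (Oq_plus n q)"
proof -
  interpret O: Module.module class_ring "Oq n q" by (rule Oq_module)
  interpret U: ring "Uq n q" by (rule Uq_ring)
  have "submodule class_ring {f \<in> carrier (Oq n q). Oq_counit n q f = 0} (Oq n q)"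
    by (intro submodule.intro Oq_module) (auto simp: Oq_counit_def Oq_apply)
  then show ?thesis unfolding Oq_plus_def by (rule O.submodule_is_module)
qed

lemma annihilator_submodule: "submodule class_ring (annihilator n q) (Oq_plus n q)"
proof -
  interpret O: Module.module class_ring "Oq n q" by (rule Oq_module)
  interpret U: ring "Uq n q" by (rule Uq_ring)
  show ?thesis
    by (intro submodule.intro Oq_plus_module)
      (auto simp: Oq_plus_simps annihilator_iff Oq_apply E_root_in)
qed

lemma Lambda1_module: "Module.module class_ring (Lambda1 n q)"
  unfolding Lambda1_def by (rule quotient_space_module[OF annihilator_submodule])

lemma Lambda1_vectorspace: "vectorspace class_ring (Lambda1 n q)"
  by (intro vectorspace.intro Lambda1_module class_field)

lemma Lambda1_carrier: "carrier (Lambda1 n q) = form_class n q ` carrier (Oq_plus n q)"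
  by (auto simp: Lambda1_def quotient_space_simps rcosets_image form_class_def)

lemma form_class_simps:
  assumes "x \<in> carrier (Oq_plus n q)" "y \<in> carrier (Oq_plus n q)"
  shows "form_class n q x \<oplus>\<^bsub>Lambda1 n q\<^esub> form_class n q y = form_class n q (x \<oplus>\<^bsub>Oq n q\<^esub> y)"
    "c \<odot>\<^bsub>Lambda1 n q\<^esub> form_class n q x = form_class n q (c \<odot>\<^bsub>Oq n q\<^esub> x)"
  using quotient_space_add[OF annihilator_submodule assms] quotient_space_smult[OF annihilator_submodule _ assms(1), of c]
  by (simp_all add: Lambda1_def form_class_def Oq_plus_simps)

text \<open>
  Both sides say that \<open>x - y\<close> lies in the annihilator.
\<close>

lemma form_class_eq_iff:
  assumes x: "x \<in> carrier (Oq_plus n q)" and y: "y \<in> carrier (Oq_plus n q)"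
  shows "form_class n q x = form_class n q y \<longleftrightarrow> (\<forall>\<delta>\<in>pos_roots n. x (E_root n q \<delta>) = y (E_root n q \<delta>))"
proof -
  interpret P: Module.module class_ring "Oq_plus n q" by (rule Oq_plus_module)
  interpret N: abelian_subgroup "annihilator n q" "Oq_plus n q" by (rule submodule_additive[OF annihilator_submodule])
  interpret U: ring "Uq n q" by (rule Uq_ring)
  have "form_class n q x = form_class n q y \<longleftrightarrow> x \<in> form_class n q y"
    using N.a_repr_independence'[of x y] N.a_rcos_self[OF x] y by (auto simp: form_class_def)
  also have "\<dots> \<longleftrightarrow> x \<oplus>\<^bsub>Oq_plus n q\<^esub> \<ominus>\<^bsub>Oq_plus n q\<^esub> y \<in> annihilator n q"
    unfolding form_class_def by (rule N.a_rcos_module[OF y x])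
  also have "\<ominus>\<^bsub>Oq_plus n q\<^esub> y = (- 1) \<odot>\<^bsub>Oq n q\<^esub> y"
    using P.smult_l_minus[of 1 y] P.smult_one[OF y] y by (simp add: Oq_plus_simps class_ring_simps)
  also have "x \<oplus>\<^bsub>Oq_plus n q\<^esub> ((- 1) \<odot>\<^bsub>Oq n q\<^esub> y) \<in> annihilator n q
      \<longleftrightarrow> (\<forall>\<delta>\<in>pos_roots n. x (E_root n q \<delta>) = y (E_root n q \<delta>))"
    using x y by (auto simp: Oq_plus_simps annihilator_iff Oq_apply E_root_in Oq_add_closed Oq_smult_closed)
  finally show ?thesis .
qed

text \<open>
  The value at \<open>E\<^sub>\<delta>\<close> of any representative of a one-form.
\<close>

definition form_val :: "nat \<Rightarrow> real \<Rightarrow> nat \<times> nat \<Rightarrow> form \<Rightarrow> complex"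
  where "form_val n q \<delta> v = (SOME y. y \<in> carrier (Oq_plus n q) \<and> form_class n q y = v) (E_root n q \<delta>)"

lemma form_val_class:
  assumes y: "y \<in> carrier (Oq_plus n q)" and \<delta>: "\<delta> \<in> pos_roots n"
  shows "form_val n q \<delta> (form_class n q y) = y (E_root n q \<delta>)"
proof -
  let ?z = "SOME z. z \<in> carrier (Oq_plus n q) \<and> form_class n q z = form_class n q y"
  have "?z \<in> carrier (Oq_plus n q) \<and> form_class n q ?z = form_class n q y"
    by (rule someI[of _ y]) (use y in simp)
  then show ?thesis using form_class_eq_iff[of ?z n q y] y \<delta> by (simp add: form_val_def)
qed

lemma form_val_linear:
  assumes "v \<in> carrier (Lambda1 n q)" "w \<in> carrier (Lambda1 n q)" "\<delta> \<in> pos_roots n"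
  shows "form_val n q \<delta> (v \<oplus>\<^bsub>Lambda1 n q\<^esub> w) = form_val n q \<delta> v + form_val n q \<delta> w"
    "form_val n q \<delta> (c \<odot>\<^bsub>Lambda1 n q\<^esub> v) = c * form_val n q \<delta> v"
proof -
  interpret P: Module.module class_ring "Oq_plus n q" by (rule Oq_plus_module)
  obtain x y where xy: "x \<in> carrier (Oq_plus n q)" "y \<in> carrier (Oq_plus n q)" "v = form_class n q x" "w = form_class n q y"
    using assms by (auto simp: Lambda1_carrier)
  have "x \<oplus>\<^bsub>Oq n q\<^esub> y \<in> carrier (Oq_plus n q)" "c \<odot>\<^bsub>Oq n q\<^esub> x \<in> carrier (Oq_plus n q)"
    using P.add.m_closed[OF xy(1,2)] P.smult_closed[of c x] xy(1) by (simp_all only: Oq_plus_simps, simp_all)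
  then show "form_val n q \<delta> (v \<oplus>\<^bsub>Lambda1 n q\<^esub> w) = form_val n q \<delta> v + form_val n q \<delta> w"
    "form_val n q \<delta> (c \<odot>\<^bsub>Lambda1 n q\<^esub> v) = c * form_val n q \<delta> v"
    using xy assms(3) by (simp_all add: form_class_simps form_val_class Oq_apply E_root_in)
qed

lemma form_eqI:
  assumes "v \<in> carrier (Lambda1 n q)" "w \<in> carrier (Lambda1 n q)"
    "\<And>\<delta>. \<delta> \<in> pos_roots n \<Longrightarrow> form_val n q \<delta> v = form_val n q \<delta> w"
  shows "v = w"
proof -
  obtain x y where xy: "x \<in> carrier (Oq_plus n q)" "y \<in> carrier (Oq_plus n q)" "v = form_class n q x" "w = form_class n q y"
    using assms by (auto simp: Lambda1_carrier)
  then have "\<forall>\<delta>\<in>pos_roots n. x (E_root n q \<delta>) = y (E_root n q \<delta>)"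
    using assms(3) by (metis form_val_class)
  then show ?thesis using xy by (simp add: form_class_eq_iff)
qed

context
  fixes n :: nat and q :: real
  assumes q: "q \<noteq> - 1" "q \<noteq> 0" "q \<noteq> 1"
begin

lemma u_coeff_plus:
  assumes "(i, j) \<in> pos_roots n"
  shows "u_coeff n q j i \<in> carrier (Oq_plus n q)"
    "(k, l) \<in> pos_roots n \<Longrightarrow> u_coeff n q j i (root_vector n q l k) = (if k = i \<and> l = j then 1 else 0)"
proof -
  have ij: "j \<in> {1..n + 1}" "i \<in> {1..n + 1}" "i \<noteq> j" using assms by (auto simp: pos_roots_iff)
  note u = u_coeff[OF q ij(1,2)]
  show "u_coeff n q j i \<in> carrier (Oq_plus n q)"
    using u ij by (simp add: Oq_plus_simps uq_class_one FA_0_1 V_op.op_elem_eval delta_def)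
  show "u_coeff n q j i (root_vector n q l k) = (if k = i \<and> l = j then 1 else 0)" if "(k, l) \<in> pos_roots n"
    using that u by (auto simp: root_vector_def root_vector_rep_carrier pos_roots_iff V_root_vector[OF q] delta_def)
qed

lemma e_root_in: "\<delta> \<in> pos_roots n \<Longrightarrow> e_root n q \<delta> \<in> carrier (Lambda1 n q)"
  by (cases \<delta>) (auto simp: Lambda1_carrier u_coeff_plus)

lemma form_val_e_root:
  "\<delta> \<in> pos_roots n \<Longrightarrow> \<eta> \<in> pos_roots n \<Longrightarrow> form_val n q \<delta> (e_root n q \<eta>) = (if \<delta> = \<eta> then 1 else 0)"
  by (cases \<delta>; cases \<eta>) (auto simp: form_val_class u_coeff_plus)

lemma e_root_inj: "inj_on (e_root n q) (pos_roots n)"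
proof (rule inj_onI)
  fix \<delta> \<eta> assume a: "\<delta> \<in> pos_roots n" "\<eta> \<in> pos_roots n" "e_root n q \<delta> = e_root n q \<eta>"
  then have "form_val n q \<delta> (e_root n q \<eta>) = 1" using form_val_e_root[of \<delta> \<delta>] by simp
  then show "\<delta> = \<eta>" using form_val_e_root[of \<delta> \<eta>] a by (simp split: if_splits)
qed

interpretation L: vectorspace class_ring "Lambda1 n q" by (rule Lambda1_vectorspace)

lemma form_val_lincomb:
  assumes "finite A" "A \<subseteq> carrier (Lambda1 n q)" "\<delta> \<in> pos_roots n"
  shows "form_val n q \<delta> (L.lincomb a A) = (\<Sum>v\<in>A. a v * form_val n q \<delta> v)"
  using assms(1,2)
proof (induction A rule: finite_induct)
  case empty
  have "form_val n q \<delta> (0 \<odot>\<^bsub>Lambda1 n q\<^esub> \<zero>\<^bsub>Lambda1 n q\<^esub>) = 0"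
    using form_val_linear(2)[of "\<zero>\<^bsub>Lambda1 n q\<^esub>" n q "\<zero>\<^bsub>Lambda1 n q\<^esub>" \<delta> 0] assms(3) by simp
  then show ?case using L.smult_l_null[of "\<zero>\<^bsub>Lambda1 n q\<^esub>"] by (simp add: L.lincomb_def)
next
  case (insert v A)
  have v: "v \<in> carrier (Lambda1 n q)" using insert.prems by simp
  have f: "(\<lambda>v. a v \<odot>\<^bsub>Lambda1 n q\<^esub> v) \<in> A \<rightarrow> carrier (Lambda1 n q)"
    using insert.prems L.smult_closed by auto
  have c: "L.lincomb a A \<in> carrier (Lambda1 n q)" "a v \<odot>\<^bsub>Lambda1 n q\<^esub> v \<in> carrier (Lambda1 n q)"
    using f v L.smult_closed[of "a v" v] by (auto simp: L.lincomb_def intro!: L.finsum_closed)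
  have "L.lincomb a (insert v A) = a v \<odot>\<^bsub>Lambda1 n q\<^esub> v \<oplus>\<^bsub>Lambda1 n q\<^esub> L.lincomb a A"
    using insert.hyps f c(2) by (simp add: L.lincomb_def L.finsum_insert)
  then show ?case
    using insert form_val_linear(1)[OF c(2,1) assms(3)] form_val_linear(2)[OF v v assms(3), of "a v"] by simp
qed

lemma form_val_lincomb_e:
  assumes "\<delta> \<in> pos_roots n"
  shows "form_val n q \<delta> (L.lincomb a (e_root n q ` pos_roots n)) = a (e_root n q \<delta>)"
proof -
  have "form_val n q \<delta> (L.lincomb a (e_root n q ` pos_roots n)) = (\<Sum>v\<in>e_root n q ` pos_roots n. a v * form_val n q \<delta> v)"
    using finite_pos_roots e_root_in assms by (intro form_val_lincomb) auto
  also have "\<dots> = (\<Sum>\<eta>\<in>pos_roots n. a (e_root n q \<eta>) * form_val n q \<delta> (e_root n q \<eta>))"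
    using e_root_inj by (simp add: sum.reindex)
  also have "\<dots> = (\<Sum>\<eta>\<in>pos_roots n. if \<eta> = \<delta> then a (e_root n q \<eta>) else 0)"
    using assms by (intro sum.cong) (auto simp: form_val_e_root)
  also have "\<dots> = a (e_root n q \<delta>)" using assms finite_pos_roots by (simp add: sum.delta)
  finally show ?thesis .
qed

lemma form_expand:
  assumes v: "v \<in> carrier (Lambda1 n q)"
  obtains a where "v = L.lincomb a (e_root n q ` pos_roots n)" "\<And>\<delta>. \<delta> \<in> pos_roots n \<Longrightarrow> a (e_root n q \<delta>) = form_val n q \<delta> v"
proof -
  define a where "a w = form_val n q (the_inv_into (pos_roots n) (e_root n q) w) v" for w
  have a: "a (e_root n q \<delta>) = form_val n q \<delta> v" if "\<delta> \<in> pos_roots n" for \<delta>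
    using that by (simp add: a_def the_inv_into_f_f[OF e_root_inj])
  have "L.lincomb a (e_root n q ` pos_roots n) \<in> carrier (Lambda1 n q)"
    using e_root_in finite_pos_roots by (intro L.lincomb_closed) auto
  then have "v = L.lincomb a (e_root n q ` pos_roots n)"
    using v a by (intro form_eqI) (auto simp: form_val_lincomb_e)
  then show ?thesis using a that by blast
qed

lemma e_root_basis: "L.basis (e_root n q ` pos_roots n)"
proof -
  let ?B = "e_root n q ` pos_roots n"
  have fin: "finite ?B" using finite_pos_roots by simp
  have sub: "?B \<subseteq> carrier (Lambda1 n q)" using e_root_in by auto
  have "L.lin_indpt ?B"
  proof (rule L.finite_lin_indpt2[OF fin sub])
    fix a assume 0: "L.lincomb a ?B = \<zero>\<^bsub>Lambda1 n q\<^esub>"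
    have "a (e_root n q \<delta>) = 0" if \<delta>: "\<delta> \<in> pos_roots n" for \<delta>
    proof -
      have "form_val n q \<delta> (L.lincomb (\<lambda>_. 0) {}) = 0" using \<delta> by (subst form_val_lincomb) auto
      then have "form_val n q \<delta> \<zero>\<^bsub>Lambda1 n q\<^esub> = 0" by (simp add: L.lincomb_def)
      then show ?thesis using form_val_lincomb_e[OF \<delta>, of a] 0 by simp
    qed
    then show "\<forall>v\<in>?B. a v = \<zero>\<^bsub>class_ring\<^esub>" by auto
  qed
  moreover have "L.span ?B = carrier (Lambda1 n q)"
  proof
    show "L.span ?B \<subseteq> carrier (Lambda1 n q)" using L.span_is_subset2[OF sub] .
    show "carrier (Lambda1 n q) \<subseteq> L.span ?B"
    proof
      fix v assume "v \<in> carrier (Lambda1 n q)"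
      then obtain a where "v = L.lincomb a ?B" by (rule form_expand)
      then show "v \<in> L.span ?B" using fin by (auto simp: L.span_def)
    qed
  qed
  ultimately show ?thesis unfolding L.basis_def using sub by blast
qed

end

section \<open>Coproducts of matrix coefficients\<close>

text \<open>
  Insert the identity matrix, as a sum over the standard basis, between \<open>\<rho>(X)\<close> and \<open>\<rho>(Y)\<close>.
\<close>

lemma Oq_coproduct_exists:
  assumes x: "x \<in> carrier (Oq n q)"
  shows "\<exists>m a b. Oq_coproduct n q x m a b"
proof -
  interpret U: ring "Uq n q" by (rule Uq_ring)
  obtain d \<rho> v w where \<rho>: "type1_rep n q d \<rho>" "v \<in> carrier_vec d" "w \<in> carrier_vec d"
    "x = (\<lambda>X\<in>carrier (Uq n q). scalar_prod w (\<rho> X *\<^sub>v v))" using OqE[OF x] .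
  note car = type1_rep_carrier[OF \<rho>(1)]
  have hom: "\<rho> \<in> Ring.ring_hom (Uq n q) (ring_mat TYPE(complex) d ())" using \<rho>(1) by (simp add: type1_rep_def)
  define a where "a k = (\<lambda>X\<in>carrier (Uq n q). scalar_prod w (\<rho> X *\<^sub>v unit_vec d k))" for k
  define b where "b k = (\<lambda>X\<in>carrier (Uq n q). scalar_prod (unit_vec d k) (\<rho> X *\<^sub>v v))" for k
  have "x (X \<otimes>\<^bsub>Uq n q\<^esub> Y) = (\<Sum>k<d. a k X * b k Y)" if X: "X \<in> carrier (Uq n q)" and Y: "Y \<in> carrier (Uq n q)" for X Y
  proof -
    note cX = car[OF X] and cY = car[OF Y]
    have u: "\<rho> Y *\<^sub>v v \<in> carrier_vec d" by (rule mult_mat_vec_carrier[OF cY \<rho>(2)])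
    have "x (X \<otimes>\<^bsub>Uq n q\<^esub> Y) = scalar_prod w (\<rho> X *\<^sub>v (\<rho> Y *\<^sub>v v))"
      using ring_hom_mult[OF hom X Y] X Y \<rho>(2) cX cY by (simp add: \<rho>(4) ring_mat_simps assoc_mult_mat_vec)
    also have "\<dots> = (\<Sum>r<d. \<Sum>k<d. w $ r * (\<rho> X $$ (r, k) * (\<rho> Y *\<^sub>v v) $ k))"
      using cX cY u by (simp add: scalar_prod_def sum_distrib_left atLeast0LessThan)
    also have "\<dots> = (\<Sum>k<d. \<Sum>r<d. w $ r * (\<rho> X $$ (r, k) * (\<rho> Y *\<^sub>v v) $ k))"
      by (rule sum.swap)
    also have "\<dots> = (\<Sum>k<d. a k X * b k Y)"
    proof (rule sum.cong)
      fix k assume "k \<in> {..<d}"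
      then have k: "k < d" by simp
      have "a k X = (\<Sum>r<d. w $ r * \<rho> X $$ (r, k))"
        using X cX k by (simp add: a_def scalar_prod_def atLeast0LessThan unit_vec_def if_distrib cong: if_cong)
      moreover have "b k Y = (\<rho> Y *\<^sub>v v) $ k"
        using Y k scalar_prod_left_unit[OF u k] by (simp add: b_def)
      ultimately show "(\<Sum>r<d. w $ r * (\<rho> X $$ (r, k) * (\<rho> Y *\<^sub>v v) $ k)) = a k X * b k Y"
        by (simp add: sum_distrib_right mult.assoc)
    qed simp
    finally show ?thesis .
  qed
  moreover have "a k \<in> carrier (Oq n q)" "b k \<in> carrier (Oq n q)" for k
    unfolding a_def b_def using \<rho> by (auto intro!: OqI)
  ultimately have "Oq_coproduct n q x d a b" by (simp add: Oq_coproduct_def)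
  then show ?thesis by blast
qed

lemma counit_root_vector:
  "op_elem (\<lambda>g (f :: nat \<Rightarrow> complex) r. uq_counit_gen g * f r) (root_vector_rep q j i) f = (\<lambda>r. 0)"
  by (induction j arbitrary: f) (auto simp: counit_action.op_elem_eval)

lemma plus_part:
  assumes a: "a \<in> carrier (Oq n q)"
  shows "plus_part n q a \<in> carrier (Oq_plus n q)"
    "\<delta> \<in> pos_roots n \<Longrightarrow> plus_part n q a (E_root n q \<delta>) = a (E_root n q \<delta>)"
proof -
  have one: "\<one>\<^bsub>Oq n q\<^esub> (uq_class n q 1) = 1"
    by (simp add: Oq_one_class FA_0_1 uq_counit_eq counit_action.op_elem_eval delta_def)
  show "plus_part n q a \<in> carrier (Oq_plus n q)"
    using a one by (simp add: plus_part_def Oq_plus_simps Oq_counit_def Oq_add_closed Oq_smult_closed Oq_one_closed Oq_apply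
        uq_class_one uq_class_in FA_0_1)
  show "plus_part n q a (E_root n q \<delta>) = a (E_root n q \<delta>)" if \<delta>: "\<delta> \<in> pos_roots n"
  proof -
    obtain i j where ij: "\<delta> = (i, j)" "1 \<le> i" "i < j" "j \<le> n + 1" using \<delta> by (auto simp: pos_roots_def)
    have "\<one>\<^bsub>Oq n q\<^esub> (E_root n q \<delta>) = 0"
      using ij by (simp add: root_vector_def Oq_one_class root_vector_rep_carrier uq_counit_eq counit_root_vector)
    then show ?thesis using E_root_in[OF \<delta>, of q] by (simp add: plus_part_def Oq_apply)
  qed
qed

section \<open>The degree-two relations\<close>

lemma root_le_total: "root_le \<beta> \<gamma> \<or> root_le \<gamma> \<beta>"
  and root_le_antisym: "root_le \<beta> \<gamma> \<Longrightarrow> root_le \<gamma> \<beta> \<Longrightarrow> \<beta> = \<gamma>"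
  and root_le_refl: "root_le \<beta> \<beta>"
  by (cases \<beta>; cases \<gamma>; auto)+

lemma crossing_nested:
  assumes "crossing (a, b) (c, d)" "(a, b) \<in> pos_roots n" "(c, d) \<in> pos_roots n"
  shows "nested (c, b) (a, d)" "root_le (c, b) (a, d)" "(c, b) \<in> pos_roots n" "(a, d) \<in> pos_roots n"
    "\<not> crossing (c, b) (a, d)"
  using assms by (auto simp: nested_def crossing_def pos_roots_iff)

text \<open>
  The relators with the product \<open>t \<beta> \<gamma>\<close> in place of \<open>e\<^sub>\<beta> \<otimes> e\<^sub>\<gamma>\<close>.  Nested roots are orthogonal, so the power of \<open>q\<close> is \<open>1\<close>
  where the term with \<open>\<nu>\<close> is present, and both kinds of relator have the same first two terms.
\<close>

definition relator :: "nat \<Rightarrow> real \<Rightarrow> (nat \<times> nat \<Rightarrow> nat \<times> nat \<Rightarrow> ('w word \<Rightarrow>\<^sub>0 complex)) \<Rightarrow> nat \<times> nat \<Rightarrow> nat \<times> nat \<Rightarrow> 'w word \<Rightarrow>\<^sub>0 complex"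
  where "relator n q t \<beta> \<gamma> = t \<beta> \<gamma> + scalar (complex_of_real (q powi root_inner n \<beta> \<gamma>)) * t \<gamma> \<beta>
    + (if nested \<beta> \<gamma> then scalar (complex_of_real (q - inverse q)) * t (fst \<beta>, snd \<gamma>) (fst \<gamma>, snd \<beta>) else 0)"

text \<open>
  Compare coefficients.  A relator contributes its coefficient at its ordered pair, the multiple by a power of
  \<open>q\<close> at the opposite pair, and, if it is nested, the multiple by \<open>\<nu>\<close> at the pair opposite to the crossing pair of the
  same sum: these are the terms on the right of \<open>swap\<close>.  On the diagonal the first two contributions
  fall on the same pair and add up to \<open>1 + q\<^sup>2\<close> times the coefficient.
\<close>

lemma sum_by_relators:
  fixes m :: "nat \<times> nat \<Rightarrow> nat \<times> nat \<Rightarrow> complex" and q :: real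
  assumes swap: "\<And>\<beta> \<gamma>. \<beta> \<in> pos_roots n \<Longrightarrow> \<gamma> \<in> pos_roots n \<Longrightarrow> root_le \<beta> \<gamma> \<Longrightarrow> \<beta> \<noteq> \<gamma> \<Longrightarrow>
      m \<gamma> \<beta> = complex_of_real (q powi root_inner n \<beta> \<gamma>) * m \<beta> \<gamma>
        + (if crossing \<beta> \<gamma> then complex_of_real (q - inverse q) * m (fst \<gamma>, snd \<beta>) (fst \<beta>, snd \<gamma>) else 0)"
    and m': "\<And>\<beta> \<gamma>. m' \<beta> \<gamma> = (if \<beta> = \<gamma> then m \<beta> \<gamma> / (1 + complex_of_real q * complex_of_real q) else m \<beta> \<gamma>)"
    and q: "complex_of_real q * complex_of_real q \<noteq> - 1"
  defines "Le \<equiv> {(\<beta>, \<gamma>). \<beta> \<in> pos_roots n \<and> \<gamma> \<in> pos_roots n \<and> root_le \<beta> \<gamma>}"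
  shows "(\<Sum>\<beta>\<in>pos_roots n. \<Sum>\<gamma>\<in>pos_roots n. scalar (m \<beta> \<gamma>) * t \<beta> \<gamma>) = (\<Sum>(\<beta>, \<gamma>)\<in>Le. scalar (m' \<beta> \<gamma>) * relator n q t \<beta> \<gamma>)"
proof -
  let ?P = "pos_roots n" and ?\<nu> = "complex_of_real (q - inverse q)" and ?\<kappa> = "\<lambda>\<beta> \<gamma>. complex_of_real (q powi root_inner n \<beta> \<gamma>)"
  define Lt where "Lt = {(\<beta>, \<gamma>). \<beta> \<in> ?P \<and> \<gamma> \<in> ?P \<and> root_le \<beta> \<gamma> \<and> \<beta> \<noteq> \<gamma>}"
  define Gt where "Gt = {(\<beta>, \<gamma>). \<beta> \<in> ?P \<and> \<gamma> \<in> ?P \<and> root_le \<gamma> \<beta> \<and> \<beta> \<noteq> \<gamma>}"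
  define Di where "Di = {(\<beta>, \<gamma>). \<beta> \<in> ?P \<and> \<gamma> = \<beta>}"
  define s where "s \<beta> \<gamma> = scalar (m \<beta> \<gamma>) * t \<beta> \<gamma>" for \<beta> \<gamma>
  have fin: "finite (?P \<times> ?P)" using finite_pos_roots by simp
  have fins: "finite Le" "finite Lt" "finite Gt" "finite Di"
    by (rule finite_subset[OF _ fin]; auto simp: Le_def Lt_def Gt_def Di_def)+
  have split_Le: "Le = Lt \<union> Di" "Lt \<inter> Di = {}"
    using root_le_refl by (auto simp: Le_def Lt_def Di_def)
  \<comment> \<open>The order is total, so a pair is ordered, or its reverse is and the entries differ.\<close>
  have cases: "p \<in> ?P \<times> ?P \<longleftrightarrow> p \<in> Le \<union> Gt" "p \<notin> Le \<or> p \<notin> Gt" for p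
    using root_le_total[of "fst p" "snd p"] root_le_antisym[of "fst p" "snd p"] root_le_refl[of "fst p"]
    by (cases p; simp add: Le_def Gt_def; metis)+
  have split_all: "?P \<times> ?P = Le \<union> Gt" by (simp only: set_eq_iff cases(1)) simp
  have disjoint: "Le \<inter> Gt = {}" using cases(2) by blast
  have "(\<Sum>\<beta>\<in>?P. \<Sum>\<gamma>\<in>?P. s \<beta> \<gamma>) = (\<Sum>(\<beta>, \<gamma>)\<in>?P \<times> ?P. s \<beta> \<gamma>)"
    by (simp add: sum.cartesian_product)
  also have "\<dots> = (\<Sum>(\<beta>, \<gamma>)\<in>Lt. s \<beta> \<gamma>) + (\<Sum>(\<beta>, \<gamma>)\<in>Di. s \<beta> \<gamma>) + (\<Sum>(\<beta>, \<gamma>)\<in>Gt. s \<beta> \<gamma>)"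
    unfolding split_all sum.union_disjoint[OF fins(1,3) disjoint]
    unfolding split_Le(1) sum.union_disjoint[OF fins(2,4) split_Le(2)] ..
  also have "(\<Sum>(\<beta>, \<gamma>)\<in>Gt. s \<beta> \<gamma>) = (\<Sum>(\<beta>, \<gamma>)\<in>Lt. s \<gamma> \<beta>)"
    by (rule sum.reindex_bij_witness[of _ prod.swap prod.swap]) (auto simp: Lt_def Gt_def)
  also have "\<dots> = (\<Sum>(\<beta>, \<gamma>)\<in>Lt. scalar (?\<kappa> \<beta> \<gamma> * m \<beta> \<gamma>) * t \<gamma> \<beta>
      + (if crossing \<beta> \<gamma> then scalar (?\<nu> * m (fst \<gamma>, snd \<beta>) (fst \<beta>, snd \<gamma>)) * t \<gamma> \<beta> else 0))"
  proof (rule sum.cong)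
    fix p assume "p \<in> Lt"
    then obtain \<beta> \<gamma> where p: "p = (\<beta>, \<gamma>)" "\<beta> \<in> ?P" "\<gamma> \<in> ?P" "root_le \<beta> \<gamma>" "\<beta> \<noteq> \<gamma>" by (auto simp: Lt_def)
    show "(case p of (\<beta>, \<gamma>) \<Rightarrow> s \<gamma> \<beta>) = (case p of (\<beta>, \<gamma>) \<Rightarrow> scalar (?\<kappa> \<beta> \<gamma> * m \<beta> \<gamma>) * t \<gamma> \<beta>
      + (if crossing \<beta> \<gamma> then scalar (?\<nu> * m (fst \<gamma>, snd \<beta>) (fst \<beta>, snd \<gamma>)) * t \<gamma> \<beta> else 0))"
      unfolding s_def p(1) prod.case swap[OF p(2-5)] by (simp add: scalar_add distrib_right)
  qed simp
  also have "\<dots> = (\<Sum>(\<beta>, \<gamma>)\<in>Lt. scalar (?\<kappa> \<beta> \<gamma> * m \<beta> \<gamma>) * t \<gamma> \<beta>)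
      + (\<Sum>(\<beta>, \<gamma>)\<in>Lt. if crossing \<beta> \<gamma> then scalar (?\<nu> * m (fst \<gamma>, snd \<beta>) (fst \<beta>, snd \<gamma>)) * t \<gamma> \<beta> else 0)"
    by (simp add: case_prod_unfold sum.distrib)
  also have "(\<Sum>(\<beta>, \<gamma>)\<in>Lt. if crossing \<beta> \<gamma> then scalar (?\<nu> * m (fst \<gamma>, snd \<beta>) (fst \<beta>, snd \<gamma>)) * t \<gamma> \<beta> else 0)
      = (\<Sum>(\<beta>, \<gamma>)\<in>{(\<beta>, \<gamma>)\<in>Lt. crossing \<beta> \<gamma>}. scalar (?\<nu> * m (fst \<gamma>, snd \<beta>) (fst \<beta>, snd \<gamma>)) * t \<gamma> \<beta>)"
    using fins(2) by (intro sum.mono_neutral_cong_right) (auto split: if_splits)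
  \<comment> \<open>Exchanging the starting points of two roots is a bijection between crossing and nested pairs.\<close>
  also have "\<dots> = (\<Sum>(\<beta>, \<gamma>)\<in>{(\<beta>, \<gamma>)\<in>Lt. nested \<beta> \<gamma>}. scalar (?\<nu> * m \<beta> \<gamma>) * t (fst \<beta>, snd \<gamma>) (fst \<gamma>, snd \<beta>))"
    by (rule sum.reindex_bij_witness[of _ "\<lambda>(\<beta>, \<gamma>). ((fst \<gamma>, snd \<beta>), (fst \<beta>, snd \<gamma>))" "\<lambda>(\<beta>, \<gamma>). ((fst \<gamma>, snd \<beta>), (fst \<beta>, snd \<gamma>))"])
      (auto simp: Lt_def nested_def crossing_def pos_roots_iff)
  also have "\<dots> = (\<Sum>(\<beta>, \<gamma>)\<in>Lt. if nested \<beta> \<gamma> then scalar (?\<nu> * m \<beta> \<gamma>) * t (fst \<beta>, snd \<gamma>) (fst \<gamma>, snd \<beta>) else 0)"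
    using fins(2) by (intro sum.mono_neutral_cong_left) (auto split: if_splits)
  finally have lhs: "(\<Sum>\<beta>\<in>?P. \<Sum>\<gamma>\<in>?P. s \<beta> \<gamma>) = (\<Sum>(\<beta>, \<gamma>)\<in>Lt. s \<beta> \<gamma>) + (\<Sum>(\<beta>, \<gamma>)\<in>Di. s \<beta> \<gamma>)
      + ((\<Sum>(\<beta>, \<gamma>)\<in>Lt. scalar (?\<kappa> \<beta> \<gamma> * m \<beta> \<gamma>) * t \<gamma> \<beta>)
      + (\<Sum>(\<beta>, \<gamma>)\<in>Lt. if nested \<beta> \<gamma> then scalar (?\<nu> * m \<beta> \<gamma>) * t (fst \<beta>, snd \<gamma>) (fst \<gamma>, snd \<beta>) else 0))" .
  have "(\<Sum>(\<beta>, \<gamma>)\<in>Le. scalar (m' \<beta> \<gamma>) * relator n q t \<beta> \<gamma>)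
    = (\<Sum>(\<beta>, \<gamma>)\<in>Lt. scalar (m' \<beta> \<gamma>) * relator n q t \<beta> \<gamma>) + (\<Sum>(\<beta>, \<gamma>)\<in>Di. scalar (m' \<beta> \<gamma>) * relator n q t \<beta> \<gamma>)"
    unfolding split_Le(1) sum.union_disjoint[OF fins(2,4) split_Le(2)] ..
  also have "(\<Sum>(\<beta>, \<gamma>)\<in>Di. scalar (m' \<beta> \<gamma>) * relator n q t \<beta> \<gamma>) = (\<Sum>(\<beta>, \<gamma>)\<in>Di. s \<beta> \<gamma>)"
  proof (rule sum.cong)
    fix p assume "p \<in> Di"
    then obtain \<beta> where p: "p = (\<beta>, \<beta>)" "\<beta> \<in> ?P" by (auto simp: Di_def)
    obtain a b where ab: "\<beta> = (a, b)" by (cases \<beta>)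
    have "root_inner n \<beta> \<beta> = 2" using root_inner_eq[of a b n a b] p(2) by (auto simp: ab pos_roots_iff)
    then have "relator n q t \<beta> \<beta> = scalar (1 + complex_of_real q * complex_of_real q) * t \<beta> \<beta>"
      by (simp add: relator_def nested_def scalar_add distrib_right power2_eq_square)
    then have "scalar (m' \<beta> \<beta>) * relator n q t \<beta> \<beta>
      = scalar (m' \<beta> \<beta> * (1 + complex_of_real q * complex_of_real q)) * t \<beta> \<beta>"
      by (simp add: scalar_mult mult.assoc)
    also have "m' \<beta> \<beta> * (1 + complex_of_real q * complex_of_real q) = m \<beta> \<beta>"
      using q by (simp add: m' add_eq_0_iff)
    finally show "(case p of (\<beta>, \<gamma>) \<Rightarrow> scalar (m' \<beta> \<gamma>) * relator n q t \<beta> \<gamma>) = (case p of (\<beta>, \<gamma>) \<Rightarrow> s \<beta> \<gamma>)"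
      by (simp add: p s_def)
  qed simp
  also have "(\<Sum>(\<beta>, \<gamma>)\<in>Lt. scalar (m' \<beta> \<gamma>) * relator n q t \<beta> \<gamma>)
    = (\<Sum>(\<beta>, \<gamma>)\<in>Lt. s \<beta> \<gamma> + (scalar (?\<kappa> \<beta> \<gamma> * m \<beta> \<gamma>) * t \<gamma> \<beta>
      + (if nested \<beta> \<gamma> then scalar (?\<nu> * m \<beta> \<gamma>) * t (fst \<beta>, snd \<gamma>) (fst \<gamma>, snd \<beta>) else 0)))"
  proof (rule sum.cong)
    fix p assume "p \<in> Lt"
    then obtain \<beta> \<gamma> where p: "p = (\<beta>, \<gamma>)" "\<beta> \<noteq> \<gamma>" by (auto simp: Lt_def)
    have comm: "scalar (x * y) = scalar (y * x)" for x y by (simp add: mult.commute)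
    show "(case p of (\<beta>, \<gamma>) \<Rightarrow> scalar (m' \<beta> \<gamma>) * relator n q t \<beta> \<gamma>) = (case p of (\<beta>, \<gamma>) \<Rightarrow> s \<beta> \<gamma> + (scalar (?\<kappa> \<beta> \<gamma> * m \<beta> \<gamma>) * t \<gamma> \<beta>
      + (if nested \<beta> \<gamma> then scalar (?\<nu> * m \<beta> \<gamma>) * t (fst \<beta>, snd \<gamma>) (fst \<gamma>, snd \<beta>) else 0)))"
      unfolding comm[of "?\<kappa> _ _"] comm[of "?\<nu>"]
      using p(2) by (simp add: p(1) m' relator_def s_def scalar_mult distrib_left mult.assoc)
  qed simp
  also have "\<dots> = (\<Sum>(\<beta>, \<gamma>)\<in>Lt. s \<beta> \<gamma>) + ((\<Sum>(\<beta>, \<gamma>)\<in>Lt. scalar (?\<kappa> \<beta> \<gamma> * m \<beta> \<gamma>) * t \<gamma> \<beta>)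
      + (\<Sum>(\<beta>, \<gamma>)\<in>Lt. if nested \<beta> \<gamma> then scalar (?\<nu> * m \<beta> \<gamma>) * t (fst \<beta>, snd \<gamma>) (fst \<gamma>, snd \<beta>) else 0))"
    by (simp add: case_prod_unfold sum.distrib)
  finally show ?thesis using lhs by (simp add: s_def add_ac)
qed

section \<open>The tensor algebra\<close>

context
  fixes V :: "(complex, 'v) module"
  assumes V: "Module.module class_ring V"
begin

interpretation V: Module.module class_ring V by (rule V)

abbreviation "FV \<equiv> free_algebra (carrier V)"

lemma linearity_relations_carrier: "linearity_relations V \<subseteq> carrier FV"
  unfolding linearity_relations_def by (auto simp: FA_letter intro!: FA_closed)

definition tensor_class where "tensor_class p = tensor_ideal V +>\<^bsub>FV\<^esub> p"

lemmas tensor_ring = presented_ring[OF linearity_relations_carrier, folded tensor_ideal_def, folded tensor_algebra_def]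
lemmas tensor_class_in = pres_class_in[OF linearity_relations_carrier, folded tensor_ideal_def, folded tensor_algebra_def tensor_class_def]
lemmas tensor_class_mult = pres_class_mult[OF linearity_relations_carrier, folded tensor_ideal_def, folded tensor_algebra_def tensor_class_def]
lemmas tensor_class_add = pres_class_add[OF linearity_relations_carrier, folded tensor_ideal_def, folded tensor_algebra_def tensor_class_def]
lemmas tensor_class_smult = pres_class_smult[OF linearity_relations_carrier, folded tensor_ideal_def, folded tensor_algebra_def tensor_class_def]
lemmas tensor_class_sum = pres_class_sum[OF linearity_relations_carrier, folded tensor_ideal_def, folded tensor_algebra_def tensor_class_def]
lemmas tensor_class_zero = pres_class_zero[OF linearity_relations_carrier, folded tensor_ideal_def, folded tensor_algebra_def tensor_class_def]
lemmas tensor_class_eq_iff = pres_class_eq_iff[OF linearity_relations_carrier, folded tensor_ideal_def, folded tensor_class_def]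

lemma tensor2_eq: "tensor2 V v w = tensor_class (letter v) \<otimes>\<^bsub>tensor_algebra V\<^esub> tensor_class (letter w)"
  by (simp add: tensor2_def tensor_class_def)

lemma tensor_class_linear:
  assumes "v \<in> carrier V" "w \<in> carrier V"
  shows "tensor_class (letter (v \<oplus>\<^bsub>V\<^esub> w)) = tensor_class (letter v + letter w)"
    "tensor_class (letter (c \<odot>\<^bsub>V\<^esub> v)) = tensor_class (scalar c * letter v)"
proof -
  have "letter (v \<oplus>\<^bsub>V\<^esub> w) - letter v - letter w \<in> linearity_relations V"
    "letter (c \<odot>\<^bsub>V\<^esub> v) - scalar c * letter v \<in> linearity_relations V"
    unfolding linearity_relations_def using assms by blast+
  note r = this[THEN relation_in_ideal[OF linearity_relations_carrier], folded tensor_ideal_def]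
  have "letter (v \<oplus>\<^bsub>V\<^esub> w) - (letter v + letter w) \<in> tensor_ideal V" using r(1) by (simp add: diff_diff_eq)
  then show "tensor_class (letter (v \<oplus>\<^bsub>V\<^esub> w)) = tensor_class (letter v + letter w)"
    using assms by (subst tensor_class_eq_iff) (auto simp: FA_letter FA_add)
  show "tensor_class (letter (c \<odot>\<^bsub>V\<^esub> v)) = tensor_class (scalar c * letter v)"
    using assms r(2) V.smult_closed[of c v] by (subst tensor_class_eq_iff) (auto simp: FA_letter FA_closed)
qed

lemma tensor_class_lincomb:
  assumes "finite A" "A \<subseteq> carrier V"
  shows "tensor_class (letter (V.lincomb a A)) = tensor_class (\<Sum>v\<in>A. scalar (a v) * letter v)"
  using assms
proof (induction A rule: finite_induct)
  case empty
  have "tensor_class (letter (0 \<odot>\<^bsub>V\<^esub> \<zero>\<^bsub>V\<^esub>)) = tensor_class 0"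
    using tensor_class_linear(2)[of "\<zero>\<^bsub>V\<^esub>" "\<zero>\<^bsub>V\<^esub>" 0] by simp
  then show ?case using V.smult_l_null[of "\<zero>\<^bsub>V\<^esub>"] by (simp add: V.lincomb_def)
next
  case (insert v A)
  have v: "v \<in> carrier V" using insert.prems by simp
  have f: "(\<lambda>v. a v \<odot>\<^bsub>V\<^esub> v) \<in> A \<rightarrow> carrier V" using insert.prems V.smult_closed by auto
  have c: "V.lincomb a A \<in> carrier V" "a v \<odot>\<^bsub>V\<^esub> v \<in> carrier V"
    using f v V.smult_closed[of "a v" v] by (auto simp: V.lincomb_def intro!: V.finsum_closed)
  have l: "letter v \<in> carrier FV" "letter (a v \<odot>\<^bsub>V\<^esub> v) \<in> carrier FV" "letter (V.lincomb a A) \<in> carrier FV"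
    "(\<Sum>v\<in>A. scalar (a v) * letter v) \<in> carrier FV"
    using v c insert.prems by (auto simp: FA_letter intro!: FA_closed)
  have "V.lincomb a (insert v A) = a v \<odot>\<^bsub>V\<^esub> v \<oplus>\<^bsub>V\<^esub> V.lincomb a A"
    using insert.hyps f c(2) by (simp add: V.lincomb_def V.finsum_insert)
  then have "tensor_class (letter (V.lincomb a (insert v A)))
    = tensor_class (letter (a v \<odot>\<^bsub>V\<^esub> v)) \<oplus>\<^bsub>tensor_algebra V\<^esub> tensor_class (letter (V.lincomb a A))"
    using tensor_class_linear(1)[OF c(2,1)] l by (simp add: tensor_class_add)
  also have "\<dots> = tensor_class (scalar (a v) * letter v) \<oplus>\<^bsub>tensor_algebra V\<^esub> tensor_class (\<Sum>v\<in>A. scalar (a v) * letter v)"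
    using insert.IH insert.prems tensor_class_linear(2)[OF v v, of "a v"] by simp
  also have "\<dots> = tensor_class (\<Sum>v\<in>insert v A. scalar (a v) * letter v)"
    using l insert.hyps by (simp add: tensor_class_add FA_closed)
  finally show ?case .
qed

context
  fixes H :: "('v word \<Rightarrow>\<^sub>0 complex) set set"
  assumes H: "ideal H (tensor_algebra V)"
begin

interpretation T: ring "tensor_algebra V" by (rule tensor_ring)
interpretation H: ideal H "tensor_algebra V" by (rule H)

lemma ideal_class_scale:
  "p \<in> carrier FV \<Longrightarrow> tensor_class p \<in> H \<Longrightarrow> tensor_class (scalar c * p) \<in> H"
  using H.I_l_closed[of "tensor_class p" "tensor_class (scalar c)"]
  by (simp add: tensor_class_in tensor_class_mult FA_scalar)

lemma ideal_class_add:
  "p \<in> carrier FV \<Longrightarrow> r \<in> carrier FV \<Longrightarrow> tensor_class p \<in> H \<Longrightarrow> tensor_class r \<in> H \<Longrightarrow> tensor_class (p + r) \<in> H"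
  using H.a_closed[of "tensor_class p" "tensor_class r"] by (simp add: tensor_class_add)

lemma ideal_class_sum:
  "(\<And>k. k \<in> K \<Longrightarrow> f k \<in> carrier FV \<and> tensor_class (f k) \<in> H) \<Longrightarrow> tensor_class (sum f K) \<in> H"
proof (induction K rule: infinite_finite_induct)
  case (insert k K)
  then show ?case by (simp add: ideal_class_add FA_sum)
qed (use H.zero_closed in \<open>simp_all add: tensor_class_zero\<close>)

end

end

section \<open>Relations of the quantum exterior algebra\<close>

context
  fixes n :: nat and q :: real
  assumes q: "q \<noteq> - 1" "q \<noteq> 0" "q \<noteq> 1"
begin

abbreviation "Forms \<equiv> Lambda1 n q"
abbreviation "Tens \<equiv> tensor_algebra Forms"
abbreviation "cl \<equiv> tensor_class Forms"

definition ee :: "nat \<times> nat \<Rightarrow> nat \<times> nat \<Rightarrow> form word \<Rightarrow>\<^sub>0 complex"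
  where "ee \<beta> \<gamma> = letter (e_root n q \<beta>) * letter (e_root n q \<gamma>)"

definition ordered_pairs :: "((nat \<times> nat) \<times> (nat \<times> nat)) set"
  where "ordered_pairs = {(\<beta>, \<gamma>). \<beta> \<in> pos_roots n \<and> \<gamma> \<in> pos_roots n \<and> root_le \<beta> \<gamma>}"

interpretation L: vectorspace class_ring Forms by (rule Lambda1_vectorspace)
interpretation T: ring Tens by (rule tensor_ring[OF Lambda1_module])

lemma letter_e: "\<beta> \<in> pos_roots n \<Longrightarrow> letter (e_root n q \<beta>) \<in> carrier (FV Forms)"
  by (simp add: FA_letter e_root_in[OF q])

lemma ee_in: "\<beta> \<in> pos_roots n \<Longrightarrow> \<gamma> \<in> pos_roots n \<Longrightarrow> ee \<beta> \<gamma> \<in> carrier (FV Forms)"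
  by (simp add: ee_def letter_e FA_mult)

lemma nested_roots:
  "\<beta> \<in> pos_roots n \<Longrightarrow> \<gamma> \<in> pos_roots n \<Longrightarrow> nested \<beta> \<gamma> \<Longrightarrow> (fst \<beta>, snd \<gamma>) \<in> pos_roots n \<and> (fst \<gamma>, snd \<beta>) \<in> pos_roots n"
  by (auto simp: nested_def pos_roots_def)

lemma relator_in: "\<beta> \<in> pos_roots n \<Longrightarrow> \<gamma> \<in> pos_roots n \<Longrightarrow> relator n q ee \<beta> \<gamma> \<in> carrier (FV Forms)"
  unfolding relator_def using nested_roots[of \<beta> \<gamma>] by (auto intro!: FA_closed ee_in)

lemma exterior_relator_eq:
  assumes "\<beta> \<in> pos_roots n" "\<gamma> \<in> pos_roots n" "root_le \<beta> \<gamma>"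
  shows "exterior_relator n q \<beta> \<gamma> = cl (relator n q ee \<beta> \<gamma>)"
proof -
  have t: "tensor2 Forms (e_root n q \<delta>) (e_root n q \<eta>) = cl (ee \<delta> \<eta>)" if "\<delta> \<in> pos_roots n" "\<eta> \<in> pos_roots n" for \<delta> \<eta>
    using that by (simp add: tensor2_eq[OF Lambda1_module] tensor_class_mult[OF Lambda1_module] letter_e ee_def)
  note r = tensor_class_smult[OF Lambda1_module] tensor_class_add[OF Lambda1_module] ee_in FA_closed
  show ?thesis
  proof (cases "nested \<beta> \<gamma>")
    case True
    then have "root_inner n \<beta> \<gamma> = 0 \<and> root_prec n \<beta> \<gamma>" using nested_iff assms by blast
    then show ?thesis
      using True assms nested_roots[OF assms(1,2) True] by (simp add: exterior_relator_def Let_def t r relator_def del: e_root.simps)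
  next
    case False
    then have "\<not> (root_inner n \<beta> \<gamma> = 0 \<and> root_prec n \<beta> \<gamma>)" using nested_iff assms by blast
    then show ?thesis
      using False assms by (simp only: exterior_relator_def Let_def if_False) (simp add: t r relator_def del: e_root.simps)
  qed
qed

lemma exterior_relations_eq: "exterior_relations n q = (\<lambda>(\<beta>, \<gamma>). cl (relator n q ee \<beta> \<gamma>)) ` ordered_pairs"
proof (intro equalityI subsetI)
  fix z assume "z \<in> exterior_relations n q"
  then obtain \<beta> \<gamma> where "z = exterior_relator n q \<beta> \<gamma>" "\<beta> \<in> pos_roots n" "\<gamma> \<in> pos_roots n" "root_le \<beta> \<gamma>"
    unfolding exterior_relations_def by blast
  then show "z \<in> (\<lambda>(\<beta>, \<gamma>). cl (relator n q ee \<beta> \<gamma>)) ` ordered_pairs"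
    by (intro image_eqI[of _ _ "(\<beta>, \<gamma>)"]) (simp_all add: exterior_relator_eq ordered_pairs_def)
next
  fix z assume "z \<in> (\<lambda>(\<beta>, \<gamma>). cl (relator n q ee \<beta> \<gamma>)) ` ordered_pairs"
  then obtain \<beta> \<gamma> where r: "\<beta> \<in> pos_roots n" "\<gamma> \<in> pos_roots n" "root_le \<beta> \<gamma>" "z = cl (relator n q ee \<beta> \<gamma>)"
    unfolding ordered_pairs_def by blast
  then have "z = exterior_relator n q \<beta> \<gamma>" by (simp add: exterior_relator_eq)
  then show "z \<in> exterior_relations n q" unfolding exterior_relations_def using r by blast
qed

lemma class_letter_expand:
  assumes y: "y \<in> carrier (Oq_plus n q)"
  shows "cl (letter (form_class n q y)) = cl (\<Sum>\<delta>\<in>pos_roots n. scalar (y (E_root n q \<delta>)) * letter (e_root n q \<delta>))"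
proof -
  have v: "form_class n q y \<in> carrier Forms" using y by (simp add: Lambda1_carrier)
  obtain a where a: "form_class n q y = L.lincomb a (e_root n q ` pos_roots n)"
    "\<And>\<delta>. \<delta> \<in> pos_roots n \<Longrightarrow> a (e_root n q \<delta>) = form_val n q \<delta> (form_class n q y)"
    using form_expand[OF q v] by blast
  have "cl (letter (form_class n q y)) = cl (\<Sum>v\<in>e_root n q ` pos_roots n. scalar (a v) * letter v)"
    unfolding a(1) using finite_pos_roots e_root_in[OF q] by (intro tensor_class_lincomb[OF Lambda1_module]) auto
  also have "(\<Sum>v\<in>e_root n q ` pos_roots n. scalar (a v) * letter v)
    = (\<Sum>\<delta>\<in>pos_roots n. scalar (y (E_root n q \<delta>)) * letter (e_root n q \<delta>))"
    using e_root_inj[OF q] y by (simp add: sum.reindex a(2) form_val_class)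
  finally show ?thesis .
qed

text \<open>
  Expanding both tensor factors in the basis \<open>e\<^sub>\<beta>\<close> turns the element of \<open>I\<^sup>(\<^sup>2\<^sup>)\<close> given by \<open>x\<close> into the sum of
  the \<open>x(E\<^sub>\<beta> E\<^sub>\<gamma>) e\<^sub>\<beta> \<otimes> e\<^sub>\<gamma>\<close>, because the coproduct of \<open>x\<close> evaluates products.
\<close>

lemma I2_element:
  assumes x: "x \<in> annihilator n q" and cop: "Oq_coproduct n q x m a b"
  shows "(\<Oplus>\<^bsub>Tens\<^esub>k\<in>{..<m}. tensor2 Forms (form_class n q (plus_part n q (a k))) (form_class n q (plus_part n q (b k))))
    = cl (\<Sum>(\<beta>, \<gamma>)\<in>ordered_pairs. scalar (if \<beta> = \<gamma> then pairing n q x \<beta> \<gamma> / (1 + complex_of_real q * complex_of_real q)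
        else pairing n q x \<beta> \<gamma>) * relator n q ee \<beta> \<gamma>)"
proof -
  let ?P = "pos_roots n"
  define A where "A k = (\<Sum>\<delta>\<in>?P. scalar (a k (E_root n q \<delta>)) * letter (e_root n q \<delta>))" for k
  define B where "B k = (\<Sum>\<delta>\<in>?P. scalar (b k (E_root n q \<delta>)) * letter (e_root n q \<delta>))" for k
  have ab: "a k \<in> carrier (Oq n q)" "b k \<in> carrier (Oq n q)" if "k < m" for k
    using cop that by (auto simp: Oq_coproduct_def)
  have AB: "A k \<in> carrier (FV Forms)" "B k \<in> carrier (FV Forms)" for k
    unfolding A_def B_def by (auto intro!: FA_closed letter_e)
  have form_in: "letter (form_class n q y) \<in> carrier (FV Forms)" if "y \<in> carrier (Oq_plus n q)" for y
    using that by (simp add: FA_letter Lambda1_carrier)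
  have t2: "tensor2 Forms (form_class n q (plus_part n q (a k))) (form_class n q (plus_part n q (b k))) = cl (A k * B k)"
    if k: "k < m" for k
  proof -
    have "cl (letter (form_class n q (plus_part n q (a k)))) = cl (A k)"
      "cl (letter (form_class n q (plus_part n q (b k)))) = cl (B k)"
      using class_letter_expand plus_part[OF ab(1)[OF k]] plus_part[OF ab(2)[OF k]] by (simp_all add: A_def B_def)
    then show ?thesis using AB by (simp add: tensor2_eq[OF Lambda1_module] tensor_class_mult[OF Lambda1_module])
  qed
  have "(\<Oplus>\<^bsub>Tens\<^esub>k\<in>{..<m}. tensor2 Forms (form_class n q (plus_part n q (a k))) (form_class n q (plus_part n q (b k))))
    = (\<Oplus>\<^bsub>Tens\<^esub>k\<in>{..<m}. cl (A k * B k))"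
    using AB by (intro T.finsum_cong') (auto simp: t2 intro!: tensor_class_in[OF Lambda1_module] FA_mult)
  also have "\<dots> = cl (\<Sum>k<m. A k * B k)"
    using AB by (intro tensor_class_sum[OF Lambda1_module]) (auto intro!: FA_mult)
  also have "(\<Sum>k<m. A k * B k) = (\<Sum>\<beta>\<in>?P. \<Sum>\<gamma>\<in>?P. scalar (pairing n q x \<beta> \<gamma>) * ee \<beta> \<gamma>)"
  proof -
    have "(\<Sum>k<m. A k * B k) = (\<Sum>k<m. \<Sum>\<beta>\<in>?P. \<Sum>\<gamma>\<in>?P. scalar (a k (E_root n q \<beta>) * b k (E_root n q \<gamma>)) * ee \<beta> \<gamma>)"
    proof -
      have "scalar c * p * (scalar c' * p') = scalar (c * c') * (p * p')" for c c' and p p' :: "form word \<Rightarrow>\<^sub>0 complex"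
      proof -
        have "scalar c * p * (scalar c' * p') = scalar c * (p * scalar c') * p'" by (simp only: mult.assoc)
        also have "\<dots> = scalar (c * c') * (p * p')" by (simp only: scalar_central[of p c'] scalar_mult mult.assoc)
        finally show ?thesis .
      qed
      then show ?thesis by (simp add: A_def B_def sum_product ee_def)
    qed
    also have "\<dots> = (\<Sum>\<beta>\<in>?P. \<Sum>k<m. \<Sum>\<gamma>\<in>?P. scalar (a k (E_root n q \<beta>) * b k (E_root n q \<gamma>)) * ee \<beta> \<gamma>)"
      by (rule sum.swap)
    also have "\<dots> = (\<Sum>\<beta>\<in>?P. \<Sum>\<gamma>\<in>?P. \<Sum>k<m. scalar (a k (E_root n q \<beta>) * b k (E_root n q \<gamma>)) * ee \<beta> \<gamma>)"
      by (rule sum.cong[OF refl], rule sum.swap)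
    also have "\<dots> = (\<Sum>\<beta>\<in>?P. \<Sum>\<gamma>\<in>?P. scalar (pairing n q x \<beta> \<gamma>) * ee \<beta> \<gamma>)"
    proof (intro sum.cong refl)
      fix \<beta> \<gamma> assume "\<beta> \<in> ?P" "\<gamma> \<in> ?P"
      then have p: "pairing n q x \<beta> \<gamma> = (\<Sum>k<m. a k (E_root n q \<beta>) * b k (E_root n q \<gamma>))"
        using cop E_root_in by (simp add: Oq_coproduct_def pairing_def)
      have "scalar (sum f K) = (\<Sum>k\<in>K. scalar (f k) :: form word \<Rightarrow>\<^sub>0 complex)" for f :: "nat \<Rightarrow> complex" and K
        by (induction K rule: infinite_finite_induct) (auto simp: scalar_add)
      then show "(\<Sum>k<m. scalar (a k (E_root n q \<beta>) * b k (E_root n q \<gamma>)) * ee \<beta> \<gamma>) = scalar (pairing n q x \<beta> \<gamma>) * ee \<beta> \<gamma>"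
        by (simp add: p sum_distrib_right)
    qed
    finally show ?thesis .
  qed
  also have "\<dots> = (\<Sum>(\<beta>, \<gamma>)\<in>ordered_pairs. scalar (if \<beta> = \<gamma> then pairing n q x \<beta> \<gamma> / (1 + complex_of_real q * complex_of_real q)
        else pairing n q x \<beta> \<gamma>) * relator n q ee \<beta> \<gamma>)"
    unfolding ordered_pairs_def
  proof (rule sum_by_relators)
    show "pairing n q x \<gamma> \<beta> = complex_of_real (q powi root_inner n \<beta> \<gamma>) * pairing n q x \<beta> \<gamma>
        + (if crossing \<beta> \<gamma> then complex_of_real (q - inverse q) * pairing n q x (fst \<gamma>, snd \<beta>) (fst \<beta>, snd \<gamma>) else 0)"
      if "\<beta> \<in> pos_roots n" "\<gamma> \<in> pos_roots n" "root_le \<beta> \<gamma>" "\<beta> \<noteq> \<gamma>" for \<beta> \<gamma>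
      using x that by (intro pairing_swap q) (auto simp: annihilator_iff)
    show "complex_of_real q * complex_of_real q \<noteq> - 1" using q_facts[OF q] by simp
  qed simp
  finally show ?thesis .
qed

lemma ordered_pairs_in: "(\<beta>, \<gamma>) \<in> ordered_pairs \<Longrightarrow> relator n q ee \<beta> \<gamma> \<in> carrier (FV Forms)"
  by (auto simp: ordered_pairs_def intro: relator_in)

lemma finite_ordered_pairs: "finite ordered_pairs"
  by (rule finite_subset[of _ "pos_roots n \<times> pos_roots n"]) (auto simp: ordered_pairs_def finite_pos_roots)

lemma exterior_relations_carrier: "exterior_relations n q \<subseteq> carrier Tens"
  unfolding exterior_relations_eq using ordered_pairs_in by (auto intro!: tensor_class_in[OF Lambda1_module])

lemma I2_carrier: "I2 n q \<subseteq> carrier Tens"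
proof
  fix z assume "z \<in> I2 n q"
  then obtain x m a b where x: "x \<in> annihilator n q" "Oq_coproduct n q x m a b"
    "z = (\<Oplus>\<^bsub>Tens\<^esub>k\<in>{..<m}. tensor2 Forms (form_class n q (plus_part n q (a k))) (form_class n q (plus_part n q (b k))))"
    unfolding I2_def by blast
  show "z \<in> carrier Tens"
    unfolding x(3) I2_element[OF x(1,2)]
    by (intro tensor_class_in[OF Lambda1_module] FA_sum) (auto intro!: FA_mult FA_scalar ordered_pairs_in)
qed

lemma I2_in_relations: "I2 n q \<subseteq> Idl\<^bsub>Tens\<^esub> (exterior_relations n q)"
proof
  have H: "ideal (Idl\<^bsub>Tens\<^esub> (exterior_relations n q)) Tens" by (rule T.genideal_ideal[OF exterior_relations_carrier])
  have rel: "cl (relator n q ee \<beta> \<gamma>) \<in> Idl\<^bsub>Tens\<^esub> (exterior_relations n q)" if "(\<beta>, \<gamma>) \<in> ordered_pairs" for \<beta> \<gamma>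
  proof -
    have "cl (relator n q ee \<beta> \<gamma>) \<in> exterior_relations n q"
      unfolding exterior_relations_eq by (rule image_eqI[OF _ that]) simp
    then show ?thesis using T.genideal_self[OF exterior_relations_carrier] by blast
  qed
  fix z assume "z \<in> I2 n q"
  then obtain x m a b where x: "x \<in> annihilator n q" "Oq_coproduct n q x m a b"
    "z = (\<Oplus>\<^bsub>Tens\<^esub>k\<in>{..<m}. tensor2 Forms (form_class n q (plus_part n q (a k))) (form_class n q (plus_part n q (b k))))"
    unfolding I2_def by blast
  show "z \<in> Idl\<^bsub>Tens\<^esub> (exterior_relations n q)"
    unfolding x(3) I2_element[OF x(1,2)]
    by (rule ideal_class_sum[OF Lambda1_module H])
      (auto intro!: FA_mult FA_scalar ordered_pairs_in ideal_class_scale[OF Lambda1_module H] rel)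
qed

text \<open>
  The separating functional of an ordered pair gives a nonzero multiple of its relator, plus \<open>\<nu>\<close> times the
  relator of a nested pair if the pair is crossing.  As nested pairs are not crossing, their
  relators lie in the ideal, and the second term can be subtracted.
\<close>

lemma relations_in_I2: "exterior_relations n q \<subseteq> Idl\<^bsub>Tens\<^esub> (I2 n q)"
proof -
  let ?G = "Idl\<^bsub>Tens\<^esub> (I2 n q)"
  have G: "ideal ?G Tens" by (rule T.genideal_ideal[OF I2_carrier])
  have key: "\<exists>\<kappa>. \<kappa> \<noteq> 0 \<and> cl (scalar \<kappa> * relator n q ee \<beta> \<gamma>
      + (if crossing \<beta> \<gamma> then scalar (complex_of_real (q - inverse q)) * relator n q ee (fst \<gamma>, snd \<beta>) (fst \<beta>, snd \<gamma>) else 0)) \<in> ?G"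
    if p: "(\<beta>, \<gamma>) \<in> ordered_pairs" for \<beta> \<gamma>
  proof -
    have P: "\<beta> \<in> pos_roots n" "\<gamma> \<in> pos_roots n" "root_le \<beta> \<gamma>" using p by (auto simp: ordered_pairs_def)
    show ?thesis
    proof (rule separating_functional[OF q P])
    fix y \<kappa> assume y: "y \<in> annihilator n q" "\<kappa> \<noteq> 0"
      "\<And>\<delta> \<eta>. \<delta> \<in> pos_roots n \<Longrightarrow> \<eta> \<in> pos_roots n \<Longrightarrow> root_le \<delta> \<eta> \<Longrightarrow> pairing n q y \<delta> \<eta>
      = (if \<delta> = \<beta> \<and> \<eta> = \<gamma> then \<kappa>
         else if crossing \<beta> \<gamma> \<and> \<delta> = (fst \<gamma>, snd \<beta>) \<and> \<eta> = (fst \<beta>, snd \<gamma>) then complex_of_real (q - inverse q) else 0)"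
    obtain m a b where cop: "Oq_coproduct n q y m a b"
      using Oq_coproduct_exists[of y n q] y(1) by (auto simp: annihilator_iff)
    define w where "w = 1 + complex_of_real q * complex_of_real q"
    \<comment> \<open>The factor by which \<open>I2_element\<close> divides on the diagonal.\<close>
    have w: "w \<noteq> 0" using q_facts(3)[OF q] by (simp add: w_def add_eq_0_iff)
    define \<kappa>' where "\<kappa>' = (if \<beta> = \<gamma> then \<kappa> / w else \<kappa>)"
    define r where "r = (if crossing \<beta> \<gamma> then scalar (complex_of_real (q - inverse q)) * relator n q ee (fst \<gamma>, snd \<beta>) (fst \<beta>, snd \<gamma>) else 0)"
    define f where "f = (\<lambda>(\<delta>, \<eta>). scalar (if \<delta> = \<eta> then pairing n q y \<delta> \<eta> / w else pairing n q y \<delta> \<eta>) * relator n q ee \<delta> \<eta>)"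
    have "(\<Oplus>\<^bsub>Tens\<^esub>k\<in>{..<m}. tensor2 Forms (form_class n q (plus_part n q (a k))) (form_class n q (plus_part n q (b k)))) \<in> I2 n q"
      unfolding I2_def using y(1) cop by blast
    then have in_G: "cl (sum f ordered_pairs) \<in> ?G"
      unfolding I2_element[OF y(1) cop] f_def w_def by (rule subsetD[OF T.genideal_self[OF I2_carrier]])
    have f_main: "f (\<beta>, \<gamma>) = scalar \<kappa>' * relator n q ee \<beta> \<gamma>"
      using y(3)[OF P] by (cases "\<beta> = \<gamma>") (simp_all add: f_def \<kappa>'_def)
    have f_zero: "f (\<delta>, \<eta>) = 0" if "(\<delta>, \<eta>) \<in> ordered_pairs" "\<not> (\<delta> = \<beta> \<and> \<eta> = \<gamma>)"
      "\<not> (crossing \<beta> \<gamma> \<and> \<delta> = (fst \<gamma>, snd \<beta>) \<and> \<eta> = (fst \<beta>, snd \<gamma>))" for \<delta> \<eta>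
    proof -
      have in1: "\<delta> \<in> pos_roots n" "\<eta> \<in> pos_roots n" "root_le \<delta> \<eta>" using that(1) by (auto simp: ordered_pairs_def)
      have "pairing n q y \<delta> \<eta> = 0"
        unfolding y(3)[OF in1] using that(2,3) by (simp only: if_False)
      then show ?thesis by (cases "\<delta> = \<eta>") (simp_all add: f_def)
    qed
    have "sum f ordered_pairs = scalar \<kappa>' * relator n q ee \<beta> \<gamma> + r"
    proof (cases "crossing \<beta> \<gamma>")
      case False
      have "sum f ordered_pairs = sum f {(\<beta>, \<gamma>)}"
      proof (rule sum.mono_neutral_right[OF finite_ordered_pairs])
        show "\<forall>p\<in>ordered_pairs - {(\<beta>, \<gamma>)}. f p = 0" using f_zero False by auto
      qed (use p in simp)
      then show ?thesis using False f_main by (simp add: r_def)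
    next
      case True
      obtain i j k l where ij: "\<beta> = (i, j)" "\<gamma> = (k, l)" by (cases \<beta>; cases \<gamma>)
      let ?c = "((fst \<gamma>, snd \<beta>), (fst \<beta>, snd \<gamma>))"
      have c: "?c \<in> ordered_pairs" and ne: "?c \<noteq> (\<beta>, \<gamma>)" "fst ?c \<noteq> snd ?c" "\<beta> \<noteq> \<gamma>"
        using crossing_nested[of i j k l n] True P by (auto simp: ij ordered_pairs_def crossing_def)
      have "sum f ordered_pairs = sum f {(\<beta>, \<gamma>), ?c}"
      proof (rule sum.mono_neutral_right[OF finite_ordered_pairs])
        show "{(\<beta>, \<gamma>), ?c} \<subseteq> ordered_pairs" using p c by simp
        show "\<forall>p\<in>ordered_pairs - {(\<beta>, \<gamma>), ?c}. f p = 0"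
        proof
          fix p assume "p \<in> ordered_pairs - {(\<beta>, \<gamma>), ?c}"
          then show "f p = 0" by (cases p) (rule ssubst, assumption, rule f_zero, auto)
        qed
      qed
      also have "\<dots> = f (\<beta>, \<gamma>) + f ?c" using not_sym[OF ne(1)] by (subst sum.insert) auto
      also have "f ?c = r"
      proof -
        have "pairing n q y (fst \<gamma>, snd \<beta>) (fst \<beta>, snd \<gamma>) = complex_of_real (q - inverse q)"
          using y(3)[of "(fst \<gamma>, snd \<beta>)" "(fst \<beta>, snd \<gamma>)"] c ne(1) True unfolding ordered_pairs_def by auto
        then show ?thesis using True ne(2) by (auto simp: f_def r_def)
      qed
      also have "f (\<beta>, \<gamma>) = scalar \<kappa>' * relator n q ee \<beta> \<gamma>" by (rule f_main)
      finally show ?thesis .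
    qed
    then show ?thesis using in_G y(2) w by (intro exI[of _ \<kappa>']) (simp add: r_def \<kappa>'_def)
    qed
  qed
  have unscale: "cl p \<in> ?G" if "\<kappa> \<noteq> 0" "cl (scalar \<kappa> * p) \<in> ?G" "p \<in> carrier (FV Forms)" for \<kappa> p
    using ideal_class_scale[OF Lambda1_module G, of "scalar \<kappa> * p" "inverse \<kappa>"] that
    by (simp add: FA_closed flip: mult.assoc scalar_mult)
  have base: "cl (relator n q ee \<beta> \<gamma>) \<in> ?G" if p: "(\<beta>, \<gamma>) \<in> ordered_pairs" and nc: "\<not> crossing \<beta> \<gamma>" for \<beta> \<gamma>
    using key[OF p] nc unscale ordered_pairs_in[OF p] by auto
  have "cl (relator n q ee \<beta> \<gamma>) \<in> ?G" if p: "(\<beta>, \<gamma>) \<in> ordered_pairs" for \<beta> \<gamma>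
  proof (cases "crossing \<beta> \<gamma>")
    case True
    obtain i j k l where ij: "\<beta> = (i, j)" "\<gamma> = (k, l)" by (cases \<beta>; cases \<gamma>)
    define R where "R = relator n q ee (k, j) (i, l)"
    have c: "((k, j), (i, l)) \<in> ordered_pairs" "\<not> crossing (k, j) (i, l)"
      using crossing_nested[of i j k l n] True p by (auto simp: ij ordered_pairs_def)
    have R: "R \<in> carrier (FV Forms)" "cl R \<in> ?G" unfolding R_def using base[OF c] ordered_pairs_in[OF c(1)] by auto
    obtain \<kappa> where \<kappa>: "\<kappa> \<noteq> 0" "cl (scalar \<kappa> * relator n q ee \<beta> \<gamma> + scalar (complex_of_real (q - inverse q)) * R) \<in> ?G"
      using key[OF p] True by (auto simp: ij R_def)
    have "cl ((scalar \<kappa> * relator n q ee \<beta> \<gamma> + scalar (complex_of_real (q - inverse q)) * R) + scalar (- complex_of_real (q - inverse q)) * R) \<in> ?G"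
      using ordered_pairs_in[OF p] R(1)
      by (intro ideal_class_add[OF Lambda1_module G _ _ \<kappa>(2) ideal_class_scale[OF Lambda1_module G R]]) (auto intro!: FA_closed)
    also have "scalar (- complex_of_real (q - inverse q)) * R = - (scalar (complex_of_real (q - inverse q)) * R)"
      by (simp only: scalar_def single_uminus mult_minus_left)
    finally have "cl (scalar \<kappa> * relator n q ee \<beta> \<gamma>) \<in> ?G" by simp
    then show ?thesis using unscale[OF \<kappa>(1)] ordered_pairs_in[OF p] by blast
  qed (rule base[OF p])
  then show ?thesis unfolding exterior_relations_eq by auto
qed

lemma ideals_eq: "Idl\<^bsub>Tens\<^esub> (I2 n q) = Idl\<^bsub>Tens\<^esub> (exterior_relations n q)"
proof
  show "Idl\<^bsub>Tens\<^esub> (I2 n q) \<subseteq> Idl\<^bsub>Tens\<^esub> (exterior_relations n q)"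
    by (rule T.genideal_minimal[OF T.genideal_ideal[OF exterior_relations_carrier] I2_in_relations])
  show "Idl\<^bsub>Tens\<^esub> (exterior_relations n q) \<subseteq> Idl\<^bsub>Tens\<^esub> (I2 n q)"
    by (rule T.genideal_minimal[OF T.genideal_ideal[OF I2_carrier] relations_in_I2])
qed

end

theorem theorem3p10:
  fixes n :: nat and q :: real
  assumes "n \<ge> 1" and "q \<noteq> - 1" and "q \<noteq> 0" and "q \<noteq> 1"
  shows "vectorspace (class_ring :: complex ring) (Lambda1 n q) \<and>
    inj_on (e_root n q) (pos_roots n) \<and>
    vectorspace.basis (class_ring :: complex ring) (Lambda1 n q) (e_root n q ` pos_roots n) \<and>
    quantum_exterior n q =
      (let T = tensor_algebra (Lambda1 n q)
       in quotient_algebra T (Idl\<^bsub>T\<^esub> (exterior_relations n q)))"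
  using Lambda1_vectorspace e_root_inj[OF assms(2-)] e_root_basis[OF assms(2-)] ideals_eq[OF assms(2-)]
  by (simp add: quantum_exterior_def Let_def)

end
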